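(* Let $M=G/K$ be a connected compact homogeneous space with $G$ a compact Lie group and $K\subset G$ the isotropy subgroup, let $Q$ be a bi-invariant (i.e. $\operatorname{Ad}(G)$-invariant) inner product on $\mathfrak{g}$, let $\mathfrak{g}=\mathfrak{k}\oplus\mathfrak{p}$ be the $Q$-orthogonal reductive decomposition, and let $\mathfrak{p}=\mathfrak{p}_1\oplus\dots\oplus\mathfrak{p}_r$ be a $Q$-orthogonal decomposition in $\operatorname{Ad}(K)$-invariant subspaces. Assume that the subspaces $\mathfrak{p}_k$ are all $\operatorname{Ad}(K)$-irreducible and pairwise inequivalent as $\operatorname{Ad}(K)$-representations. Then, for any $G$-invariant metric $g=x_1Q|_{\mathfrak{p}_1}+\dots+x_rQ|_{\mathfrak{p}_r}$ (with $x_1,\dots,x_r>0$), the entries of the matrix of $\operatorname{L}_{\mathfrak{p}}=\operatorname{L}_{\mathfrak{p}}(g)$, restricted to $\operatorname{sym}(\mathfrak{p})^K$, with respect to the orthonormal basis $\left\{\frac{1}{\sqrt{d_1}}I_1,\dots,\frac{1}{\sqrt{d_r}}I_r\right\}$ of $\operatorname{sym}(\mathfrak{p})^K$ are given by $$ [\operatorname{L}_{\mathfrak{p}}]_{kk}=\frac{1}{d_k}\sum_{i,j\neq k}\frac{x_k}{x_ix_j}[ijk]+\frac{1}{d_k}\sum_{i\neq k}\frac{x_i}{x_k^2}[ikk],\qquad k=1,\dots,r, $$ $$ [\operatorname{L}_{\mathfrak{p}}]_{km}=\frac{1}{\sqrt{d_k}\sqrt{d_m}}\sum_{i}\frac{x_i^2-x_k^2-x_m^2}{x_ix_kx_m}[ikm],\qquad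 k\neq m. $$ Here all summation indices range over $\{1,\dots,r\}$ subject to the indicated restrictions ($i,j$ range independently, both different from $k$, in the first sum).
   Context: Setting. $M$ is a compact connected manifold with a fixed almost-effective transitive action of a compact Lie group $G$; $K$ is the isotropy subgroup at a point $o\in M$, so $M=G/K$. $\mathfrak{g},\mathfrak{k}$ are the Lie algebras of $G,K$. The reductive complement $\mathfrak{p}$ is identified with $T_oM$, and a $G$-invariant metric $g$ is identified with the $\operatorname{Ad}(K)$-invariant inner product $\langle\cdot,\cdot\rangle:=g_o$ on $\mathfrak{p}$. Structural constants. $d_k:=\dim\mathfrak{p}_k$, and $$[ijk]:=\sum_{\alpha,\beta,\gamma}Q([e^i_\alpha,e^j_\beta],e^k_\gamma)^2,$$ where $\{e^i_\alpha\},\{e^j_\beta\},\{e^k_\gamma\}$ are $Q$-orthonormal bases of $\mathfrak{p}_i,\mathfrak{p}_j,\mathfrak{p}_k$, respectively. The number $[ijk]$ is invariant under permutations of $i,j,k$. Spaces and basis. $\operatorname{sym}(\mathfrak{p}):=\{A:\mathfrak{p}\to\mathfrak{p}\ \text{linear}: A^t=A\}$ (transpose with respect to $\langle\cdot,\cdot\rangle$) and $\operatorname{sym}(\mathfrak{p})^K:=\{A\in\operatorname{sym}(\mathfrak{p}):[\operatorname{Ad}(K),A]=0\}$, the maps commuting with $\operatorname{Ad}(k)|_{\mathfrak{p}}$ for all $k\in K$. The inner product on $\mathfrak{gl}(\mathfrak{p})$ is $\langle A,B\rangle:=\operatorname{tr}AB^t$. $I_k\in\operatorname{sym}(\mathfrak{p})$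 is the map that is the identity on $\mathfrak{p}_k$ and $0$ on $\mathfrak{p}_i$ for $i\neq k$. The operator $\operatorname{L}_{\mathfrak{p}}$. Let $\mu$ be the Lie bracket of $\mathfrak{g}$ and $\mu_{\mathfrak{p}}:=\operatorname{pr}_{\mathfrak{p}}\circ\mu|_{\mathfrak{p}\times\mathfrak{p}}:\mathfrak{p}\times\mathfrak{p}\to\mathfrak{p}$, with $\operatorname{pr}_{\mathfrak{p}}:\mathfrak{g}\to\mathfrak{p}$ the projection relative to $\mathfrak{g}=\mathfrak{k}\oplus\mathfrak{p}$. Thus $\mu_{\mathfrak{p}}\in\Lambda^2\mathfrak{p}^*\otimes\mathfrak{p}$, a space endowed with the inner product $\langle\lambda,\nu\rangle:=\sum_{i,j}\langle\lambda(X_i,X_j),\nu(X_i,X_j)\rangle$ for any $\langle\cdot,\cdot\rangle$-orthonormal basis $\{X_i\}$ of $\mathfrak{p}$. The representation $\theta$ of $\mathfrak{gl}(\mathfrak{p})$ on $\Lambda^2\mathfrak{p}^*\otimes\mathfrak{p}$ is $$\theta(A)\lambda:=A\lambda(\cdot,\cdot)-\lambda(A\cdot,\cdot)-\lambda(\cdot,A\cdot).$$ The moment map value $\operatorname{M}_{\mu_{\mathfrak{p}}}\in\operatorname{sym}(\mathfrak{p})$ is defined by $\langle\operatorname{M}_{\mu_{\mathfrak{p}}},A\rangle=\frac14\langle\theta(A)\mu_{\mathfrak{p}},\mu_{\mathfrak{p}}\rangle$ for all $A\in\mathfrak{gl}(\mathfrak{p})$. Then $\operatorname{L}_{\mathfrak{p}}=\operatorname{L}_{\mathfrak{p}}(g):\operatorname{sym}(\mathfrak{p})\to\operatorname{sym}(\mathfrak{p})$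 is the self-adjoint operator defined by $$\langle\operatorname{L}_{\mathfrak{p}}A,B\rangle=\tfrac12\langle\theta(A)\mu_{\mathfrak{p}},\theta(B)\mu_{\mathfrak{p}}\rangle+2\operatorname{tr}\operatorname{M}_{\mu_{\mathfrak{p}}}AB,\qquad\forall A,B\in\operatorname{sym}(\mathfrak{p}).$$ (It corresponds to the Lichnerowicz Laplacian of $g$ on $G$-invariant symmetric $2$-tensors.) The operator $\operatorname{L}_{\mathfrak{p}}$ leaves $\operatorname{sym}(\mathfrak{p})^K$ invariant. *)

theory Defs
  imports "HOL-Analysis.Analysis" "HOL-Algebra.Group_Action"
begin

section \<open>Smooth manifolds, Lie groups, homogeneous spaces\<close>

text \<open>The argument \<open>S\<close> is meant to be open.\<close>

primrec Ck_on :: "nat \<Rightarrow> ('a::euclidean_space \<Rightarrow> 'b::euclidean_space) \<Rightarrow> 'a set \<Rightarrow> bool" where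
  "Ck_on 0 f S \<longleftrightarrow> continuous_on S f"
| "Ck_on (Suc n) f S \<longleftrightarrow>
     (\<forall>x\<in>S. f differentiable (at x)) \<and> (\<forall>v. Ck_on n (\<lambda>x. frechet_derivative f (at x) v) S)"

definition smooth_on :: "'a set \<Rightarrow> ('a::euclidean_space \<Rightarrow> 'b::euclidean_space) \<Rightarrow> bool" where
  "smooth_on S f \<longleftrightarrow> (\<forall>n. Ck_on n f S)"

text \<open>A chart is a pair \<open>(U, \<phi>)\<close>. An atlas is not required to be maximal; the dimension of the
  manifold is \<open>DIM('b)\<close>.\<close>

locale smooth_manifold =
  fixes T :: "'m topology" and \<A> :: "('m set \<times> ('m \<Rightarrow> 'b::euclidean_space)) set"
  assumes Hausdorff: "Hausdorff_space T"
    and second_countable: "second_countable T"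
    and chart: "\<And>U \<phi>. (U, \<phi>) \<in> \<A> \<Longrightarrow>
          openin T U \<and> open (\<phi> ` U) \<and>
          homeomorphic_map (subtopology T U) (top_of_set (\<phi> ` U)) \<phi>"
    and cover: "\<Union> (fst ` \<A>) = topspace T"
    and transition: "\<And>U \<phi> V \<psi>. (U, \<phi>) \<in> \<A> \<Longrightarrow> (V, \<psi>) \<in> \<A> \<Longrightarrow>
          smooth_on (\<phi> ` (U \<inter> V)) (\<psi> \<circ> inv_into U \<phi>)"

definition smooth_map ::
  "'m topology \<Rightarrow> ('m set \<times> ('m \<Rightarrow> 'b::euclidean_space)) set \<Rightarrow>
   'n topology \<Rightarrow> ('n set \<times> ('n \<Rightarrow> 'c::euclidean_space)) set \<Rightarrow> ('m \<Rightarrow> 'n) \<Rightarrow> bool" where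
  "smooth_map T \<A> T' \<B> f \<longleftrightarrow>
     continuous_map T T' f \<and>
     (\<forall>(U, \<phi>)\<in>\<A>. \<forall>(V, \<psi>)\<in>\<B>. smooth_on (\<phi> ` (U \<inter> f -` V)) (\<psi> \<circ> f \<circ> inv_into U \<phi>))"

definition prod_atlas ::
  "('m set \<times> ('m \<Rightarrow> 'b)) set \<Rightarrow> ('n set \<times> ('n \<Rightarrow> 'c)) set \<Rightarrow>
   (('m \<times> 'n) set \<times> ('m \<times> 'n \<Rightarrow> 'b \<times> 'c)) set" where
  "prod_atlas \<A> \<B> = {(U \<times> V, map_prod \<phi> \<psi>) | U \<phi> V \<psi>. (U, \<phi>) \<in> \<A> \<and> (V, \<psi>) \<in> \<B>}"

locale lie_group = group G + smooth_manifold T \<A>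
  for G (structure) and T :: "'g topology" and \<A> :: "('g set \<times> ('g \<Rightarrow> 'b::euclidean_space)) set" +
  assumes topspace_eq: "topspace T = carrier G"
    and smooth_mult: "smooth_map (prod_topology T T) (prod_atlas \<A> \<A>) T \<A> (\<lambda>(g, h). g \<otimes> h)"
    and smooth_inv: "smooth_map T \<A> T \<A> (\<lambda>g. inv g)"

text \<open>A compact connected manifold \<open>M\<close> with an almost-effective (the kernel of the action is
  discrete) smooth transitive action of a compact Lie group \<open>G\<close>.\<close>

locale compact_homogeneous_space =
  lie_group G T \<A> + M: smooth_manifold TM \<A>M + transitive_action G "topspace TM" act
  for G (structure) and T :: "'g topology" and \<A> :: "('g set \<times> ('g \<Rightarrow> 'b::euclidean_space)) set"
    and TM :: "'m topology" and \<A>M :: "('m set \<times> ('m \<Rightarrow> 'c::euclidean_space)) set"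
    and act :: "'g \<Rightarrow> 'm \<Rightarrow> 'm" +
  assumes compact_G: "compact_space T"
    and compact_M: "compact_space TM"
    and connected_M: "connected_space TM"
    and smooth_action:
      "smooth_map (prod_topology T TM) (prod_atlas \<A> \<A>M) TM \<A>M (\<lambda>(g, m). act g m)"
    and almost_effective:
      "subtopology T (kernel G (BijGroup (topspace TM)) act)
       = discrete_topology (kernel G (BijGroup (topspace TM)) act)"

section \<open>The Lie algebra\<close>

text \<open>Given a chart \<open>(U, \<phi>)\<close> around the identity, the Lie algebra (the tangent space of \<open>G\<close> at
  the identity) is identified with the model space \<open>'b\<close> through the differential of \<open>\<phi>\<close> at the
  identity. The map \<open>Ad g\<close> is the differential at the identity of conjugation by \<open>g\<close>; the bracket
  is the differential of \<open>Ad\<close>, i.e. \<open>[X, Y] = d(Ad)(X) Y\<close>.\<close>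

definition Ad :: "('g, 'z) monoid_scheme \<Rightarrow> 'g set \<Rightarrow> ('g \<Rightarrow> 'b::euclidean_space) \<Rightarrow> 'g \<Rightarrow> 'b \<Rightarrow> 'b" where
  "Ad G U \<phi> g =
     frechet_derivative (\<lambda>y. \<phi> (g \<otimes>\<^bsub>G\<^esub> inv_into U \<phi> y \<otimes>\<^bsub>G\<^esub> inv\<^bsub>G\<^esub> g)) (at (\<phi> \<one>\<^bsub>G\<^esub>))"

definition lie_bracket ::
  "('g, 'z) monoid_scheme \<Rightarrow> 'g set \<Rightarrow> ('g \<Rightarrow> 'b::euclidean_space) \<Rightarrow> 'b \<Rightarrow> 'b \<Rightarrow> 'b" where
  "lie_bracket G U \<phi> X Y =
     frechet_derivative (\<lambda>x. Ad G U \<phi> (inv_into U \<phi> x) Y) (at (\<phi> \<one>\<^bsub>G\<^esub>)) X"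

text \<open>The Lie algebra of a closed subgroup \<open>K\<close>: all \<open>X\<close> such that \<open>exp (t X) \<in> K\<close> for all \<open>t\<close>,
  where \<open>t \<mapsto> exp (t X)\<close> is the one-parameter subgroup \<open>c\<close> of \<open>G\<close> with \<open>c'(0) = X\<close>.\<close>

definition lie_subalgebra ::
  "('g, 'z) monoid_scheme \<Rightarrow> 'g topology \<Rightarrow> ('g \<Rightarrow> 'b::euclidean_space) \<Rightarrow> 'g set \<Rightarrow> 'b set" where
  "lie_subalgebra G T \<phi> K =
     {X. \<exists>c :: real \<Rightarrow> 'g. continuous_map euclideanreal T c \<and>
           (\<forall>s t. c (s + t) = c s \<otimes>\<^bsub>G\<^esub> c t) \<and>
           ((\<lambda>t. \<phi> (c t)) has_vector_derivative X) (at 0) \<and>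
           (\<forall>t. c t \<in> K)}"

section \<open>Inner products and representations\<close>

definition inner_product_on :: "'a::real_vector set \<Rightarrow> ('a \<Rightarrow> 'a \<Rightarrow> real) \<Rightarrow> bool" where
  "inner_product_on V q \<longleftrightarrow>
     (\<forall>x\<in>V. \<forall>y\<in>V. q x y = q y x) \<and>
     (\<forall>x\<in>V. \<forall>y\<in>V. \<forall>z\<in>V. \<forall>a b. q (a *\<^sub>R x + b *\<^sub>R y) z = a * q x z + b * q y z) \<and>
     (\<forall>x\<in>V. x \<noteq> 0 \<longrightarrow> q x x > 0)"

definition orthonormal_basis :: "'a::real_vector set \<Rightarrow> ('a \<Rightarrow> 'a \<Rightarrow> real) \<Rightarrow> 'a set \<Rightarrow> bool" where
  "orthonormal_basis V q B \<longleftrightarrow>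
     B \<subseteq> V \<and> span B = V \<and> (\<forall>x\<in>B. \<forall>y\<in>B. q x y = (if x = y then 1 else 0))"

definition invariant_subspace :: "('g \<Rightarrow> 'b \<Rightarrow> 'b) \<Rightarrow> 'g set \<Rightarrow> 'b::real_vector set \<Rightarrow> bool" where
  "invariant_subspace \<rho> K V \<longleftrightarrow> subspace V \<and> (\<forall>g\<in>K. \<forall>v\<in>V. \<rho> g v \<in> V)"

definition irreducible_subrep :: "('g \<Rightarrow> 'b \<Rightarrow> 'b) \<Rightarrow> 'g set \<Rightarrow> 'b::real_vector set \<Rightarrow> bool" where
  "irreducible_subrep \<rho> K V \<longleftrightarrow>
     invariant_subspace \<rho> K V \<and> V \<noteq> {0} \<and>
     (\<forall>W. invariant_subspace \<rho> K W \<and> W \<subseteq> V \<longrightarrow> W = {0} \<or> W = V)"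

definition equivalent_subreps ::
  "('g \<Rightarrow> 'b \<Rightarrow> 'b) \<Rightarrow> 'g set \<Rightarrow> 'b::real_vector set \<Rightarrow> 'b set \<Rightarrow> bool" where
  "equivalent_subreps \<rho> K V W \<longleftrightarrow>
     (\<exists>f. linear f \<and> bij_betw f V W \<and> (\<forall>g\<in>K. \<forall>v\<in>V. f (\<rho> g v) = \<rho> g (f v)))"

section \<open>Endomorphisms of the reductive complement\<close>

text \<open>In the following, \<open>\<kk>\<close> and \<open>\<pp>\<close> are complementary subspaces of \<open>'b\<close> and \<open>ip\<close> is an inner
  product on \<open>\<pp>\<close>. A linear map \<open>\<pp> \<rightarrow> \<pp>\<close> is encoded by its extension by \<open>0\<close> on \<open>\<kk>\<close>; in particular
  its trace is the trace of the extension.\<close>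

definition proj_along :: "'b::real_vector set \<Rightarrow> 'b set \<Rightarrow> 'b \<Rightarrow> 'b" where
  "proj_along \<kk> \<pp> X = (THE Y. Y \<in> \<pp> \<and> X - Y \<in> \<kk>)"

definition gl_on :: "'b::euclidean_space set \<Rightarrow> 'b set \<Rightarrow> ('b \<Rightarrow>\<^sub>L 'b) set" where
  "gl_on \<kk> \<pp> = {A. (\<forall>X. blinfun_apply A X \<in> \<pp>) \<and> (\<forall>X\<in>\<kk>. blinfun_apply A X = 0)}"

definition endo_trace :: "('b::euclidean_space \<Rightarrow>\<^sub>L 'b) \<Rightarrow> real" where
  "endo_trace A = (\<Sum>b\<in>Basis. blinfun_apply A b \<bullet> b)"

definition transp :: "'b::euclidean_space set \<Rightarrow> 'b set \<Rightarrow> ('b \<Rightarrow> 'b \<Rightarrow> real) \<Rightarrow> ('b \<Rightarrow>\<^sub>L 'b) \<Rightarrow> ('b \<Rightarrow>\<^sub>L 'b)" where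
  "transp \<kk> \<pp> ip A =
     (THE B. B \<in> gl_on \<kk> \<pp> \<and> (\<forall>X\<in>\<pp>. \<forall>Y\<in>\<pp>. ip (blinfun_apply A X) Y = ip X (blinfun_apply B Y)))"

definition sym_on :: "'b::euclidean_space set \<Rightarrow> 'b set \<Rightarrow> ('b \<Rightarrow> 'b \<Rightarrow> real) \<Rightarrow> ('b \<Rightarrow>\<^sub>L 'b) set" where
  "sym_on \<kk> \<pp> ip = {A \<in> gl_on \<kk> \<pp>. transp \<kk> \<pp> ip A = A}"

definition sym_inv_on ::
  "'b::euclidean_space set \<Rightarrow> 'b set \<Rightarrow> ('b \<Rightarrow> 'b \<Rightarrow> real) \<Rightarrow> ('g \<Rightarrow> 'b \<Rightarrow> 'b) \<Rightarrow> 'g set \<Rightarrow> ('b \<Rightarrow>\<^sub>L 'b) set" where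
  "sym_inv_on \<kk> \<pp> ip \<rho> K =
     {A \<in> sym_on \<kk> \<pp> ip. \<forall>g\<in>K. \<forall>X\<in>\<pp>. blinfun_apply A (\<rho> g X) = \<rho> g (blinfun_apply A X)}"

definition gl_inner ::
  "'b::euclidean_space set \<Rightarrow> 'b set \<Rightarrow> ('b \<Rightarrow> 'b \<Rightarrow> real) \<Rightarrow> ('b \<Rightarrow>\<^sub>L 'b) \<Rightarrow> ('b \<Rightarrow>\<^sub>L 'b) \<Rightarrow> real" where
  "gl_inner \<kk> \<pp> ip A B = endo_trace (A o\<^sub>L transp \<kk> \<pp> ip B)"

section \<open>The operator L\<close>

text \<open>Elements of \<open>\<Lambda>\<^sup>2\<pp>\<^sup>* \<otimes> \<pp>\<close> are functions \<open>'b \<Rightarrow> 'b \<Rightarrow> 'b\<close> of which only the values on \<open>\<pp>\<close> matter.\<close>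

definition theta :: "('b::euclidean_space \<Rightarrow>\<^sub>L 'b) \<Rightarrow> ('b \<Rightarrow> 'b \<Rightarrow> 'b) \<Rightarrow> 'b \<Rightarrow> 'b \<Rightarrow> 'b" where
  "theta A \<nu> X Y =
     blinfun_apply A (\<nu> X Y) - \<nu> (blinfun_apply A X) Y - \<nu> X (blinfun_apply A Y)"

text \<open>The sum below does not depend on the choice of the orthonormal basis.\<close>

definition bracket_inner ::
  "'b::euclidean_space set \<Rightarrow> ('b \<Rightarrow> 'b \<Rightarrow> real) \<Rightarrow> ('b \<Rightarrow> 'b \<Rightarrow> 'b) \<Rightarrow> ('b \<Rightarrow> 'b \<Rightarrow> 'b) \<Rightarrow> real" where
  "bracket_inner \<pp> ip \<nu> \<nu>' =
     (let B = (SOME B. orthonormal_basis \<pp> ip B) in \<Sum>X\<in>B. \<Sum>Y\<in>B. ip (\<nu> X Y) (\<nu>' X Y))"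

definition moment_map ::
  "'b::euclidean_space set \<Rightarrow> 'b set \<Rightarrow> ('b \<Rightarrow> 'b \<Rightarrow> real) \<Rightarrow> ('b \<Rightarrow> 'b \<Rightarrow> 'b) \<Rightarrow> ('b \<Rightarrow>\<^sub>L 'b)" where
  "moment_map \<kk> \<pp> ip \<nu> =
     (THE M. M \<in> sym_on \<kk> \<pp> ip \<and>
        (\<forall>A\<in>gl_on \<kk> \<pp>. gl_inner \<kk> \<pp> ip M A = 1/4 * bracket_inner \<pp> ip (theta A \<nu>) \<nu>))"

definition L_op ::
  "'b::euclidean_space set \<Rightarrow> 'b set \<Rightarrow> ('b \<Rightarrow> 'b \<Rightarrow> real) \<Rightarrow> ('b \<Rightarrow> 'b \<Rightarrow> 'b) \<Rightarrow> ('b \<Rightarrow>\<^sub>L 'b) \<Rightarrow> ('b \<Rightarrow>\<^sub>L 'b)" where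
  "L_op \<kk> \<pp> ip \<nu> A =
     (THE C. C \<in> sym_on \<kk> \<pp> ip \<and>
        (\<forall>B\<in>sym_on \<kk> \<pp> ip. gl_inner \<kk> \<pp> ip C B =
           1/2 * bracket_inner \<pp> ip (theta A \<nu>) (theta B \<nu>)
           + 2 * endo_trace (moment_map \<kk> \<pp> ip \<nu> o\<^sub>L A o\<^sub>L B)))"

section \<open>Decompositions, diagonal metrics, structural constants\<close>

definition orthogonal_decomposition ::
  "('b::real_vector \<Rightarrow> 'b \<Rightarrow> real) \<Rightarrow> 'b set \<Rightarrow> 'i set \<Rightarrow> ('i \<Rightarrow> 'b set) \<Rightarrow> bool" where
  "orthogonal_decomposition q V I W \<longleftrightarrow>
     (\<forall>i\<in>I. subspace (W i)) \<and>
     (\<forall>i\<in>I. \<forall>j\<in>I. i \<noteq> j \<longrightarrow> (\<forall>x\<in>W i. \<forall>y\<in>W j. q x y = 0)) \<and>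
     V = {\<Sum>i\<in>I. w i | w. \<forall>i\<in>I. w i \<in> W i}"

text \<open>\<open>I\<^sub>k\<close>, extended by \<open>0\<close> on \<open>\<kk>\<close> through \<open>gl_on\<close>.\<close>

definition block_id ::
  "'b::euclidean_space set \<Rightarrow> 'b set \<Rightarrow> nat \<Rightarrow> (nat \<Rightarrow> 'b set) \<Rightarrow> nat \<Rightarrow> ('b \<Rightarrow>\<^sub>L 'b)" where
  "block_id \<kk> \<pp> r P k =
     (THE A. A \<in> gl_on \<kk> \<pp> \<and> (\<forall>X\<in>P k. blinfun_apply A X = X) \<and>
        (\<forall>i\<in>{1..r} - {k}. \<forall>X\<in>P i. blinfun_apply A X = 0))"

text \<open>The inner product \<open>x\<^sub>1 Q|\<^bsub>P 1\<^esub> + \<dots> + x\<^sub>r Q|\<^bsub>P r\<^esub>\<close>; as a form on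
  \<open>'b\<close> it vanishes on \<open>\<kk>\<close>, so it is an inner product on \<open>\<pp>\<close> only.\<close>

definition diag_metric ::
  "'b::euclidean_space set \<Rightarrow> 'b set \<Rightarrow> nat \<Rightarrow> (nat \<Rightarrow> 'b set) \<Rightarrow> ('b \<Rightarrow> 'b \<Rightarrow> real) \<Rightarrow> (nat \<Rightarrow> real)
   \<Rightarrow> 'b \<Rightarrow> 'b \<Rightarrow> real" where
  "diag_metric \<kk> \<pp> r P Q x X Y =
     (\<Sum>i\<in>{1..r}. x i * Q (blinfun_apply (block_id \<kk> \<pp> r P i) X) (blinfun_apply (block_id \<kk> \<pp> r P i) Y))"

definition struct_const ::
  "('b \<Rightarrow> 'b \<Rightarrow> real) \<Rightarrow> ('b \<Rightarrow> 'b \<Rightarrow> 'b) \<Rightarrow> (nat \<Rightarrow> 'b set) \<Rightarrow> nat \<Rightarrow> nat \<Rightarrow> nat \<Rightarrow> real" where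
  "struct_const Q br E i j k = (\<Sum>a\<in>E i. \<Sum>b\<in>E j. \<Sum>c\<in>E k. (Q (br a b) c)\<^sup>2)"

text \<open>The \<open>(k, m)\<close> entry of the matrix of \<open>T\<close> with respect to the basis \<open>(e i)\<^sub>i\<close>, \<open>i \<in> I\<close>: the
  coefficient of \<open>e k\<close> in \<open>T (e m)\<close>.\<close>

definition matrix_entry :: "'i set \<Rightarrow> ('i \<Rightarrow> 'v::real_vector) \<Rightarrow> ('v \<Rightarrow> 'v) \<Rightarrow> 'i \<Rightarrow> 'i \<Rightarrow> real" where
  "matrix_entry I e T k m = representation (e ` I) (T (e m)) (e k)"

end

theory Submission
  imports Defs
begin

text \<open>
  Since \<open>Q\<close> is positive definite, \<open>\<kk>\<close> is the \<open>Q\<close>-orthogonal complement of \<open>\<pp>\<close>, so the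
  only facts about the Lie group that enter are: \<open>Ad\<close> is a linear representation preserving the
  bracket, the bracket is antisymmetric (symmetry of the second derivative of the multiplication), and
  \<open>ad X\<close> is \<open>Q\<close>-skew (derivative of the invariance of \<open>Q\<close>); the last two make \<open>[ijk]\<close> symmetric.

  For \<open>A = I\<^sub>m\<close>, \<open>B = I\<^sub>k\<close> the moment map term of \<open>\<langle>L A, B\<rangle>\<close> is
  \<open>1/2 \<langle>\<theta>(B A)\<mu>, \<mu>\<rangle>\<close>. In an orthonormal basis adapted to the \<open>\<pp>\<^sub>i\<close>, the operator
  \<open>\<theta>(I\<^sub>k)\<close> multiplies the component \<open>\<pp>\<^sub>i \<times> \<pp>\<^sub>j \<rightarrow> \<pp>\<^sub>l\<close> of \<open>\<mu>\<close>, whose square norm is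
  \<open>x\<^sub>l / (x\<^sub>i x\<^sub>j) [ijl]\<close>, by \<open>\<delta>\<^sub>k\<^sub>l - \<delta>\<^sub>k\<^sub>i - \<delta>\<^sub>k\<^sub>j\<close>; the matrix entries are sums of these weights.
  Schur's lemma shows that the \<open>I\<^sub>k\<close> span the invariant symmetric maps, and \<open>L\<close> preserves invariance
  because \<open>L A\<close> is the unique symmetric map representing an \<open>Ad(K)\<close>-invariant form.
\<close>

section \<open>Second derivatives and the Lie bracket\<close>

text \<open>Much of the work comes from the form of the definitions. \<open>transp\<close>,
  \<open>moment_map\<close>, \<open>L_op\<close>, \<open>block_id\<close> and
  \<open>proj_along\<close> are definite descriptions, so each needs an explicit formula in an
  orthonormal basis or a Riesz argument before it can be computed with. \<open>\<kk>\<close>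
  consists of velocities of one-parameter subgroups, where neither linearity nor stability under
  \<open>Ad\<close> is visible; both are read off from Q-orthogonality to \<open>\<pp>\<close>. The
  bracket is a derivative of \<open>Ad\<close> in an arbitrary chart at the identity, so the
  differentiability of x \<mapsto> Ad(x) Y has to be extracted from the second derivatives of the
  multiplication; the same computation yields antisymmetry. To keep linear algebra free of
  relativisation to \<open>\<pp>\<close>, the metric is handled as a degenerate form on the whole
  model space with kernel \<open>\<kk>\<close>, for which projections, transposes and traces are
  plain sums over a basis.\<close>

lemma smooth_on_differentiable: "smooth_on S f \<Longrightarrow> p \<in> S \<Longrightarrow> f differentiable (at p)"
  unfolding smooth_on_def by (metis Ck_on.simps(2))

lemma smooth_on_frechet_derivative:
  "smooth_on S f \<Longrightarrow> smooth_on S (\<lambda>p. frechet_derivative f (at p) v)"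
  unfolding smooth_on_def by (metis Ck_on.simps(2))

lemma smooth_on_continuous_on: "smooth_on S f \<Longrightarrow> continuous_on S f"
  unfolding smooth_on_def by (metis Ck_on.simps(1))

text \<open>The mean value theorem is used twice on the second difference over a parallelogram:
  along \<open>u\<close> for the difference of \<open>F\<close> across the \<open>v\<close> side,
  then along \<open>v\<close> for the derivative in direction \<open>u\<close>. The intermediate
  point is uncontrolled, but it stays in the parallelogram.\<close>

lemma mixed_difference_mean_value:
  fixes F :: "'a::real_normed_vector \<Rightarrow> real"
  assumes F: "\<And>q. q \<in> S \<Longrightarrow> (F has_derivative F' q) (at q)"
    and Fu: "\<And>q. q \<in> S \<Longrightarrow> ((\<lambda>q. F' q u) has_derivative Fu' q) (at q)"
    and h: "h > 0"
    and S: "\<And>s t. \<lbrakk>0 \<le> s; s \<le> h; 0 \<le> t; t \<le> h\<rbrakk> \<Longrightarrow> p + s *\<^sub>R u + t *\<^sub>R v \<in> S"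
  shows "\<exists>s\<in>{0..h}. \<exists>t\<in>{0..h}.
    F (p + h *\<^sub>R u + h *\<^sub>R v) - F (p + h *\<^sub>R u) - (F (p + h *\<^sub>R v) - F p)
      = h\<^sup>2 * Fu' (p + s *\<^sub>R u + t *\<^sub>R v) v"
proof -
  define g where "g s = F (p + s *\<^sub>R u + h *\<^sub>R v) - F (p + s *\<^sub>R u)" for s
  define g' where "g' s k = k * (F' (p + s *\<^sub>R u + h *\<^sub>R v) u - F' (p + s *\<^sub>R u) u)" for s k
  have "\<exists>s\<in>{0<..<h}. g h - g 0 = g' s (h - 0)"
  proof (rule mvt_simple[OF h])
    fix s :: real assume s: "0 \<le> s" "s \<le> h"
    have i1: "p + s *\<^sub>R u + h *\<^sub>R v \<in> S" using S[of s h] s h by simp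
    have i2: "p + s *\<^sub>R u \<in> S" using S[of s 0] s h by simp
    have l1: "linear (F' (p + s *\<^sub>R u + h *\<^sub>R v))" "linear (F' (p + s *\<^sub>R u))"
      using F[OF i1] F[OF i2] has_derivative_linear by auto
    have "((\<lambda>s. F (p + s *\<^sub>R u + h *\<^sub>R v)) has_derivative (\<lambda>k. F' (p + s *\<^sub>R u + h *\<^sub>R v) (k *\<^sub>R u))) (at s within {0..h})"
      by (rule has_derivative_compose[where g=F and f="\<lambda>s. p + s *\<^sub>R u + h *\<^sub>R v", OF _ F[OF i1]]) (auto intro!: derivative_eq_intros)
    moreover have "((\<lambda>s. F (p + s *\<^sub>R u)) has_derivative (\<lambda>k. F' (p + s *\<^sub>R u) (k *\<^sub>R u))) (at s within {0..h})"
      by (rule has_derivative_compose[where g=F and f="\<lambda>s. p + s *\<^sub>R u", OF _ F[OF i2]]) (auto intro!: derivative_eq_intros)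
    ultimately show "(g has_derivative g' s) (at s within {0..h})"
      unfolding g_def g'_def
      by (auto intro!: derivative_eq_intros simp: linear_cmul[OF l1(1)] linear_cmul[OF l1(2)] right_diff_distrib)
  qed
  then obtain s where s: "0 < s" "s < h" and gs: "g h - g 0 = g' s h" by auto
  define f where "f t = F' (p + s *\<^sub>R u + t *\<^sub>R v) u" for t
  have "\<exists>t\<in>{0<..<h}. f h - f 0 = (\<lambda>k. Fu' (p + s *\<^sub>R u + t *\<^sub>R v) (k *\<^sub>R v)) (h - 0)"
  proof (rule mvt_simple[OF h])
    fix t :: real assume t: "0 \<le> t" "t \<le> h"
    have i1: "p + s *\<^sub>R u + t *\<^sub>R v \<in> S" using S[of s t] s t by simp
    show "(f has_derivative (\<lambda>k. Fu' (p + s *\<^sub>R u + t *\<^sub>R v) (k *\<^sub>R v))) (at t within {0..h})"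
      unfolding f_def
      by (rule has_derivative_compose[where g="\<lambda>q. F' q u" and f="\<lambda>t. p + s *\<^sub>R u + t *\<^sub>R v", OF _ Fu[OF i1]]) (auto intro!: derivative_eq_intros)
  qed
  then obtain t where t: "0 < t" "t < h"
    and ft: "f h - f 0 = Fu' (p + s *\<^sub>R u + t *\<^sub>R v) (h *\<^sub>R v)" by auto
  have "linear (Fu' (p + s *\<^sub>R u + t *\<^sub>R v))"
    using Fu[OF S[of s t]] s t has_derivative_linear by auto
  with ft have "f h - f 0 = h * Fu' (p + s *\<^sub>R u + t *\<^sub>R v) v" by (simp add: linear_cmul)
  then have "g h - g 0 = h\<^sup>2 * Fu' (p + s *\<^sub>R u + t *\<^sub>R v) v"
    unfolding gs by (simp add: g'_def f_def power2_eq_square)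
  then show ?thesis using s t by (intro bexI[of _ s] bexI[of _ t]) (auto simp: g_def)
qed

text \<open>The second difference is symmetric in \<open>u\<close> and \<open>v\<close>. Evaluating
  it by the mean value theorem in both orders equates the two mixed derivatives at two points near
  \<open>p\<close>, and continuity at \<open>p\<close> closes the gap.\<close>

lemma frechet_derivative_commute_real:
  fixes F :: "'a::real_normed_vector \<Rightarrow> real"
  assumes "open S" "p \<in> S"
    and F: "\<And>q. q \<in> S \<Longrightarrow> (F has_derivative F' q) (at q)"
    and Fu: "\<And>q. q \<in> S \<Longrightarrow> ((\<lambda>q. F' q u) has_derivative Fu' q) (at q)"
    and Fv: "\<And>q. q \<in> S \<Longrightarrow> ((\<lambda>q. F' q v) has_derivative Fv' q) (at q)"
    and cu: "isCont (\<lambda>q. Fu' q v) p" and cv: "isCont (\<lambda>q. Fv' q u) p"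
  shows "Fu' p v = Fv' p u"
proof (rule ccontr)
  assume ne: "Fu' p v \<noteq> Fv' p u"
  \<comment> \<open>Half the gap: values strictly within \<open>\<epsilon>\<close> of the two
    different limits cannot coincide.\<close>
  define \<epsilon> where "\<epsilon> = \<bar>Fu' p v - Fv' p u\<bar> / 2"
  have \<epsilon>: "\<epsilon> > 0" using ne by (simp add: \<epsilon>_def)
  obtain d0 where d0: "d0 > 0" "ball p d0 \<subseteq> S" using assms(1,2) openE by blast
  obtain d1 where d1: "d1 > 0" "\<And>q. dist q p < d1 \<Longrightarrow> \<bar>Fu' q v - Fu' p v\<bar> < \<epsilon>"
    using cu \<epsilon> unfolding continuous_at_eps_delta by (auto simp: dist_real_def)
  obtain d2 where d2: "d2 > 0" "\<And>q. dist q p < d2 \<Longrightarrow> \<bar>Fv' q u - Fv' p u\<bar> < \<epsilon>"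
    using cv \<epsilon> unfolding continuous_at_eps_delta by (auto simp: dist_real_def)
  define d where "d = min d0 (min d1 d2)"
  have d: "d > 0" using d0 d1 d2 by (simp add: d_def)
  \<comment> \<open>Small enough for the whole parallelogram with sides \<open>h u\<close> and
    \<open>h v\<close> to lie within \<open>d / 2\<close> of \<open>p\<close>; the summand 1 keeps
    the denominator positive when \<open>u\<close> and \<open>v\<close> are both zero.\<close>
  define h where "h = d / (2 * (norm u + norm v + 1))"
  have n: "norm u + norm v + 1 > 0" by (smt (verit) norm_ge_zero)
  then have n0: "norm u + norm v + 1 \<noteq> 0" by simp
  have h: "h > 0" using d n by (simp add: h_def)
  have near: "dist (p + s *\<^sub>R u + t *\<^sub>R v) p < d" if "0 \<le> s" "s \<le> h" "0 \<le> t" "t \<le> h" for s t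
  proof -
    have "norm (s *\<^sub>R u + t *\<^sub>R v) \<le> h * norm u + h * norm v"
      using that by (intro norm_triangle_le add_mono) (auto intro: mult_right_mono)
    also have "\<dots> \<le> h * (norm u + norm v + 1)" using h by (simp add: algebra_simps)
    also have "\<dots> = d / 2"
      unfolding h_def using nonzero_mult_div_cancel_right[OF n0] by (metis divide_divide_eq_left' nonzero_eq_divide_eq n0 times_divide_eq_left)
    also have "\<dots> < d" using d by simp
    finally show ?thesis by (simp add: dist_norm add.assoc)
  qed
  have inS: "p + s *\<^sub>R u + t *\<^sub>R v \<in> S" if "0 \<le> s" "s \<le> h" "0 \<le> t" "t \<le> h" for s t
    using near[OF that] d0(2) by (auto simp: d_def dist_commute subset_iff)
  obtain s t where st: "s \<in> {0..h}" "t \<in> {0..h}" and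
    1: "F (p + h *\<^sub>R u + h *\<^sub>R v) - F (p + h *\<^sub>R u) - (F (p + h *\<^sub>R v) - F p)
      = h\<^sup>2 * Fu' (p + s *\<^sub>R u + t *\<^sub>R v) v"
    using mixed_difference_mean_value[OF F Fu h inS] by blast
  have inS': "p + s *\<^sub>R v + t *\<^sub>R u \<in> S" if "0 \<le> s" "s \<le> h" "0 \<le> t" "t \<le> h" for s t
    using inS[of t s] that by (simp add: ac_simps)
  obtain s' t' where st': "s' \<in> {0..h}" "t' \<in> {0..h}" and
    2: "F (p + h *\<^sub>R v + h *\<^sub>R u) - F (p + h *\<^sub>R v) - (F (p + h *\<^sub>R u) - F p)
      = h\<^sup>2 * Fv' (p + s' *\<^sub>R v + t' *\<^sub>R u) u"
    using mixed_difference_mean_value[OF F Fv h inS'] by blast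
  have sw: "p + a + b = p + b + a" for a b by simp
  have "h\<^sup>2 * Fu' (p + s *\<^sub>R u + t *\<^sub>R v) v = h\<^sup>2 * Fv' (p + t' *\<^sub>R u + s' *\<^sub>R v) u"
    using 1 2 unfolding sw[of "h *\<^sub>R v"] sw[of "s' *\<^sub>R v"] by linarith
  then have eq: "Fu' (p + s *\<^sub>R u + t *\<^sub>R v) v = Fv' (p + t' *\<^sub>R u + s' *\<^sub>R v) u"
    using h by simp
  have "\<bar>Fu' (p + s *\<^sub>R u + t *\<^sub>R v) v - Fu' p v\<bar> < \<epsilon>"
    using near[of s t] st by (intro d1) (simp add: d_def)
  moreover have "\<bar>Fv' (p + t' *\<^sub>R u + s' *\<^sub>R v) u - Fv' p u\<bar> < \<epsilon>"
    using near[of t' s'] st' by (intro d2) (simp add: d_def)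
  ultimately show False using eq unfolding \<epsilon>_def by (auto simp: field_simps abs_if split: if_splits)
qed

text \<open>The mean value theorem is an equality for real-valued functions only, hence the passage
  to components.\<close>

lemma frechet_derivative_commute:
  fixes f :: "'a::euclidean_space \<Rightarrow> 'b::euclidean_space"
  assumes S: "open S" "p \<in> S" and f: "smooth_on S f"
  shows "frechet_derivative (\<lambda>q. frechet_derivative f (at q) u) (at p) v =
         frechet_derivative (\<lambda>q. frechet_derivative f (at q) v) (at p) u"
proof (rule euclidean_eqI)
  fix b :: 'b assume "b \<in> Basis"
  define D where "D w q = frechet_derivative f (at q) w" for w q
  have smD: "smooth_on S (D w)" for w
    using smooth_on_frechet_derivative[OF f] by (simp add: D_def[abs_def])
  have Df: "(f has_derivative (\<lambda>w. D w q)) (at q)" if "q \<in> S" for q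
    using smooth_on_differentiable[OF f that] by (simp add: D_def frechet_derivative_works)
  have DD: "(D w has_derivative frechet_derivative (D w) (at q)) (at q)" if "q \<in> S" for q w
    using smooth_on_differentiable[OF smD that] by (simp add: frechet_derivative_works)
  have cont: "isCont (\<lambda>q. frechet_derivative (D w) (at q) z \<bullet> b) p" for w z
    using smooth_on_continuous_on[OF smooth_on_frechet_derivative[OF smD]] S
    by (auto simp: continuous_on_eq_continuous_at intro!: continuous_intros)
  have "frechet_derivative (D u) (at p) v \<bullet> b = frechet_derivative (D v) (at p) u \<bullet> b"
    by (rule frechet_derivative_commute_real[OF S, where F="\<lambda>q. f q \<bullet> b" and F'="\<lambda>q w. D w q \<bullet> b"])
      (auto intro!: has_derivative_inner_left Df DD cont)
  then show "frechet_derivative (\<lambda>q. frechet_derivative f (at q) u) (at p) v \<bullet> b =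
         frechet_derivative (\<lambda>q. frechet_derivative f (at q) v) (at p) u \<bullet> b"
    by (simp add: D_def[abs_def])
qed

lemma has_derivative_transform_nhds:
  assumes f: "(f has_derivative D) (at p)" and fg: "\<forall>\<^sub>F y in nhds p. f y = g y"
  shows "(g has_derivative D) (at p)"
  using fg has_derivative_transform_eventually[OF f] by (simp add: eventually_nhds_conv_at)

section \<open>Charts and the group operations in local coordinates\<close>

context smooth_manifold
begin

lemma chart_subset: "(U, \<phi>) \<in> \<A> \<Longrightarrow> U \<subseteq> topspace T"
  using chart openin_subset by blast

lemma chart_inj_on: assumes "(U, \<phi>) \<in> \<A>" shows "inj_on \<phi> U"
  using chart[OF assms] homeomorphic_imp_injective_map[of "subtopology T U"] chart_subset[OF assms]
  by (metis inf.absorb_iff2 topspace_subtopology)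

lemma open_chart_image:
  assumes U: "(U, \<phi>) \<in> \<A>" and A: "openin T A" "A \<subseteq> U"
  shows "open (\<phi> ` A)"
proof -
  have "openin (top_of_set (\<phi> ` U)) (\<phi> ` A)"
    using homeomorphic_imp_open_map[of "subtopology T U" "top_of_set (\<phi> ` U)" \<phi>] chart[OF U] A
    by (metis open_map_def openin_subset_topspace_eq openin_subtopology inf.absorb_iff1)
  then show ?thesis using chart[OF U] openin_open_trans by blast
qed

text \<open>The bridge from the topology of the manifold to derivatives in the model space: an
  identity valid on an open set of group elements becomes one valid eventually at the coordinate
  point, so derivatives can be transferred along it.\<close>

lemma eventually_chart:
  assumes U: "(U, \<phi>) \<in> \<A>" and A: "openin T A" "A \<subseteq> U" "p \<in> A"
  shows "\<forall>\<^sub>F y in nhds (\<phi> p). inv_into U \<phi> y \<in> A \<and> \<phi> (inv_into U \<phi> y) = y"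
  unfolding eventually_nhds
  using open_chart_image[OF U A(1,2)] A chart_inj_on[OF U]
  by (intro exI[of _ "\<phi> ` A"]) (auto simp: inv_into_f_f subset_iff)

end

context lie_group
begin

lemma chart_exists: "g \<in> carrier G \<Longrightarrow> \<exists>V \<psi>. (V, \<psi>) \<in> \<A> \<and> g \<in> V"
  using cover topspace_eq by fastforce

lemma chart_carrier: "(V, \<psi>) \<in> \<A> \<Longrightarrow> g \<in> V \<Longrightarrow> g \<in> carrier G"
  using chart_subset topspace_eq by blast

lemma continuous_mult: "continuous_map (prod_topology T T) T (\<lambda>(g, h). g \<otimes> h)"
  using smooth_mult by (simp add: smooth_map_def)

lemma continuous_mult_comp:
  assumes "continuous_map X T f" "continuous_map X T g"
  shows "continuous_map X T (\<lambda>x. f x \<otimes> g x)"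
  using continuous_map_compose[OF continuous_map_pairedI[OF assms] continuous_mult]
  by (simp add: o_def)

lemma continuous_conj:
  assumes "g \<in> carrier G" shows "continuous_map T T (\<lambda>h. g \<otimes> h \<otimes> inv g)"
  using assms by (intro continuous_mult_comp) (auto simp: topspace_eq)

text \<open>Packages smoothness of the multiplication for arbitrary charts of the two factors and of
  the product. The domain \<open>S\<close> consists of the coordinates of the pairs whose product
  lies in the third chart.\<close>

lemma local_mult:
  assumes V: "(V1, \<psi>1) \<in> \<A>" "(V2, \<psi>2) \<in> \<A>" "(V3, \<psi>3) \<in> \<A>"
  obtains F S where "open S" "smooth_on S F"
    "\<And>g h. \<lbrakk>g \<in> V1; h \<in> V2; g \<otimes> h \<in> V3\<rbrakk> \<Longrightarrow> (\<psi>1 g, \<psi>2 h) \<in> S"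
    "\<And>g h. \<lbrakk>g \<in> V1; h \<in> V2\<rbrakk> \<Longrightarrow> F (\<psi>1 g, \<psi>2 h) = \<psi>3 (g \<otimes> h)"
proof -
  define A where "A = V1 \<times> V2 \<inter> (\<lambda>(g, h). g \<otimes> h) -` V3"
  define F where "F = \<psi>3 \<circ> (\<lambda>(g, h). g \<otimes> h) \<circ> inv_into (V1 \<times> V2) (map_prod \<psi>1 \<psi>2)"
  have inj: "inj_on (map_prod \<psi>1 \<psi>2) (V1 \<times> V2)"
    using chart_inj_on V by (simp add: map_prod_inj_on)
  have "(V1 \<times> V2, map_prod \<psi>1 \<psi>2) \<in> prod_atlas \<A> \<A>"
    using V by (auto simp: prod_atlas_def)
  then have sm: "smooth_on (map_prod \<psi>1 \<psi>2 ` A) F"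
    using smooth_mult V unfolding smooth_map_def A_def F_def by fast
  have FF: "F (\<psi>1 g, \<psi>2 h) = \<psi>3 (g \<otimes> h)" if "g \<in> V1" "h \<in> V2" for g h
  proof -
    have "inv_into (V1 \<times> V2) (map_prod \<psi>1 \<psi>2) (map_prod \<psi>1 \<psi>2 (g, h)) = (g, h)"
      using that by (intro inv_into_f_f[OF inj]) auto
    then show ?thesis by (simp add: F_def)
  qed
  have "openin (prod_topology T T) {z \<in> topspace (prod_topology T T). (\<lambda>(g, h). g \<otimes> h) z \<in> V3}"
    using openin_continuous_map_preimage[OF continuous_mult] chart V by blast
  moreover have "openin (prod_topology T T) (V1 \<times> V2)"
    using chart V by (simp add: openin_prod_Times_iff)
  ultimately have "openin (prod_topology T T) (V1 \<times> V2 \<inter> {z \<in> topspace (prod_topology T T). (\<lambda>(g, h). g \<otimes> h) z \<in> V3})"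
    by blast
  also have "V1 \<times> V2 \<inter> {z \<in> topspace (prod_topology T T). (\<lambda>(g, h). g \<otimes> h) z \<in> V3} = A"
    using chart_subset V by (auto simp: A_def)
  finally have opA: "openin (prod_topology T T) A" .
  \<comment> \<open>Openness is not part of \<open>smooth_on\<close>, yet the symmetry of second
    derivatives requires it. It holds because \<open>A\<close> is a union of open rectangles and
    each factor chart is open.\<close>
  have "open (map_prod \<psi>1 \<psi>2 ` A)"
  proof (rule openI)
    fix z assume "z \<in> map_prod \<psi>1 \<psi>2 ` A"
    then obtain g h where gh: "(g, h) \<in> A" "z = (\<psi>1 g, \<psi>2 h)"
      by (metis imageE map_prod_simp surj_pair)
    then obtain B C where BC: "openin T B" "openin T C" "g \<in> B" "h \<in> C" "B \<times> C \<subseteq> A"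
      using opA unfolding openin_prod_topology_alt by metis
    then have "B \<subseteq> V1" "C \<subseteq> V2" by (auto simp: A_def)
    then have "open (\<psi>1 ` B \<times> \<psi>2 ` C)"
      using open_chart_image V BC by (simp add: open_Times)
    moreover have "z \<in> \<psi>1 ` B \<times> \<psi>2 ` C" using BC gh by auto
    moreover have "\<psi>1 ` B \<times> \<psi>2 ` C \<subseteq> map_prod \<psi>1 \<psi>2 ` A" using BC(5) by force
    ultimately show "\<exists>e>0. ball z e \<subseteq> map_prod \<psi>1 \<psi>2 ` A"
      using openE[of "\<psi>1 ` B \<times> \<psi>2 ` C" z] by (metis order_trans)
  qed
  moreover have "(\<psi>1 g, \<psi>2 h) \<in> map_prod \<psi>1 \<psi>2 ` A" if "g \<in> V1" "h \<in> V2" "g \<otimes> h \<in> V3" for g h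
    using that by (force simp: A_def)
  ultimately show thesis using sm FF by (intro that)
qed

lemma local_inv:
  assumes V: "(V1, \<psi>1) \<in> \<A>" "(V2, \<psi>2) \<in> \<A>" and g: "g \<in> V1" "inv g \<in> V2"
  shows "(\<lambda>y. \<psi>2 (inv (inv_into V1 \<psi>1 y))) differentiable (at (\<psi>1 g))"
proof -
  have "\<forall>C\<in>\<A>. \<forall>C'\<in>\<A>. smooth_on (snd C ` (fst C \<inter> (\<lambda>g. inv g) -` fst C'))
      (snd C' \<circ> (\<lambda>g. inv g) \<circ> inv_into (fst C) (snd C))"
    using smooth_inv by (simp add: smooth_map_def case_prod_beta)
  from bspec[OF bspec[OF this V(1)] V(2)]
  have "smooth_on (\<psi>1 ` (V1 \<inter> (\<lambda>g. inv g) -` V2)) (\<psi>2 \<circ> (\<lambda>g. inv g) \<circ> inv_into V1 \<psi>1)"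
    by simp
  from smooth_on_differentiable[OF this, of "\<psi>1 g"] g show ?thesis by (simp add: o_def)
qed

end

section \<open>The adjoint representation in a chart around the identity\<close>

locale lie_group_chart = lie_group G T \<A>
  for G (structure) and T :: "'g topology" and \<A> :: "('g set \<times> ('g \<Rightarrow> 'b::euclidean_space)) set" +
  fixes U :: "'g set" and \<phi> :: "'g \<Rightarrow> 'b"
  assumes U: "(U, \<phi>) \<in> \<A>" and one_U: "\<one> \<in> U"
begin

abbreviation "\<psi> \<equiv> inv_into U \<phi>"

lemma U_open: "openin T U" using chart[OF U] by blast
lemma \<psi>_\<phi>: "g \<in> U \<Longrightarrow> \<psi> (\<phi> g) = g" using chart_inj_on[OF U] by simp
lemma U_carrier: "g \<in> U \<Longrightarrow> g \<in> carrier G" using chart_carrier[OF U] .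

lemma eventually_conj_in:
  assumes g: "g \<in> carrier G"
  shows "\<forall>\<^sub>F y in nhds (\<phi> \<one>). \<psi> y \<in> U \<and> \<phi> (\<psi> y) = y \<and> g \<otimes> \<psi> y \<otimes> inv g \<in> U"
proof -
  have "openin T {h \<in> topspace T. g \<otimes> h \<otimes> inv g \<in> U}"
    by (rule openin_continuous_map_preimage[OF continuous_conj[OF g] U_open])
  then have "openin T (U \<inter> {h \<in> topspace T. g \<otimes> h \<otimes> inv g \<in> U})"
    using U_open by blast
  from eventually_chart[OF U this, of \<one>] show ?thesis
    using one_U g by (auto simp: topspace_eq elim!: eventually_mono)
qed

text \<open>Neither \<open>g\<close> nor its inverse need lie in \<open>U\<close>, so conjugation is
  split into two products: left multiplication by \<open>g\<close> from \<open>U\<close> into a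
  chart \<open>V\<close> at \<open>g\<close>, then right multiplication by \<open>inv g\<close>, in
  a chart \<open>W\<close>, back into \<open>U\<close>.\<close>

lemma conj_differentiable:
  assumes g: "g \<in> carrier G"
  shows "(\<lambda>y. \<phi> (g \<otimes> \<psi> y \<otimes> inv g)) differentiable (at (\<phi> \<one>))"
proof -
  obtain V \<eta> where V: "(V, \<eta>) \<in> \<A>" "g \<in> V" using chart_exists g by blast
  obtain W \<xi> where W: "(W, \<xi>) \<in> \<A>" "inv g \<in> W" using chart_exists g by (meson inv_closed)
  obtain F S where FS: "open S" "smooth_on S F"
    "\<And>a b. \<lbrakk>a \<in> V; b \<in> U; a \<otimes> b \<in> V\<rbrakk> \<Longrightarrow> (\<eta> a, \<phi> b) \<in> S"
    "\<And>a b. a \<in> V \<Longrightarrow> b \<in> U \<Longrightarrow> F (\<eta> a, \<phi> b) = \<eta> (a \<otimes> b)"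
    by (rule local_mult[OF V(1) U V(1)]) blast
  obtain F' S' where FS': "open S'" "smooth_on S' F'"
    "\<And>a b. \<lbrakk>a \<in> V; b \<in> W; a \<otimes> b \<in> U\<rbrakk> \<Longrightarrow> (\<eta> a, \<xi> b) \<in> S'"
    "\<And>a b. a \<in> V \<Longrightarrow> b \<in> W \<Longrightarrow> F' (\<eta> a, \<xi> b) = \<phi> (a \<otimes> b)"
    by (rule local_mult[OF V(1) W(1) U]) blast
  have S: "(\<eta> g, \<phi> \<one>) \<in> S" using FS(3)[OF V(2) one_U] V g by simp
  have S': "(F (\<eta> g, \<phi> \<one>), \<xi> (inv g)) \<in> S'"
    using FS(4)[OF V(2) one_U] FS'(3)[OF V(2) W(2)] V g one_U by simp
  have "(\<lambda>y. (\<eta> g, y)) differentiable (at (\<phi> \<one>))"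
    by (rule differentiableI[OF has_derivative_Pair[OF has_derivative_const has_derivative_ident]])
  from differentiable_chain_at[OF this smooth_on_differentiable[OF FS(2) S]]
  have "(\<lambda>y. F (\<eta> g, y)) differentiable (at (\<phi> \<one>))" by (simp add: o_def)
  then obtain D where "((\<lambda>y. F (\<eta> g, y)) has_derivative D) (at (\<phi> \<one>))"
    unfolding differentiable_def by (rule exE)
  from differentiableI[OF has_derivative_Pair[OF this has_derivative_const]]
  have "(\<lambda>y. (F (\<eta> g, y), \<xi> (inv g))) differentiable (at (\<phi> \<one>))" .
  from differentiable_chain_at[OF this smooth_on_differentiable[OF FS'(2) S']]
  have "(\<lambda>y. F' (F (\<eta> g, y), \<xi> (inv g))) differentiable (at (\<phi> \<one>))" by (simp add: o_def)
  then obtain D where D: "((\<lambda>y. F' (F (\<eta> g, y), \<xi> (inv g))) has_derivative D) (at (\<phi> \<one>))"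
    unfolding differentiable_def by (rule exE)
  have "continuous_map T T (\<lambda>h. g \<otimes> h)"
    using g by (intro continuous_mult_comp) (auto simp: topspace_eq)
  then have "openin T {h \<in> topspace T. g \<otimes> h \<in> V}"
    by (rule openin_continuous_map_preimage) (use chart[OF V(1)] in blast)
  then have "openin T (U \<inter> {h \<in> topspace T. g \<otimes> h \<in> V})"
    using U_open by blast
  from eventually_chart[OF U this, of \<one>]
  have ev: "\<forall>\<^sub>F y in nhds (\<phi> \<one>). \<psi> y \<in> U \<and> \<phi> (\<psi> y) = y \<and> g \<otimes> \<psi> y \<in> V"
    using one_U g V by (auto simp: topspace_eq elim!: eventually_mono)
  have "F' (F (\<eta> g, y), \<xi> (inv g)) = \<phi> (g \<otimes> \<psi> y \<otimes> inv g)"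
    if "\<psi> y \<in> U \<and> \<phi> (\<psi> y) = y \<and> g \<otimes> \<psi> y \<in> V" for y
  proof -
    have "F (\<eta> g, y) = \<eta> (g \<otimes> \<psi> y)" using FS(4)[OF V(2), of "\<psi> y"] that by metis
    then show ?thesis using FS'(4)[of "g \<otimes> \<psi> y" "inv g"] that W by metis
  qed
  then have ev': "\<forall>\<^sub>F y in nhds (\<phi> \<one>). F' (F (\<eta> g, y), \<xi> (inv g)) = \<phi> (g \<otimes> \<psi> y \<otimes> inv g)"
    using ev by (rule eventually_mono[rotated])
  have "((\<lambda>y. \<phi> (g \<otimes> \<psi> y \<otimes> inv g)) has_derivative D) (at (\<phi> \<one>))"
    by (rule has_derivative_transform_nhds[OF D ev'])
  then show ?thesis by (rule differentiableI)
qed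

lemma Ad_has_derivative:
  "g \<in> carrier G \<Longrightarrow> ((\<lambda>y. \<phi> (g \<otimes> \<psi> y \<otimes> inv g)) has_derivative Ad G U \<phi> g) (at (\<phi> \<one>))"
  unfolding Ad_def using conj_differentiable frechet_derivative_works by blast

lemma linear_Ad: "g \<in> carrier G \<Longrightarrow> linear (Ad G U \<phi> g)"
  using Ad_has_derivative has_derivative_linear by blast

lemma conj_one: "g \<in> carrier G \<Longrightarrow> \<phi> (g \<otimes> \<psi> (\<phi> \<one>) \<otimes> inv g) = \<phi> \<one>"
  using one_U by (simp add: \<psi>_\<phi>)

lemma conj_conj:
  assumes "g \<in> carrier G" "h \<in> carrier G" "k \<in> carrier G"
  shows "g \<otimes> (h \<otimes> k \<otimes> inv h) \<otimes> inv g = g \<otimes> h \<otimes> k \<otimes> inv (g \<otimes> h)"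
  using assms by (simp add: inv_mult_group m_assoc)

text \<open>Chain rule for the composition of two conjugations. The coordinate expressions compose
  only while the inner conjugate stays in \<open>U\<close>, hence the eventual equality near the
  identity.\<close>

lemma Ad_mult:
  assumes g: "g \<in> carrier G" and h: "h \<in> carrier G"
  shows "Ad G U \<phi> (g \<otimes> h) Y = Ad G U \<phi> g (Ad G U \<phi> h Y)"
proof -
  let ?c = "\<lambda>g y. \<phi> (g \<otimes> \<psi> y \<otimes> inv g)"
  have "(?c g has_derivative Ad G U \<phi> g) (at (?c h (\<phi> \<one>)))"
    unfolding conj_one[OF h] by (rule Ad_has_derivative[OF g])
  from has_derivative_compose[OF Ad_has_derivative[OF h] this]
  have D: "((\<lambda>y. ?c g (?c h y)) has_derivative (\<lambda>Y. Ad G U \<phi> g (Ad G U \<phi> h Y))) (at (\<phi> \<one>))" .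
  have "?c g (?c h y) = ?c (g \<otimes> h) y"
    if "\<psi> y \<in> U \<and> \<phi> (\<psi> y) = y \<and> h \<otimes> \<psi> y \<otimes> inv h \<in> U" for y
  proof -
    have "\<psi> (?c h y) = h \<otimes> \<psi> y \<otimes> inv h" using that \<psi>_\<phi> by blast
    moreover have "\<psi> y \<in> carrier G" using that U_carrier by blast
    ultimately show ?thesis by (simp only: conj_conj[OF g h])
  qed
  then have ev: "\<forall>\<^sub>F y in nhds (\<phi> \<one>). ?c g (?c h y) = ?c (g \<otimes> h) y"
    using eventually_conj_in[OF h] by (rule eventually_mono[rotated])
  have "(?c (g \<otimes> h) has_derivative (\<lambda>Y. Ad G U \<phi> g (Ad G U \<phi> h Y))) (at (\<phi> \<one>))"
    by (rule has_derivative_transform_nhds[OF D ev])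
  from has_derivative_unique[OF Ad_has_derivative[OF m_closed[OF g h]] this] show ?thesis
    by (rule fun_cong)
qed

lemma Ad_one: "Ad G U \<phi> \<one> Y = Y"
proof -
  have ev: "\<forall>\<^sub>F y in nhds (\<phi> \<one>). y = \<phi> (\<one> \<otimes> \<psi> y \<otimes> inv \<one>)"
    using eventually_conj_in[OF one_closed] by eventually_elim (simp add: U_carrier)
  have "((\<lambda>y. \<phi> (\<one> \<otimes> \<psi> y \<otimes> inv \<one>)) has_derivative (\<lambda>Y. Y)) (at (\<phi> \<one>))"
    by (rule has_derivative_transform_nhds[OF has_derivative_ident ev])
  from has_derivative_unique[OF Ad_has_derivative[OF one_closed] this] show ?thesis
    by (rule fun_cong)
qed

lemma eventually_inv_in:
  "\<forall>\<^sub>F y in nhds (\<phi> \<one>). \<psi> y \<in> U \<and> \<phi> (\<psi> y) = y \<and> inv (\<psi> y) \<in> U"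
proof -
  have "continuous_map T T (\<lambda>g. inv g)" using smooth_inv by (simp add: smooth_map_def)
  then have "openin T {h \<in> topspace T. inv h \<in> U}"
    by (rule openin_continuous_map_preimage[OF _ U_open])
  then have "openin T (U \<inter> {h \<in> topspace T. inv h \<in> U})"
    using U_open by blast
  from eventually_chart[OF U this, of \<one>] show ?thesis
    using one_U by (auto simp: topspace_eq elim!: eventually_mono)
qed

lemma eventually_mult_in:
  assumes g: "g \<in> U"
  shows "\<forall>\<^sub>F y in nhds (\<phi> \<one>). \<psi> y \<in> U \<and> \<phi> (\<psi> y) = y \<and> g \<otimes> \<psi> y \<in> U"
proof -
  have "continuous_map T T (\<lambda>h. g \<otimes> h)"
    using U_carrier[OF g] by (intro continuous_mult_comp) (auto simp: topspace_eq)
  then have "openin T {h \<in> topspace T. g \<otimes> h \<in> U}"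
    by (rule openin_continuous_map_preimage[OF _ U_open])
  then have "openin T (U \<inter> {h \<in> topspace T. g \<otimes> h \<in> U})"
    using U_open by blast
  from eventually_chart[OF U this, of \<one>] show ?thesis
    using one_U g U_carrier[OF g] by (auto simp: topspace_eq elim!: eventually_mono)
qed

text \<open>In local coordinates, with \<open>B\<close> the mixed second derivative of the multiplication at the
  identity, the bracket is the antisymmetrization of \<open>B\<close>.\<close>

lemma Ad_derivative_antisymmetrization:
  obtains B where
    "\<And>Y. ((\<lambda>x. Ad G U \<phi> (\<psi> x) Y) has_derivative (\<lambda>X. B X Y - B Y X)) (at (\<phi> \<one>))"
proof -
  define e where "e = \<phi> \<one>"
  obtain m S where S: "open S" and sm: "smooth_on S m"
    and inS: "\<And>g h. \<lbrakk>g \<in> U; h \<in> U; g \<otimes> h \<in> U\<rbrakk> \<Longrightarrow> (\<phi> g, \<phi> h) \<in> S"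
    and m: "\<And>g h. \<lbrakk>g \<in> U; h \<in> U\<rbrakk> \<Longrightarrow> m (\<phi> g, \<phi> h) = \<phi> (g \<otimes> h)"
    by (rule local_mult[OF U U U]) blast
  define \<iota> where "\<iota> y = \<phi> (inv (\<psi> y))" for y
  define D where "D v p = frechet_derivative m (at p) v" for v p
  have m': "(m has_derivative (\<lambda>v. D v p)) (at p)" if "p \<in> S" for p
    using smooth_on_differentiable[OF sm that] by (simp add: D_def frechet_derivative_works)
  have linD: "linear (\<lambda>v. D v p)" if "p \<in> S" for p
    using has_derivative_linear[OF m'[OF that]] .
  \<comment> \<open>The second derivative of the multiplication at the identity: outer direction
    \<open>v\<close>, inner direction \<open>w\<close>. Its mixed part will be
    \<open>B\<close>.\<close>
  define H where "H v w = frechet_derivative (D w) (at (e, e)) v" for v w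
  have eS: "(e, e) \<in> S" using inS[OF one_U one_U] one_U by (simp add: e_def)
  have D': "(D w has_derivative (\<lambda>v. H v w)) (at (e, e))" for w
    using smooth_on_differentiable[OF smooth_on_frechet_derivative[OF sm] eS, of w]
    by (simp add: H_def D_def[abs_def] frechet_derivative_works)
  have linH: "linear (\<lambda>v. H v w)" for w using has_derivative_linear[OF D'] .
  have Hcomm: "H v w = H w v" for v w
    using frechet_derivative_commute[OF S eS sm, of w v] by (simp add: H_def D_def[abs_def])
  have linH': "linear (\<lambda>w. H v w)" for v using linH[of v] by (simp add: Hcomm[of v])
  have good: "(x, e) \<in> S \<and> (e, x) \<in> S \<and> m (x, e) = x \<and> m (e, x) = x"
    if x: "\<psi> x \<in> U" "\<phi> (\<psi> x) = x" for x
    using inS[OF x(1) one_U] inS[OF one_U x(1)] m[OF x(1) one_U] m[OF one_U x(1)] x U_carrier[OF x(1)]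
    by (metis e_def l_one r_one)
  have ev: "\<forall>\<^sub>F x in nhds e. \<psi> x \<in> U \<and> \<phi> (\<psi> x) = x \<and> inv (\<psi> x) \<in> U"
    using eventually_inv_in by (simp add: e_def)
  \<comment> \<open>The unit laws are to be differentiated at points \<open>x\<close> near
    \<open>e\<close>, not only at \<open>e\<close>, so they must hold on a neighbourhood of each
    such \<open>x\<close>.\<close>
  have ev2: "\<forall>\<^sub>F x in nhds e. (\<forall>\<^sub>F x' in nhds x. m (x', e) = x' \<and> m (e, x') = x') \<and> (x, e) \<in> S \<and> (e, x) \<in> S"
  proof -
    have "\<forall>\<^sub>F x in nhds e. m (x, e) = x \<and> m (e, x) = x"
      using ev by eventually_elim (use good in blast)
    then have "\<forall>\<^sub>F x in nhds e. \<forall>\<^sub>F x' in nhds x. m (x', e) = x' \<and> m (e, x') = x'"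
      by (simp only: eventually_eventually)
    then show ?thesis using ev by eventually_elim (use good in blast)
  qed
  have D1: "D (X, 0) (x, e) = X" and D2: "D (0, X) (e, x) = X"
    if x: "\<forall>\<^sub>F x' in nhds x. m (x', e) = x' \<and> m (e, x') = x'" "(x, e) \<in> S" "(e, x) \<in> S" for x X
  proof -
    have "((\<lambda>x. m (x, e)) has_derivative (\<lambda>X. D (X, 0) (x, e))) (at x)"
      by (rule has_derivative_compose[where f="\<lambda>x. (x, e)", OF has_derivative_Pair[OF has_derivative_ident has_derivative_const] m'[OF x(2)]])
    moreover have "((\<lambda>x. m (x, e)) has_derivative (\<lambda>X. X)) (at x)"
      by (rule has_derivative_transform_nhds[OF has_derivative_ident])
        (use x(1) in \<open>auto elim: eventually_mono\<close>)
    ultimately show "D (X, 0) (x, e) = X" using has_derivative_unique by metis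
    have "((\<lambda>x. m (e, x)) has_derivative (\<lambda>X. D (0, X) (e, x))) (at x)"
      by (rule has_derivative_compose[where f="\<lambda>x. (e, x)", OF has_derivative_Pair[OF has_derivative_const has_derivative_ident] m'[OF x(3)]])
    moreover have "((\<lambda>x. m (e, x)) has_derivative (\<lambda>X. X)) (at x)"
      by (rule has_derivative_transform_nhds[OF has_derivative_ident])
        (use x(1) in \<open>auto elim: eventually_mono\<close>)
    ultimately show "D (0, X) (e, x) = X" using has_derivative_unique by metis
  qed
  have De: "D (X, 0) (e, e) = X" "D (0, X) (e, e) = X" for X
    using D1[of e X] D2[of e X] eventually_nhds_x_imp_x[OF ev2] by auto
  have \<iota>e: "\<iota> e = e" using one_U by (simp add: \<iota>_def e_def \<psi>_\<phi>)
  obtain \<iota>' where \<iota>': "(\<iota> has_derivative \<iota>') (at e)"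
    using local_inv[OF U U one_U] one_U unfolding differentiable_def \<iota>_def[abs_def] e_def by auto
  have m_inv: "m (x, \<iota> x) = e \<and> (x, \<iota> x) \<in> S" if "\<psi> x \<in> U \<and> \<phi> (\<psi> x) = x \<and> inv (\<psi> x) \<in> U" for x
    using m[of "\<psi> x" "inv (\<psi> x)"] inS[of "\<psi> x" "inv (\<psi> x)"] that one_U U_carrier[of "\<psi> x"]
    by (metis \<iota>_def e_def r_inv)
  \<comment> \<open>Differentiating x x^-1 = 1 at the identity, where both partial derivatives of
    \<open>m\<close> are the identity map.\<close>
  have "\<iota>' = (\<lambda>X. - X)"
  proof
    fix X
    have "((\<lambda>x. m (x, \<iota> x)) has_derivative (\<lambda>X. D (X, \<iota>' X) (e, e))) (at e)"
      by (rule has_derivative_compose[where f="\<lambda>x. (x, \<iota> x)", OF has_derivative_Pair[OF has_derivative_ident \<iota>']])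
        (simp add: \<iota>e m'[OF eS])
    moreover have "((\<lambda>x. m (x, \<iota> x)) has_derivative (\<lambda>X. 0)) (at e)"
      by (rule has_derivative_transform_nhds[OF has_derivative_const[of e]])
        (use ev in \<open>eventually_elim, use m_inv in force\<close>)
    ultimately have "D (X, \<iota>' X) (e, e) = 0" using has_derivative_unique by metis
    moreover have "D (X, \<iota>' X) (e, e) = D (X, 0) (e, e) + D (0, \<iota>' X) (e, e)"
      using linear_add[OF linD[OF eS], of "(X, 0)" "(0, \<iota>' X)"] by simp
    ultimately show "\<iota>' X = - X" by (simp add: De eq_neg_iff_add_eq_0 add.commute)
  qed
  with \<iota>' have \<iota>': "(\<iota> has_derivative (\<lambda>X. - X)) (at e)" by simp
  \<comment> \<open>\<open>Ad\<close> in coordinates: y \<mapsto> x y x^-1 is a left translation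
    followed by a right translation, so the first contributes a second partial derivative of
    \<open>m\<close> and the other a first partial derivative.\<close>
  have Ad_local: "Ad G U \<phi> (\<psi> x) Y = D (D (0, Y) (x, e), 0) (x, \<iota> x)"
    if x: "\<psi> x \<in> U \<and> \<phi> (\<psi> x) = x \<and> inv (\<psi> x) \<in> U" for x Y
  proof -
    have xe: "(x, e) \<in> S" "m (x, e) = x" using good x by auto
    have i: "((\<lambda>y. m (x, y)) has_derivative (\<lambda>Y. D (0, Y) (x, e))) (at e)"
      by (rule has_derivative_compose[where f="\<lambda>y. (x, y)", OF has_derivative_Pair[OF has_derivative_const has_derivative_ident] m'[OF xe(1)]])
    have "(x, \<iota> x) \<in> S" using m_inv[OF x] by blast
    then have mS: "(m has_derivative (\<lambda>v. D v (x, \<iota> x))) (at (m (x, e), \<iota> x))"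
      using m' xe(2) by simp
    have d: "((\<lambda>y. m (m (x, y), \<iota> x)) has_derivative (\<lambda>Y. D (D (0, Y) (x, e), 0) (x, \<iota> x))) (at e)"
      by (rule has_derivative_compose[where f="\<lambda>y. (m (x, y), \<iota> x)", OF has_derivative_Pair[OF i has_derivative_const] mS])
    have "\<forall>\<^sub>F y in nhds e. \<psi> y \<in> U \<and> \<phi> (\<psi> y) = y \<and> \<psi> x \<otimes> \<psi> y \<in> U"
      using eventually_mult_in x by (simp add: e_def)
    then have "\<forall>\<^sub>F y in nhds e. m (m (x, y), \<iota> x) = \<phi> (\<psi> x \<otimes> \<psi> y \<otimes> inv (\<psi> x))"
    proof eventually_elim
      case (elim y)
      have "m (x, y) = \<phi> (\<psi> x \<otimes> \<psi> y)" using m[of "\<psi> x" "\<psi> y"] x elim by metis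
      then show ?case using m[of "\<psi> x \<otimes> \<psi> y" "inv (\<psi> x)"] x elim by (metis \<iota>_def)
    qed
    from has_derivative_transform_nhds[OF d this]
    have "((\<lambda>y. \<phi> (\<psi> x \<otimes> \<psi> y \<otimes> inv (\<psi> x))) has_derivative (\<lambda>Y. D (D (0, Y) (x, e), 0) (x, \<iota> x))) (at e)" .
    from has_derivative_unique[OF Ad_has_derivative[OF U_carrier] this[unfolded e_def]] x
    show ?thesis by (metis e_def)
  qed
  \<comment> \<open>By the unit law the first partial derivative of \<open>m\<close> at (x, e) is
    the identity for every \<open>x\<close> near \<open>e\<close>, hence constant in
    \<open>x\<close>.\<close>
  have H0: "H (X, 0) (Y, 0) = 0" for X Y
  proof -
    have "((\<lambda>x. D (Y, 0) (x, e)) has_derivative (\<lambda>X. H (X, 0) (Y, 0))) (at e)"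
      by (rule has_derivative_compose[where f="\<lambda>x. (x, e)", OF has_derivative_Pair[OF has_derivative_ident has_derivative_const] D'])
    moreover have "((\<lambda>x. D (Y, 0) (x, e)) has_derivative (\<lambda>X. 0)) (at e)"
      by (rule has_derivative_transform_nhds[OF has_derivative_const[of Y]])
        (use ev2 in \<open>eventually_elim, use D1 in force\<close>)
    ultimately show "H (X, 0) (Y, 0) = 0" using has_derivative_unique by metis
  qed
  have "((\<lambda>x. Ad G U \<phi> (\<psi> x) Y) has_derivative (\<lambda>X. H (X, 0) (0, Y) - H (Y, 0) (0, X))) (at e)" for Y
  proof -
    have a: "((\<lambda>x. D (0, Y) (x, e) \<bullet> b) has_derivative (\<lambda>X. H (X, 0) (0, Y) \<bullet> b)) (at e)" for b
      by (rule has_derivative_inner_left[OF has_derivative_compose[where f="\<lambda>x. (x, e)", OF has_derivative_Pair[OF has_derivative_ident has_derivative_const] D']])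
    have c: "((\<lambda>x. D (b, 0) (x, \<iota> x)) has_derivative (\<lambda>X. H (X, - X) (b, 0))) (at e)" for b
      by (rule has_derivative_compose[where f="\<lambda>x. (x, \<iota> x)", OF has_derivative_Pair[OF has_derivative_ident \<iota>']])
        (simp add: \<iota>e D')
    \<comment> \<open>In \<open>Ad_local\<close> the direction and the base point both vary with
      \<open>x\<close>. Expanding the direction in the standard basis leaves scalar functions times
      vectors, to which the product rule applies.\<close>
    have d: "((\<lambda>x. \<Sum>b\<in>Basis. (D (0, Y) (x, e) \<bullet> b) *\<^sub>R D (b, 0) (x, \<iota> x)) has_derivative
        (\<lambda>X. \<Sum>b\<in>Basis. (D (0, Y) (e, e) \<bullet> b) *\<^sub>R H (X, - X) (b, 0) + (H (X, 0) (0, Y) \<bullet> b) *\<^sub>R D (b, 0) (e, \<iota> e))) (at e)"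
      by (intro has_derivative_sum has_derivative_scaleR a c)
    have lin0: "linear (\<lambda>b::'b. (b, 0::'b))" by (intro linearI) auto
    have expand: "(\<Sum>b\<in>Basis. (Z \<bullet> b) *\<^sub>R f (b, 0)) = f (Z, 0)" if "linear f" for Z :: 'b and f :: "'b \<times> 'b \<Rightarrow> 'b"
    proof -
      have l: "linear (\<lambda>b. f (b, 0))" using linear_compose[OF lin0 that] by (simp add: o_def)
      have "f (Z, 0) = f ((\<Sum>b\<in>Basis. (Z \<bullet> b) *\<^sub>R b), 0)" by (simp add: euclidean_representation)
      also have "\<dots> = (\<Sum>b\<in>Basis. (Z \<bullet> b) *\<^sub>R f (b, 0))"
        using linear_sum[OF l, of "\<lambda>b. (Z \<bullet> b) *\<^sub>R b" Basis] by (simp add: linear_cmul[OF l])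
      finally show ?thesis ..
    qed
    have "(\<Sum>b\<in>Basis. (D (0, Y) (e, e) \<bullet> b) *\<^sub>R H (X, - X) (b, 0) + (H (X, 0) (0, Y) \<bullet> b) *\<^sub>R D (b, 0) (e, \<iota> e))
        = H (X, 0) (0, Y) - H (Y, 0) (0, X)" for X
    proof -
      have "(\<Sum>b\<in>Basis. (D (0, Y) (e, e) \<bullet> b) *\<^sub>R H (X, - X) (b, 0) + (H (X, 0) (0, Y) \<bullet> b) *\<^sub>R D (b, 0) (e, \<iota> e))
         = H (X, - X) (Y, 0) + H (X, 0) (0, Y)"
        unfolding sum.distrib De \<iota>e expand[OF linH'] by (simp add: euclidean_representation)
      \<comment> \<open>The point (x, \<open>\<iota>\<close> x) moves in direction (X, -X). The pure
        part vanishes by \<open>H0\<close>, and symmetry of \<open>H\<close> turns the mixed part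
        into the transposed value of \<open>B\<close>.\<close>
      also have "H (X, - X) (Y, 0) = H (X, 0) (Y, 0) - H (0, X) (Y, 0)"
        using linear_diff[OF linH, of "(X, 0)" "(0, X)" "(Y, 0)"] by simp
      finally show ?thesis using Hcomm[of "(0, X)" "(Y, 0)"] by (simp add: H0)
    qed
    with d have d': "((\<lambda>x. \<Sum>b\<in>Basis. (D (0, Y) (x, e) \<bullet> b) *\<^sub>R D (b, 0) (x, \<iota> x)) has_derivative
        (\<lambda>X. H (X, 0) (0, Y) - H (Y, 0) (0, X))) (at e)" by simp
    show ?thesis
    proof (rule has_derivative_transform_nhds[OF d'])
      show "\<forall>\<^sub>F x in nhds e. (\<Sum>b\<in>Basis. (D (0, Y) (x, e) \<bullet> b) *\<^sub>R D (b, 0) (x, \<iota> x)) = Ad G U \<phi> (\<psi> x) Y"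
        using ev
      proof eventually_elim
        case (elim x)
        then have "(x, \<iota> x) \<in> S" using m_inv by blast
        then show ?case using expand[OF linD] Ad_local[OF elim] by simp
      qed
    qed
  qed
  then show thesis unfolding e_def by (rule that[where B="\<lambda>X Y. H (X, 0) (0, Y)"])
qed

section \<open>Skewness, bilinearity and equivariance of the bracket\<close>

lemma lie_bracket_has_derivative:
  "((\<lambda>x. Ad G U \<phi> (\<psi> x) Y) has_derivative (\<lambda>X. lie_bracket G U \<phi> X Y)) (at (\<phi> \<one>))"
proof -
  obtain B where "\<And>Y. ((\<lambda>x. Ad G U \<phi> (\<psi> x) Y) has_derivative (\<lambda>X. B X Y - B Y X)) (at (\<phi> \<one>))"
    using Ad_derivative_antisymmetrization by blast
  from differentiableI[OF this] show ?thesis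
    unfolding lie_bracket_def using frechet_derivative_works by blast
qed

lemma lie_bracket_skew: "lie_bracket G U \<phi> Y X = - lie_bracket G U \<phi> X Y"
proof -
  obtain B where B: "\<And>Y. ((\<lambda>x. Ad G U \<phi> (\<psi> x) Y) has_derivative (\<lambda>X. B X Y - B Y X)) (at (\<phi> \<one>))"
    using Ad_derivative_antisymmetrization by blast
  have "lie_bracket G U \<phi> X Y = B X Y - B Y X" for X Y
    using fun_cong[OF has_derivative_unique[OF lie_bracket_has_derivative B]] .
  then show ?thesis by simp
qed

lemma linear_lie_bracket_left: "linear (\<lambda>X. lie_bracket G U \<phi> X Y)"
  using has_derivative_linear[OF lie_bracket_has_derivative] .

lemma linear_lie_bracket_right: "linear (lie_bracket G U \<phi> X)"
proof -
  have "linear (\<lambda>Y. - lie_bracket G U \<phi> Y X)"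
    by (rule linear_compose_neg[OF linear_lie_bracket_left])
  then show ?thesis by (simp add: lie_bracket_skew[symmetric])
qed

text \<open>Differentiate Ad(g x g^-1) Ad(g) Y = Ad(g) Ad(x) Y at x = 1 in the direction
  \<open>X\<close>: the left side needs the chain rule through conjugation, the right side only
  linearity of Ad(g).\<close>

lemma Ad_lie_bracket:
  assumes g: "g \<in> carrier G"
  shows "Ad G U \<phi> g (lie_bracket G U \<phi> X Y) = lie_bracket G U \<phi> (Ad G U \<phi> g X) (Ad G U \<phi> g Y)"
proof -
  let ?c = "\<lambda>x. \<phi> (g \<otimes> \<psi> x \<otimes> inv g)"
  have "((\<lambda>x. Ad G U \<phi> (\<psi> x) (Ad G U \<phi> g Y)) has_derivative (\<lambda>X. lie_bracket G U \<phi> X (Ad G U \<phi> g Y))) (at (?c (\<phi> \<one>)))"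
    unfolding conj_one[OF g] by (rule lie_bracket_has_derivative)
  from has_derivative_compose[OF Ad_has_derivative[OF g] this]
  have d: "((\<lambda>x. Ad G U \<phi> (\<psi> (?c x)) (Ad G U \<phi> g Y)) has_derivative
     (\<lambda>X. lie_bracket G U \<phi> (Ad G U \<phi> g X) (Ad G U \<phi> g Y))) (at (\<phi> \<one>))" .
  have ev: "\<forall>\<^sub>F x in nhds (\<phi> \<one>). Ad G U \<phi> (\<psi> (?c x)) (Ad G U \<phi> g Y) = Ad G U \<phi> g (Ad G U \<phi> (\<psi> x) Y)"
    using eventually_conj_in[OF g]
  proof eventually_elim
    case (elim x)
    then have x: "\<psi> x \<in> carrier G" using U_carrier by blast
    have "\<psi> (?c x) = g \<otimes> \<psi> x \<otimes> inv g" using elim \<psi>_\<phi> by blast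
    then have "Ad G U \<phi> (\<psi> (?c x)) (Ad G U \<phi> g Y) = Ad G U \<phi> (g \<otimes> \<psi> x \<otimes> inv g \<otimes> g) Y"
      using Ad_mult[of "g \<otimes> \<psi> x \<otimes> inv g" g] g x by (metis inv_closed m_closed)
    also have "g \<otimes> \<psi> x \<otimes> inv g \<otimes> g = g \<otimes> \<psi> x" using g x by (simp add: m_assoc)
    finally show ?case using Ad_mult[OF g x] by metis
  qed
  have "((\<lambda>x. Ad G U \<phi> g (Ad G U \<phi> (\<psi> x) Y)) has_derivative (\<lambda>X. Ad G U \<phi> g (lie_bracket G U \<phi> X Y))) (at (\<phi> \<one>))"
    by (rule bounded_linear.has_derivative[OF _ lie_bracket_has_derivative])
      (use linear_Ad[OF g] in \<open>simp add: linear_conv_bounded_linear\<close>)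
  from fun_cong[OF has_derivative_unique[OF this has_derivative_transform_nhds[OF d ev]]]
  show ?thesis .
qed

lemma lie_bracket_skew_adjoint:
  fixes Q :: "'b \<Rightarrow> 'b \<Rightarrow> real"
  assumes Q: "bilinear Q"
    and inv: "\<And>g X Y. g \<in> carrier G \<Longrightarrow> Q (Ad G U \<phi> g X) (Ad G U \<phi> g Y) = Q X Y"
  shows "Q (lie_bracket G U \<phi> X Y) Z = - Q Y (lie_bracket G U \<phi> X Z)"
proof -
  have Q': "bounded_bilinear Q" using Q bilinear_conv_bounded_bilinear by blast
  have d: "((\<lambda>x. Q (Ad G U \<phi> (\<psi> x) Y) (Ad G U \<phi> (\<psi> x) Z)) has_derivative
     (\<lambda>X. Q (Ad G U \<phi> (\<psi> (\<phi> \<one>)) Y) (lie_bracket G U \<phi> X Z) + Q (lie_bracket G U \<phi> X Y) (Ad G U \<phi> (\<psi> (\<phi> \<one>)) Z))) (at (\<phi> \<one>))"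
    by (rule bounded_bilinear.FDERIV[OF Q' lie_bracket_has_derivative lie_bracket_has_derivative])
  have ev: "\<forall>\<^sub>F x in nhds (\<phi> \<one>). Q (Ad G U \<phi> (\<psi> x) Y) (Ad G U \<phi> (\<psi> x) Z) = Q Y Z"
    using eventually_inv_in by eventually_elim (use inv U_carrier in blast)
  from fun_cong[OF has_derivative_unique[OF has_derivative_transform_nhds[OF d ev] has_derivative_const], of X]
  show ?thesis by (simp add: \<psi>_\<phi> one_U Ad_one)
qed

end

section \<open>Symmetric endomorphisms and the operator L\<close>

lemma Blinfun_linear: "linear f \<Longrightarrow> blinfun_apply (Blinfun f) = f"
  for f :: "'a::euclidean_space \<Rightarrow> 'b::real_normed_vector"
  by (simp add: bounded_linear_Blinfun_apply linear_conv_bounded_linear)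

lemma linear_blinfun: "linear (blinfun_apply A)"
  using blinfun.bounded_linear_right bounded_linear.linear by blast

section \<open>Orthonormal bases of a subspace with respect to a bilinear form\<close>

text \<open>Stated for an arbitrary bilinear form so that it serves \<open>Q\<close> on the blocks,
  the metric on \<open>\<pp>\<close> and the trace form on endomorphisms. Pairing a vanishing
  combination with one of its vectors isolates the coefficient.\<close>

lemma orthonormal_basis_independent:
  assumes q: "bilinear q" and C: "orthonormal_basis V q C"
  shows "independent C"
  unfolding independent_explicit_module
proof (intro allI impI)
  fix s and u and v :: 'a assume s: "finite s" "s \<subseteq> C" "(\<Sum>v\<in>s. u v *\<^sub>R v) = 0" "v \<in> s"
  have l: "linear (\<lambda>X. q X v)" using q by (simp add: bilinear_def)
  have qv: "q w v = (if w = v then 1 else 0)" if "w \<in> s" for w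
    using C s that unfolding orthonormal_basis_def by blast
  have "0 = q (\<Sum>v\<in>s. u v *\<^sub>R v) v" unfolding s(3) by (simp add: linear_0[OF l])
  also have "\<dots> = (\<Sum>w\<in>s. u w * q w v)" by (simp add: linear_sum[OF l] linear_cmul[OF l])
  also have "\<dots> = (\<Sum>w\<in>s. if w = v then u w else 0)"
    by (intro sum.cong refl) (simp add: qv)
  finally show "u v = 0" using s by simp
qed

lemma orthonormal_basis_finite:
  fixes C :: "'a::euclidean_space set"
  shows "bilinear q \<Longrightarrow> orthonormal_basis V q C \<Longrightarrow> finite C"
  using orthonormal_basis_independent independent_bound by blast

lemma orthonormal_basis_expand:
  fixes C :: "'a::euclidean_space set"
  assumes q: "bilinear q" and C: "orthonormal_basis V q C" and X: "X \<in> V"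
  shows "(\<Sum>b\<in>C. q X b *\<^sub>R b) = X"
proof -
  have fin: "finite C" by (rule orthonormal_basis_finite[OF q C])
  have qc: "q b c = (if b = c then 1 else 0)" if "b \<in> C" "c \<in> C" for b c
    using C that by (simp add: orthonormal_basis_def)
  obtain u where u: "X = (\<Sum>b\<in>C. u b *\<^sub>R b)"
    using C X span_finite[OF fin] unfolding orthonormal_basis_def by (metis (no_types, lifting) imageE)
  have "q X c = u c" if "c \<in> C" for c
  proof -
    have l: "linear (\<lambda>X. q X c)" using q by (simp add: bilinear_def)
    have "q X c = (\<Sum>b\<in>C. u b * q b c)" by (simp add: u linear_sum[OF l] linear_cmul[OF l])
    also have "\<dots> = (\<Sum>b\<in>C. if b = c then u b else 0)"
      using that by (intro sum.cong refl) (simp add: qc)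
    finally show ?thesis using that fin by simp
  qed
  then show ?thesis by (simp add: u)
qed

text \<open>Turns \<open>matrix_entry\<close>, which is a \<open>representation\<close> coefficient,
  into an inner product. The vectors in that application are endomorphisms rather than elements of a
  Euclidean space type, so finiteness of the basis is a premise.\<close>

lemma orthonormal_basis_representation:
  assumes q: "bilinear q" and C: "orthonormal_basis V q C" and fin: "finite C"
    and X: "X \<in> V" and c: "c \<in> C"
  shows "representation C X c = q X c"
proof -
  have l: "linear (\<lambda>X. q X c)" using q by (simp add: bilinear_def)
  have qc: "q b c = (if b = c then 1 else 0)" if "b \<in> C" for b
    using C that c by (simp add: orthonormal_basis_def)
  have "X \<in> span C" using C X by (simp add: orthonormal_basis_def)
  then have "(\<Sum>b\<in>C. representation C X b *\<^sub>R b) = X"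
    by (rule real_vector.sum_representation_eq[OF orthonormal_basis_independent[OF q C] _ fin order_refl])
  then have "q X c = q (\<Sum>b\<in>C. representation C X b *\<^sub>R b) c" by simp
  also have "\<dots> = (\<Sum>b\<in>C. representation C X b * q b c)" by (simp add: linear_sum[OF l] linear_cmul[OF l])
  also have "\<dots> = (\<Sum>b\<in>C. if b = c then representation C X b else 0)"
    by (intro sum.cong refl) (simp add: qc)
  finally show ?thesis using c fin by simp
qed

lemma blinfun_compose_assoc: "A o\<^sub>L A' o\<^sub>L A'' = A o\<^sub>L (A' o\<^sub>L A'')"
  by (rule blinfun_eqI) simp

section \<open>Transposes and traces for a metric on the complement\<close>

text \<open>\<open>ip\<close> is bilinear on the whole space with kernel \<open>\<kk>\<close>, as
  \<open>diag_metric\<close> is. The basis \<open>B\<close> is a parameter, so that the diagonal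
  case can supply one adapted to the blocks.\<close>

locale metric_complement =
  fixes \<kk> \<pp> :: "'b::euclidean_space set" and ip :: "'b \<Rightarrow> 'b \<Rightarrow> real" and B :: "'b set"
  assumes subspace_k: "subspace \<kk>" and subspace_p: "subspace \<pp>"
    and k_plus_p: "\<And>X. \<exists>Y\<in>\<kk>. \<exists>Z\<in>\<pp>. X = Y + Z"
    and bilinear_ip: "bilinear ip" and ip_sym: "\<And>X Y. ip X Y = ip Y X"
    and ip_k: "\<And>X Y. X \<in> \<kk> \<Longrightarrow> ip X Y = 0"
    and ip_pos: "\<And>X. X \<in> \<pp> \<Longrightarrow> X \<noteq> 0 \<Longrightarrow> ip X X > 0"
    and onb_B: "orthonormal_basis \<pp> ip B"
begin

lemma linear_ip_right: "linear (ip X)"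
  using bilinear_ip by (simp add: bilinear_def)

lemma linear_ip_left: "linear (\<lambda>X. ip X Y)"
  using bilinear_ip by (simp add: bilinear_def)

lemmas ip_simps = linear_add[OF linear_ip_left] linear_add[OF linear_ip_right]
  linear_cmul[OF linear_ip_left, simplified] linear_cmul[OF linear_ip_right, simplified]
  linear_sum[OF linear_ip_left] linear_sum[OF linear_ip_right]
  linear_diff[OF linear_ip_left] linear_diff[OF linear_ip_right]
  linear_neg[OF linear_ip_left] linear_neg[OF linear_ip_right]
  linear_0[OF linear_ip_left] linear_0[OF linear_ip_right]

lemma ip_nonneg: "X \<in> \<pp> \<Longrightarrow> ip X X \<ge> 0"
  using ip_pos[of X] by (cases "X = 0") (auto simp: ip_simps)

lemma ip_eqI:
  assumes "X \<in> \<pp>" "Y \<in> \<pp>" "\<And>Z. Z \<in> \<pp> \<Longrightarrow> ip X Z = ip Y Z"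
  shows "X = Y"
proof -
  have "X - Y \<in> \<pp>" using assms subspace_p subspace_diff by blast
  then have "ip (X - Y) (X - Y) = 0"
    using assms(3)[of "X - Y"] by (subst linear_diff[OF linear_ip_left]) simp
  then show ?thesis using ip_pos[OF \<open>X - Y \<in> \<pp>\<close>] by fastforce
qed

text \<open>The projection to \<open>\<pp>\<close> along \<open>\<kk>\<close> as a Fourier sum:
  \<open>ip\<close> annihilates \<open>\<kk>\<close>, so linearity is immediate, and it becomes the
  witness for \<open>proj_along\<close>.\<close>

definition pr :: "'b \<Rightarrow> 'b" where "pr X = (\<Sum>b\<in>B. ip X b *\<^sub>R b)"

lemma linear_pr: "linear pr"
  unfolding pr_def
  by (intro linearI) (simp_all add: ip_simps scaleR_left_distrib sum.distrib scaleR_sum_right)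

lemma onb_in: "orthonormal_basis \<pp> ip C \<Longrightarrow> b \<in> C \<Longrightarrow> b \<in> \<pp>"
  and onb_span: "orthonormal_basis \<pp> ip C \<Longrightarrow> span C = \<pp>"
  and onb_ip: "orthonormal_basis \<pp> ip C \<Longrightarrow> b \<in> C \<Longrightarrow> c \<in> C \<Longrightarrow> ip b c = (if b = c then 1 else 0)"
  by (auto simp: orthonormal_basis_def)

lemmas onb_independent = orthonormal_basis_independent[OF bilinear_ip]
  and onb_finite = orthonormal_basis_finite[OF bilinear_ip]
  and onb_expand = orthonormal_basis_expand[OF bilinear_ip]

lemma pr_p: "X \<in> \<pp> \<Longrightarrow> pr X = X"
  unfolding pr_def by (rule onb_expand[OF onb_B])

lemma pr_k: "X \<in> \<kk> \<Longrightarrow> pr X = 0"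
  by (simp add: pr_def ip_k)

lemma pr_in: "pr X \<in> \<pp>"
  unfolding pr_def by (intro subspace_sum subspace_scale subspace_p onb_in[OF onb_B])

lemma diff_pr: "X - pr X \<in> \<kk>"
proof -
  obtain Y Z where "Y \<in> \<kk>" "Z \<in> \<pp>" "X = Y + Z" using k_plus_p by blast
  then show ?thesis by (simp add: linear_add[OF linear_pr] pr_p pr_k)
qed

lemma ip_pr: "ip (pr X) Y = ip X Y" "ip X (pr Y) = ip X Y"
proof -
  show 1: "ip (pr X) Y = ip X Y" for X Y
    using ip_k[OF diff_pr, of X Y] by (simp add: ip_simps)
  show "ip X (pr Y) = ip X Y" by (metis 1 ip_sym)
qed

lemma proj_along_eq: "proj_along \<kk> \<pp> X = pr X"
  unfolding proj_along_def
proof (rule the_equality)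
  show "pr X \<in> \<pp> \<and> X - pr X \<in> \<kk>" using pr_in diff_pr by blast
  fix Y assume Y: "Y \<in> \<pp> \<and> X - Y \<in> \<kk>"
  then have "pr (X - Y) = 0" by (simp add: pr_k)
  then show "Y = pr X" using Y by (simp add: linear_diff[OF linear_pr] pr_p)
qed

lemma gl_p: "A \<in> gl_on \<kk> \<pp> \<Longrightarrow> blinfun_apply A X \<in> \<pp>"
  and gl_k: "A \<in> gl_on \<kk> \<pp> \<Longrightarrow> X \<in> \<kk> \<Longrightarrow> blinfun_apply A X = 0"
  by (auto simp: gl_on_def)

lemma gl_pr: assumes "A \<in> gl_on \<kk> \<pp>" shows "blinfun_apply A (pr X) = blinfun_apply A X"
  using gl_k[OF assms diff_pr, of X] by (simp add: blinfun.bilinear_simps)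

lemma gl_eqI:
  assumes "A \<in> gl_on \<kk> \<pp>" "A' \<in> gl_on \<kk> \<pp>"
    "\<And>X. X \<in> \<pp> \<Longrightarrow> blinfun_apply A X = blinfun_apply A' X"
  shows "A = A'"
  by (rule blinfun_eqI) (metis assms gl_pr pr_in)

lemma gl_compose: "A \<in> gl_on \<kk> \<pp> \<Longrightarrow> A' \<in> gl_on \<kk> \<pp> \<Longrightarrow> A o\<^sub>L A' \<in> gl_on \<kk> \<pp>"
  by (auto simp: gl_on_def)

lemma subspace_gl: "subspace (gl_on \<kk> \<pp>)"
  using subspace_p by (auto simp: subspace_def gl_on_def blinfun.bilinear_simps)

lemma onb_expand_gl:
  assumes "orthonormal_basis \<pp> ip C" "A \<in> gl_on \<kk> \<pp>"
  shows "(\<Sum>b\<in>C. ip X b *\<^sub>R blinfun_apply A b) = blinfun_apply A X"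
proof -
  have "(\<Sum>b\<in>C. ip X b *\<^sub>R blinfun_apply A b) = blinfun_apply A (\<Sum>b\<in>C. ip (pr X) b *\<^sub>R b)"
    by (simp add: blinfun.bilinear_simps blinfun.sum_right ip_pr)
  then show ?thesis by (simp add: onb_expand[OF assms(1) pr_in] gl_pr[OF assms(2)])
qed

lemma onb_parseval:
  assumes "orthonormal_basis \<pp> ip C"
  shows "(\<Sum>b\<in>C. ip X b * ip Y b) = ip X Y"
proof -
  have "ip X Y = ip X (pr Y)" by (simp only: ip_pr)
  also have "\<dots> = ip X (\<Sum>b\<in>C. ip (pr Y) b *\<^sub>R b)"
    by (simp only: onb_expand[OF assms pr_in])
  finally show ?thesis by (simp add: ip_simps ip_pr mult.commute)
qed

text \<open>The trace of an arbitrary bilinear form. Expanding each vector of \<open>C\<close> in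
  \<open>D\<close> produces coefficients whose sum over \<open>C\<close> collapses by Parseval to
  the Kronecker delta of \<open>D\<close>.\<close>

lemma onb_sum_independent:
  fixes f :: "'b \<Rightarrow> 'b \<Rightarrow> real"
  assumes C: "orthonormal_basis \<pp> ip C" and D: "orthonormal_basis \<pp> ip D" and f: "bilinear f"
  shows "(\<Sum>b\<in>C. f b b) = (\<Sum>b\<in>D. f b b)"
proof -
  have l: "linear (f X)" "linear (\<lambda>X. f X Y)" for X Y using f by (auto simp: bilinear_def)
  have pv: "(\<Sum>b\<in>C. ip b c * ip b c') = ip c c'" for c c'
    unfolding onb_parseval[OF C, of c c', symmetric] by (metis ip_sym)
  have "(\<Sum>b\<in>C. f b b) = (\<Sum>b\<in>C. f (\<Sum>c\<in>D. ip b c *\<^sub>R c) (\<Sum>c\<in>D. ip b c *\<^sub>R c))"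
    using onb_expand[OF D] onb_in[OF C] by simp
  also have "\<dots> = (\<Sum>b\<in>C. \<Sum>c\<in>D. \<Sum>c'\<in>D. (ip b c * ip b c') * f c' c)"
    by (simp add: linear_sum[OF l(1)] linear_sum[OF l(2)] linear_cmul[OF l(1)] linear_cmul[OF l(2)]
        sum_distrib_left mult.assoc)
  also have "\<dots> = (\<Sum>c\<in>D. \<Sum>b\<in>C. \<Sum>c'\<in>D. (ip b c * ip b c') * f c' c)"
    by (rule sum.swap)
  also have "\<dots> = (\<Sum>c\<in>D. \<Sum>c'\<in>D. \<Sum>b\<in>C. (ip b c * ip b c') * f c' c)"
    by (intro sum.cong refl sum.swap)
  also have "\<dots> = (\<Sum>c\<in>D. \<Sum>c'\<in>D. ip c c' * f c' c)"
    by (simp only: sum_distrib_right[symmetric] pv)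
  also have "\<dots> = (\<Sum>c\<in>D. \<Sum>c'\<in>D. if c' = c then f c' c else 0)"
    using onb_ip[OF D] by (intro sum.cong refl) auto
  also have "\<dots> = (\<Sum>c\<in>D. f c c)"
    using onb_finite[OF D] by (intro sum.cong) auto
  finally show ?thesis .
qed

text \<open>The transpose in coordinates, extended by zero on \<open>\<kk>\<close>; it supplies the
  existence hidden in \<open>transp\<close>.\<close>

definition adj :: "('b \<Rightarrow>\<^sub>L 'b) \<Rightarrow> ('b \<Rightarrow>\<^sub>L 'b)" where
  "adj A = Blinfun (\<lambda>Y. \<Sum>b\<in>B. ip Y (blinfun_apply A b) *\<^sub>R b)"

lemma adj_apply: "blinfun_apply (adj A) Y = (\<Sum>b\<in>B. ip Y (blinfun_apply A b) *\<^sub>R b)"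
  unfolding adj_def
  by (subst Blinfun_linear) (auto intro!: linearI simp: ip_simps scaleR_left_distrib sum.distrib scaleR_sum_right)

lemma adj_gl: "adj A \<in> gl_on \<kk> \<pp>"
proof -
  have "blinfun_apply (adj A) X \<in> \<pp>" for X
    unfolding adj_apply by (intro subspace_sum subspace_scale subspace_p onb_in[OF onb_B])
  then show ?thesis by (simp add: gl_on_def adj_apply ip_k)
qed

lemma ip_adj: assumes "A \<in> gl_on \<kk> \<pp>"
  shows "ip (blinfun_apply A X) Y = ip X (blinfun_apply (adj A) Y)"
proof -
  have "ip X (blinfun_apply (adj A) Y) = ip (\<Sum>b\<in>B. ip X b *\<^sub>R blinfun_apply A b) Y"
    by (simp add: adj_apply ip_simps ip_sym[of Y] mult.commute)
  then show ?thesis by (simp add: onb_expand_gl[OF onb_B assms])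
qed

lemma linear_adj: "linear adj"
  by (intro linearI blinfun_eqI)
    (simp_all add: adj_apply blinfun.bilinear_simps ip_simps scaleR_left_distrib sum.distrib scaleR_sum_right)

lemma adj_unique:
  assumes "A \<in> gl_on \<kk> \<pp>" "A' \<in> gl_on \<kk> \<pp>"
    "\<And>X Y. X \<in> \<pp> \<Longrightarrow> Y \<in> \<pp> \<Longrightarrow> ip (blinfun_apply A X) Y = ip X (blinfun_apply A' Y)"
  shows "adj A = A'"
proof (rule gl_eqI[OF adj_gl assms(2)])
  fix Y assume "Y \<in> \<pp>"
  then show "blinfun_apply (adj A) Y = blinfun_apply A' Y"
    using assms by (intro ip_eqI gl_p adj_gl) (auto, metis ip_adj ip_sym)
qed

lemma transp_eq: assumes "A \<in> gl_on \<kk> \<pp>" shows "transp \<kk> \<pp> ip A = adj A"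
  unfolding transp_def using adj_gl ip_adj[OF assms] adj_unique[OF assms]
  by (intro the_equality) auto

lemma adj_adj: "A \<in> gl_on \<kk> \<pp> \<Longrightarrow> adj (adj A) = A"
  by (rule adj_unique[OF adj_gl]) (auto, metis ip_adj ip_sym)

lemma adj_compose: "A \<in> gl_on \<kk> \<pp> \<Longrightarrow> A' \<in> gl_on \<kk> \<pp> \<Longrightarrow> adj (A o\<^sub>L A') = adj A' o\<^sub>L adj A"
  by (rule adj_unique) (auto simp: gl_compose adj_gl ip_adj)

lemma sym_on_iff: "A \<in> sym_on \<kk> \<pp> ip \<longleftrightarrow> A \<in> gl_on \<kk> \<pp> \<and> adj A = A"
  by (auto simp: sym_on_def transp_eq)

text \<open>Expanding \<open>A\<close> in \<open>C\<close> and exchanging sums moves the trace from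
  the standard basis of the ambient space to \<open>C\<close>. The extension by zero on
  \<open>\<kk>\<close> contributes nothing.\<close>

lemma endo_trace_eq:
  assumes C: "orthonormal_basis \<pp> ip C" and A: "A \<in> gl_on \<kk> \<pp>"
  shows "endo_trace A = (\<Sum>c\<in>C. ip (blinfun_apply A c) c)"
proof -
  have "endo_trace A = (\<Sum>b\<in>Basis. (\<Sum>c\<in>C. ip b c *\<^sub>R blinfun_apply A c) \<bullet> b)"
    by (simp add: endo_trace_def onb_expand_gl[OF C A])
  also have "\<dots> = (\<Sum>c\<in>C. \<Sum>b\<in>Basis. ip b c * (blinfun_apply A c \<bullet> b))"
    by (subst sum.swap) (simp add: inner_sum_left)
  also have "\<dots> = (\<Sum>c\<in>C. ip (\<Sum>b\<in>Basis. (blinfun_apply A c \<bullet> b) *\<^sub>R b) c)"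
    by (simp add: ip_simps mult.commute)
  finally show ?thesis by (simp add: euclidean_representation)
qed

text \<open>Under a sum over an orthonormal basis an endomorphism changes slots as its transpose,
  because both sides are the same double sum over matrix coefficients of \<open>A\<close> against
  values of \<open>f\<close>.\<close>

lemma trace_adj:
  fixes f :: "'b \<Rightarrow> 'b \<Rightarrow> real"
  assumes C: "orthonormal_basis \<pp> ip C" and A: "A \<in> gl_on \<kk> \<pp>" and f: "bilinear f"
  shows "(\<Sum>c\<in>C. f (blinfun_apply A c) c) = (\<Sum>c\<in>C. f c (blinfun_apply (adj A) c))"
proof -
  have l: "linear (f X)" "linear (\<lambda>X. f X Y)" for X Y using f by (auto simp: bilinear_def)
  have sw: "ip (blinfun_apply A c) b = ip (blinfun_apply (adj A) b) c" for b c
    by (metis A ip_adj ip_sym)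
  have "(\<Sum>c\<in>C. f (blinfun_apply A c) c) = (\<Sum>c\<in>C. f (\<Sum>b\<in>C. ip (blinfun_apply A c) b *\<^sub>R b) c)"
    by (simp add: onb_expand[OF C gl_p[OF A]])
  also have "\<dots> = (\<Sum>c\<in>C. \<Sum>b\<in>C. ip (blinfun_apply A c) b * f b c)"
    by (simp add: linear_sum[OF l(2)] linear_cmul[OF l(2)])
  also have "\<dots> = (\<Sum>b\<in>C. \<Sum>c\<in>C. ip (blinfun_apply (adj A) b) c * f b c)"
    by (subst sum.swap) (simp only: sw)
  also have "\<dots> = (\<Sum>b\<in>C. f b (\<Sum>c\<in>C. ip (blinfun_apply (adj A) b) c *\<^sub>R c))"
    by (simp add: linear_sum[OF l(1)] linear_cmul[OF l(1)])
  finally show ?thesis by (simp add: onb_expand[OF C gl_p[OF adj_gl]])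
qed

lemma bilinear_comp_ip: "linear f \<Longrightarrow> linear g \<Longrightarrow> bilinear (\<lambda>X Y. ip (f X) (g Y))"
  using linear_compose[OF _ linear_ip_left] linear_compose[OF _ linear_ip_right]
  by (auto simp: bilinear_def o_def)

lemma gl_inner_eq:
  assumes C: "orthonormal_basis \<pp> ip C" and A: "A \<in> gl_on \<kk> \<pp>" and A': "A' \<in> gl_on \<kk> \<pp>"
  shows "gl_inner \<kk> \<pp> ip A A' = (\<Sum>c\<in>C. ip (blinfun_apply A c) (blinfun_apply A' c))"
proof -
  have "gl_inner \<kk> \<pp> ip A A' = (\<Sum>c\<in>C. ip (blinfun_apply A (blinfun_apply (adj A') c)) c)"
    by (simp add: gl_inner_def transp_eq[OF A'] endo_trace_eq[OF C gl_compose[OF A adj_gl]])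
  also have "\<dots> = (\<Sum>c\<in>C. ip c (blinfun_apply A (blinfun_apply (adj A') c)))"
    by (simp add: ip_sym)
  also have "\<dots> = (\<Sum>c\<in>C. ip (blinfun_apply A' c) (blinfun_apply A c))"
    using trace_adj[OF C A', of "\<lambda>X Y. ip X (blinfun_apply A Y)"]
      bilinear_comp_ip[OF linear_id linear_blinfun[of A]] by simp
  finally show ?thesis by (simp add: ip_sym)
qed

text \<open>Symmetric test maps suffice because the difference of two symmetric maps is itself one,
  and pairing it with itself is positive definite. This is the uniqueness half of the descriptions
  of the moment map and of \<open>L_op\<close>.\<close>

lemma gl_inner_eqI:
  assumes A: "A \<in> sym_on \<kk> \<pp> ip" and A': "A' \<in> sym_on \<kk> \<pp> ip"
    and eq: "\<And>C. C \<in> sym_on \<kk> \<pp> ip \<Longrightarrow> gl_inner \<kk> \<pp> ip A C = gl_inner \<kk> \<pp> ip A' C"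
  shows "A = A'"
proof -
  have g: "A \<in> gl_on \<kk> \<pp>" "A' \<in> gl_on \<kk> \<pp>" using A A' by (auto simp: sym_on_iff)
  have d: "A - A' \<in> gl_on \<kk> \<pp>" using g subspace_gl subspace_diff by blast
  then have "A - A' \<in> sym_on \<kk> \<pp> ip" using A A' by (simp add: sym_on_iff linear_diff[OF linear_adj])
  then have "gl_inner \<kk> \<pp> ip A (A - A') - gl_inner \<kk> \<pp> ip A' (A - A') = 0"
    using eq by simp
  then have z0: "(\<Sum>c\<in>B. ip (blinfun_apply (A - A') c) (blinfun_apply (A - A') c)) = 0"
    unfolding gl_inner_eq[OF onb_B g(1) d] gl_inner_eq[OF onb_B g(2) d]
    by (simp only: sum_subtractf[symmetric] linear_diff[OF linear_ip_left, symmetric] blinfun.diff_left[symmetric])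
  have "ip (blinfun_apply (A - A') c) (blinfun_apply (A - A') c) = 0" if "c \<in> B" for c
    using z0 that by (subst (asm) sum_nonneg_eq_0_iff[OF onb_finite[OF onb_B]])
      (auto intro: ip_nonneg gl_p[OF d])
  then have z: "blinfun_apply (A - A') c = 0" if "c \<in> B" for c
    using ip_pos[OF gl_p[OF d]] that by (metis less_irrefl)
  have "blinfun_apply (A - A') X = 0" for X
    by (subst onb_expand_gl[OF onb_B d, symmetric]) (intro sum.neutral ballI, simp only: z scaleR_zero_right)
  then have "A - A' = 0" by (intro blinfun_eqI) simp
  then show ?thesis by simp
qed

section \<open>Riesz representation by matrix units\<close>

definition elem :: "'b \<Rightarrow> 'b \<Rightarrow> ('b \<Rightarrow>\<^sub>L 'b)" where
  "elem X Y = Blinfun (\<lambda>Z. ip Z X *\<^sub>R Y)"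

lemma elem_apply: "blinfun_apply (elem X Y) Z = ip Z X *\<^sub>R Y"
  unfolding elem_def by (subst Blinfun_linear) (auto intro!: linearI simp: ip_simps scaleR_left_distrib)

lemma elem_gl: "Y \<in> \<pp> \<Longrightarrow> elem X Y \<in> gl_on \<kk> \<pp>"
  by (auto simp: gl_on_def elem_apply ip_k subspace_scale[OF subspace_p])

lemma adj_elem: "X \<in> \<pp> \<Longrightarrow> Y \<in> \<pp> \<Longrightarrow> adj (elem X Y) = elem Y X"
  by (rule adj_unique) (auto simp: elem_gl elem_apply ip_simps ip_sym)

text \<open>\<open>transp\<close> is identified with \<open>adj\<close> on \<open>gl_on\<close>
  only, so bilinearity of \<open>gl_inner\<close> is at hand only there. This Hilbert-Schmidt sum
  agrees with it on \<open>gl_on\<close> and is bilinear everywhere.\<close>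

definition trace_form :: "('b \<Rightarrow>\<^sub>L 'b) \<Rightarrow> ('b \<Rightarrow>\<^sub>L 'b) \<Rightarrow> real" where
  "trace_form A C = (\<Sum>b\<in>B. ip (blinfun_apply A b) (blinfun_apply C b))"

lemma bilinear_trace_form: "bilinear trace_form"
  unfolding bilinear_def trace_form_def
  by (auto intro!: linearI simp: blinfun.bilinear_simps ip_simps sum.distrib sum_distrib_left)

lemma gl_inner_trace_form:
  "A \<in> gl_on \<kk> \<pp> \<Longrightarrow> C \<in> gl_on \<kk> \<pp> \<Longrightarrow> gl_inner \<kk> \<pp> ip A C = trace_form A C"
  unfolding trace_form_def by (rule gl_inner_eq[OF onb_B])

lemma sym_inv_on_gl: "A \<in> sym_inv_on \<kk> \<pp> ip \<rho> K \<Longrightarrow> A \<in> gl_on \<kk> \<pp>"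
  by (simp add: sym_inv_on_def sym_on_iff)

lemma subspace_sym_inv_on:
  assumes \<rho>: "\<And>g. g \<in> K \<Longrightarrow> linear (\<rho> g)"
  shows "subspace (sym_inv_on \<kk> \<pp> ip \<rho> K)"
  using subspace_gl unfolding subspace_def sym_inv_on_def sym_on_iff
  by (auto simp: linear_0[OF linear_adj] linear_add[OF linear_adj] linear_cmul[OF linear_adj]
      linear_0[OF \<rho>] linear_add[OF \<rho>] linear_cmul[OF \<rho>] blinfun.bilinear_simps)

text \<open>The existence half of the moment map and of \<open>L_op\<close>. The representing map
  has the values of \<open>\<beta>\<close> on matrix units as its matrix; invariance of
  \<open>\<beta>\<close> under transposition makes that matrix symmetric.\<close>

lemma riesz_sym:
  assumes \<beta>: "linear \<beta>" and \<beta>_adj: "\<And>A. A \<in> gl_on \<kk> \<pp> \<Longrightarrow> \<beta> (adj A) = (\<beta> A :: real)"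
  shows "\<exists>C \<in> sym_on \<kk> \<pp> ip. \<forall>A \<in> gl_on \<kk> \<pp>. gl_inner \<kk> \<pp> ip C A = \<beta> A"
proof -
  define C where "C = (\<Sum>c\<in>B. \<Sum>d\<in>B. \<beta> (elem c d) *\<^sub>R elem c d)"
  have C_gl: "C \<in> gl_on \<kk> \<pp>" unfolding C_def
    by (intro subspace_sum subspace_scale subspace_gl elem_gl onb_in[OF onb_B])
  have "adj C = (\<Sum>c\<in>B. \<Sum>d\<in>B. \<beta> (elem c d) *\<^sub>R elem d c)"
    unfolding C_def using onb_in[OF onb_B]
    by (simp add: linear_sum[OF linear_adj] linear_cmul[OF linear_adj] adj_elem)
  also have "\<dots> = (\<Sum>c\<in>B. \<Sum>d\<in>B. \<beta> (elem d c) *\<^sub>R elem c d)" by (rule sum.swap)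
  also have "\<dots> = C" unfolding C_def
  proof (intro sum.cong refl)
    fix c d assume "c \<in> B" "d \<in> B"
    then show "\<beta> (elem d c) *\<^sub>R elem c d = \<beta> (elem c d) *\<^sub>R elem c d"
      using \<beta>_adj[of "elem c d"] onb_in[OF onb_B] by (simp add: elem_gl adj_elem)
  qed
  finally have "C \<in> sym_on \<kk> \<pp> ip" using C_gl by (simp add: sym_on_iff)
  moreover have "gl_inner \<kk> \<pp> ip C A = \<beta> A" if A: "A \<in> gl_on \<kk> \<pp>" for A
  proof -
    have Cb: "blinfun_apply C b = (\<Sum>d\<in>B. \<beta> (elem b d) *\<^sub>R d)" if b: "b \<in> B" for b
    proof -
      have "blinfun_apply C b = (\<Sum>c\<in>B. \<Sum>d\<in>B. (\<beta> (elem c d) * ip b c) *\<^sub>R d)"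
        by (simp add: C_def blinfun.sum_left blinfun.bilinear_simps elem_apply)
      also have "\<dots> = (\<Sum>c\<in>B. if c = b then (\<Sum>d\<in>B. \<beta> (elem c d) *\<^sub>R d) else 0)"
        using b onb_ip[OF onb_B] by (intro sum.cong) auto
      finally show ?thesis using b onb_finite[OF onb_B] by simp
    qed
    have "A = (\<Sum>c\<in>B. \<Sum>d\<in>B. ip (blinfun_apply A c) d *\<^sub>R elem c d)"
    proof (rule blinfun_eqI)
      fix X
      have "blinfun_apply (\<Sum>c\<in>B. \<Sum>d\<in>B. ip (blinfun_apply A c) d *\<^sub>R elem c d) X
        = (\<Sum>c\<in>B. ip X c *\<^sub>R (\<Sum>d\<in>B. ip (blinfun_apply A c) d *\<^sub>R d))"
        by (simp add: blinfun.sum_left blinfun.bilinear_simps elem_apply scaleR_sum_right mult.commute)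
      then show "blinfun_apply A X = blinfun_apply (\<Sum>c\<in>B. \<Sum>d\<in>B. ip (blinfun_apply A c) d *\<^sub>R elem c d) X"
        by (simp add: onb_expand[OF onb_B gl_p[OF A]] onb_expand_gl[OF onb_B A])
    qed
    then have "\<beta> A = \<beta> (\<Sum>c\<in>B. \<Sum>d\<in>B. ip (blinfun_apply A c) d *\<^sub>R elem c d)" by simp
    also have "\<dots> = (\<Sum>c\<in>B. \<Sum>d\<in>B. ip (blinfun_apply A c) d * \<beta> (elem c d))"
      by (simp add: linear_sum[OF \<beta>] linear_cmul[OF \<beta>])
    also have "\<dots> = (\<Sum>c\<in>B. ip (blinfun_apply C c) (blinfun_apply A c))"
      by (simp add: Cb ip_simps ip_sym[of _ "blinfun_apply A _"] mult.commute)
    finally show ?thesis by (simp add: gl_inner_eq[OF onb_B C_gl A])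
  qed
  ultimately show ?thesis by blast
qed

section \<open>The action of endomorphisms on brackets, the moment map and L\<close>

lemma bilinear_theta:
  assumes "bilinear \<nu>" shows "bilinear (theta A \<nu>)"
proof -
  have l: "linear (\<nu> X)" "linear (\<lambda>X. \<nu> X Y)" for X Y using assms by (auto simp: bilinear_def)
  show ?thesis unfolding bilinear_def theta_def
    by (auto intro!: linearI simp: blinfun.bilinear_simps linear_add[OF l(1)] linear_add[OF l(2)]
        linear_cmul[OF l(1)] linear_cmul[OF l(2)] algebra_simps)
qed

lemma bilinear_ip_comp:
  assumes "bilinear \<nu>" "bilinear \<nu>'"
  shows "bilinear (\<lambda>X X'. ip (\<nu> X Y) (\<nu>' X' Y))" "bilinear (\<lambda>Y Y'. ip (\<nu> X Y) (\<nu>' X Y'))"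
proof -
  have l: "linear (\<nu> X)" "linear (\<lambda>X. \<nu> X Y)" "linear (\<nu>' X)" "linear (\<lambda>X. \<nu>' X Y)"
    using assms by (auto simp: bilinear_def)
  show "bilinear (\<lambda>X X'. ip (\<nu> X Y) (\<nu>' X' Y))" by (rule bilinear_comp_ip[OF l(2,4)])
  show "bilinear (\<lambda>Y Y'. ip (\<nu> X Y) (\<nu>' X Y'))" by (rule bilinear_comp_ip[OF l(1,3)])
qed

text \<open>The basis chosen by \<open>SOME\<close> is traded for \<open>C\<close> one argument at a
  time, each time by basis independence of the trace of a bilinear form.\<close>

lemma bracket_inner_eq:
  assumes C: "orthonormal_basis \<pp> ip C" and \<nu>: "bilinear \<nu>" "bilinear \<nu>'"
  shows "bracket_inner \<pp> ip \<nu> \<nu>' = (\<Sum>X\<in>C. \<Sum>Y\<in>C. ip (\<nu> X Y) (\<nu>' X Y))"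
proof -
  define D where "D = (SOME B. orthonormal_basis \<pp> ip B)"
  have D: "orthonormal_basis \<pp> ip D" unfolding D_def using onb_B by (rule someI)
  have "bracket_inner \<pp> ip \<nu> \<nu>' = (\<Sum>X\<in>D. \<Sum>Y\<in>D. ip (\<nu> X Y) (\<nu>' X Y))"
    by (simp add: bracket_inner_def D_def Let_def)
  also have "\<dots> = (\<Sum>X\<in>D. \<Sum>Y\<in>C. ip (\<nu> X Y) (\<nu>' X Y))"
    by (intro sum.cong refl onb_sum_independent[OF D C] bilinear_ip_comp \<nu>)
  also have "\<dots> = (\<Sum>Y\<in>C. \<Sum>X\<in>D. ip (\<nu> X Y) (\<nu>' X Y))" by (rule sum.swap)
  also have "\<dots> = (\<Sum>Y\<in>C. \<Sum>X\<in>C. ip (\<nu> X Y) (\<nu>' X Y))"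
    by (intro sum.cong refl onb_sum_independent[OF D C] bilinear_ip_comp \<nu>)
  also have "\<dots> = (\<Sum>X\<in>C. \<Sum>Y\<in>C. ip (\<nu> X Y) (\<nu>' X Y))" by (rule sum.swap)
  finally show ?thesis .
qed

lemma theta_add: "theta (A + A') \<nu> X Y = theta A \<nu> X Y + theta A' \<nu> X Y"
  and theta_scale: "theta (c *\<^sub>R A) \<nu> X Y = c *\<^sub>R theta A \<nu> X Y"
  if "bilinear \<nu>"
proof -
  have l: "linear (\<nu> X)" "linear (\<lambda>X. \<nu> X Y)" for X Y using that by (auto simp: bilinear_def)
  show "theta (A + A') \<nu> X Y = theta A \<nu> X Y + theta A' \<nu> X Y"
    by (simp add: theta_def blinfun.bilinear_simps linear_add[OF l(1)] linear_add[OF l(2)])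
  show "theta (c *\<^sub>R A) \<nu> X Y = c *\<^sub>R theta A \<nu> X Y"
    by (simp add: theta_def blinfun.bilinear_simps linear_cmul[OF l(1)] linear_cmul[OF l(2)] scaleR_diff_right)
qed

lemma linear_bracket_inner_theta:
  assumes "bilinear \<nu>" "bilinear \<nu>'"
  shows "linear (\<lambda>A. bracket_inner \<pp> ip (theta A \<nu>) \<nu>')" "linear (\<lambda>A. bracket_inner \<pp> ip \<nu>' (theta A \<nu>))"
  using assms
  by (auto intro!: linearI simp: bracket_inner_eq[OF onb_B] bilinear_theta theta_add theta_scale ip_simps
      sum.distrib sum_distrib_left)

text \<open>Each of the three terms pairs \<open>A\<close> with a symmetric form, so only the
  symmetric part of \<open>A\<close> counts. This is why a symmetric moment map can represent the
  functional on all of \<open>gl_on\<close>.\<close>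

lemma bracket_inner_theta_adj:
  assumes \<nu>: "bilinear \<nu>" and A: "A \<in> gl_on \<kk> \<pp>"
  shows "bracket_inner \<pp> ip (theta (adj A) \<nu>) \<nu> = bracket_inner \<pp> ip (theta A \<nu>) \<nu>"
proof -
  have sym: "(\<Sum>X\<in>B. f (blinfun_apply (adj A) X) X) = (\<Sum>X\<in>B. f (blinfun_apply A X) X)"
    if "bilinear f" "\<And>X Y. f X Y = f Y X" for f :: "'b \<Rightarrow> 'b \<Rightarrow> real"
    using trace_adj[OF onb_B A that(1)] that(2) by simp
  have 1: "ip (blinfun_apply (adj A) Z) Z = ip (blinfun_apply A Z) Z" for Z
    by (metis A ip_adj ip_sym)
  have 2: "(\<Sum>X\<in>B. \<Sum>Y\<in>B. ip (\<nu> (blinfun_apply (adj A) X) Y) (\<nu> X Y)) =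
      (\<Sum>X\<in>B. \<Sum>Y\<in>B. ip (\<nu> (blinfun_apply A X) Y) (\<nu> X Y))"
    by (subst (1 2) sum.swap)
      (intro sum.cong refl sym[of "\<lambda>U X. ip (\<nu> U _) (\<nu> X _)"] bilinear_ip_comp \<nu> ip_sym)
  have 3: "(\<Sum>X\<in>B. \<Sum>Y\<in>B. ip (\<nu> X (blinfun_apply (adj A) Y)) (\<nu> X Y)) =
      (\<Sum>X\<in>B. \<Sum>Y\<in>B. ip (\<nu> X (blinfun_apply A Y)) (\<nu> X Y))"
    by (intro sum.cong refl sym[of "\<lambda>U X. ip (\<nu> _ U) (\<nu> _ X)"] bilinear_ip_comp \<nu> ip_sym)
  show ?thesis
    unfolding bracket_inner_eq[OF onb_B bilinear_theta[OF \<nu>] \<nu>]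
    by (simp add: theta_def ip_simps sum_subtractf 1 2 3)
qed

lemma moment_map:
  assumes \<nu>: "bilinear \<nu>"
  shows "moment_map \<kk> \<pp> ip \<nu> \<in> sym_on \<kk> \<pp> ip"
    and "A \<in> gl_on \<kk> \<pp> \<Longrightarrow>
      gl_inner \<kk> \<pp> ip (moment_map \<kk> \<pp> ip \<nu>) A = 1/4 * bracket_inner \<pp> ip (theta A \<nu>) \<nu>"
proof -
  let ?P = "\<lambda>M. M \<in> sym_on \<kk> \<pp> ip \<and>
        (\<forall>A\<in>gl_on \<kk> \<pp>. gl_inner \<kk> \<pp> ip M A = 1/4 * bracket_inner \<pp> ip (theta A \<nu>) \<nu>)"
  have "linear (\<lambda>A. 1/4 * bracket_inner \<pp> ip (theta A \<nu>) \<nu>)"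
    using linear_compose_scale_right[OF linear_bracket_inner_theta(1)[OF \<nu> \<nu>], of "1/4"] by simp
  then obtain M where M: "?P M"
    using riesz_sym[of "\<lambda>A. 1/4 * bracket_inner \<pp> ip (theta A \<nu>) \<nu>"] bracket_inner_theta_adj[OF \<nu>]
    by auto
  have "?P (moment_map \<kk> \<pp> ip \<nu>)" unfolding moment_map_def
  proof (rule theI[of ?P, OF M])
    fix M' assume "?P M'"
    then show "M' = M" using M
      by (intro gl_inner_eqI) (auto simp only: sym_on_iff)
  qed
  then show "moment_map \<kk> \<pp> ip \<nu> \<in> sym_on \<kk> \<pp> ip"
    and "A \<in> gl_on \<kk> \<pp> \<Longrightarrow>
      gl_inner \<kk> \<pp> ip (moment_map \<kk> \<pp> ip \<nu>) A = 1/4 * bracket_inner \<pp> ip (theta A \<nu>) \<nu>" by auto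
qed

text \<open>The form defining \<open>L_op\<close>, with its trace term expressed by
  \<open>\<nu>\<close> itself. The order of the product comes from tr M A C = <M, C A>: for
  symmetric \<open>A\<close> and \<open>C\<close> the transpose of C A is A C.\<close>

definition L_form :: "('b \<Rightarrow> 'b \<Rightarrow> 'b) \<Rightarrow> ('b \<Rightarrow>\<^sub>L 'b) \<Rightarrow> ('b \<Rightarrow>\<^sub>L 'b) \<Rightarrow> real" where
  "L_form \<nu> A C = 1/2 * bracket_inner \<pp> ip (theta A \<nu>) (theta C \<nu>)
     + 1/2 * bracket_inner \<pp> ip (theta (C o\<^sub>L A) \<nu>) \<nu>"

lemma linear_L_form:
  assumes \<nu>: "bilinear \<nu>" shows "linear (L_form \<nu> A)"
proof (rule linearI)
  have l: "linear (\<lambda>A. bracket_inner \<pp> ip (theta A \<nu>) \<nu>)" "linear (\<lambda>C. bracket_inner \<pp> ip (theta A \<nu>) (theta C \<nu>))"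
    by (intro linear_bracket_inner_theta bilinear_theta \<nu>)+
  have "(C + D) o\<^sub>L A = (C o\<^sub>L A) + (D o\<^sub>L A)" "(c *\<^sub>R C) o\<^sub>L A = c *\<^sub>R (C o\<^sub>L A)" for C D :: "'b \<Rightarrow>\<^sub>L 'b" and c
    by (auto intro!: blinfun_eqI simp: blinfun.bilinear_simps)
  then show "L_form \<nu> A (C + D) = L_form \<nu> A C + L_form \<nu> A D" "L_form \<nu> A (c *\<^sub>R C) = c *\<^sub>R L_form \<nu> A C" for C D c
    by (simp_all add: L_form_def linear_add[OF l(1)] linear_add[OF l(2)] linear_cmul[OF l(1)] linear_cmul[OF l(2)]
       algebra_simps)
qed

lemma L_op:
  assumes \<nu>: "bilinear \<nu>" and A: "A \<in> sym_on \<kk> \<pp> ip"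
  shows "L_op \<kk> \<pp> ip \<nu> A \<in> sym_on \<kk> \<pp> ip"
    and "C \<in> sym_on \<kk> \<pp> ip \<Longrightarrow> gl_inner \<kk> \<pp> ip (L_op \<kk> \<pp> ip \<nu> A) C = L_form \<nu> A C"
proof -
  let ?P = "\<lambda>D. D \<in> sym_on \<kk> \<pp> ip \<and>
        (\<forall>C\<in>sym_on \<kk> \<pp> ip. gl_inner \<kk> \<pp> ip D C = L_form \<nu> A C)"
  have Ag: "A \<in> gl_on \<kk> \<pp>" "adj A = A" using A by (auto simp: sym_on_iff)
  have tr: "2 * endo_trace (moment_map \<kk> \<pp> ip \<nu> o\<^sub>L A o\<^sub>L C) = 1/2 * bracket_inner \<pp> ip (theta (C o\<^sub>L A) \<nu>) \<nu>"
    if "C \<in> sym_on \<kk> \<pp> ip" for C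
  proof -
    have C: "C \<in> gl_on \<kk> \<pp>" "adj C = C" using that by (auto simp: sym_on_iff)
    have "transp \<kk> \<pp> ip (C o\<^sub>L A) = A o\<^sub>L C"
      using C Ag by (simp add: transp_eq gl_compose adj_compose)
    then have "gl_inner \<kk> \<pp> ip (moment_map \<kk> \<pp> ip \<nu>) (C o\<^sub>L A) = endo_trace (moment_map \<kk> \<pp> ip \<nu> o\<^sub>L A o\<^sub>L C)"
      by (simp add: gl_inner_def blinfun_compose_assoc)
    then show ?thesis using moment_map(2)[OF \<nu> gl_compose[OF C(1) Ag(1)]] by simp
  qed
  \<comment> \<open>\<open>riesz_sym\<close> asks for a functional on all endomorphisms that ignores
    transposition. Averaging over \<open>C\<close> and its transpose produces one, and on symmetric
    \<open>C\<close> it is still \<open>L_form\<close>.\<close>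
  define \<beta> where "\<beta> C = 1/2 * L_form \<nu> A (C + adj C)" for C
  have lin: "linear \<beta>" unfolding \<beta>_def
    by (rule linearI)
      (simp_all add: linear_add[OF linear_L_form[OF \<nu>]] linear_cmul[OF linear_L_form[OF \<nu>]]
        linear_add[OF linear_adj] linear_cmul[OF linear_adj] algebra_simps)
  have "\<beta> (adj C) = \<beta> C" if "C \<in> gl_on \<kk> \<pp>" for C
    using that by (simp add: \<beta>_def adj_adj add.commute)
  then obtain D where D: "D \<in> sym_on \<kk> \<pp> ip" "\<forall>C\<in>gl_on \<kk> \<pp>. gl_inner \<kk> \<pp> ip D C = \<beta> C"
    using riesz_sym[OF lin] by blast
  have "\<beta> C = L_form \<nu> A C" if "C \<in> sym_on \<kk> \<pp> ip" for C
    using that linear_cmul[OF linear_L_form[OF \<nu>, of A], of 2 C]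
    by (simp add: \<beta>_def sym_on_iff scaleR_2[symmetric])
  then have PD: "?P D" using D by (auto simp: sym_on_iff)
  have "?P (THE D. ?P D)"
  proof (rule theI[of ?P, OF PD])
    fix D' assume "?P D'"
    then show "D' = D" using PD by (intro gl_inner_eqI) auto
  qed
  also have "(THE D. ?P D) = L_op \<kk> \<pp> ip \<nu> A"
    unfolding L_op_def
    by (intro arg_cong[where f=The] ext conj_cong ball_cong refl) (simp only: L_form_def tr)
  finally show "L_op \<kk> \<pp> ip \<nu> A \<in> sym_on \<kk> \<pp> ip"
    and "C \<in> sym_on \<kk> \<pp> ip \<Longrightarrow> gl_inner \<kk> \<pp> ip (L_op \<kk> \<pp> ip \<nu> A) C = L_form \<nu> A C" by auto
qed

section \<open>Isometric automorphisms of the bracket commute with L\<close>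

context
  fixes R \<nu>
  assumes R: "R \<in> gl_on \<kk> \<pp>"
    and R_isom: "\<And>X Y. X \<in> \<pp> \<Longrightarrow> Y \<in> \<pp> \<Longrightarrow> ip (blinfun_apply R X) (blinfun_apply R Y) = ip X Y"
    and bil: "bilinear \<nu>"
    and \<nu>_p: "\<And>X Y. \<nu> X Y \<in> \<pp>"
    and equiv: "\<And>X Y. X \<in> \<pp> \<Longrightarrow> Y \<in> \<pp> \<Longrightarrow>
      \<nu> (blinfun_apply R X) (blinfun_apply R Y) = blinfun_apply R (\<nu> X Y)"
begin

lemma adj_R_R: "X \<in> \<pp> \<Longrightarrow> blinfun_apply (adj R) (blinfun_apply R X) = X"
  by (rule ip_eqI[OF gl_p[OF adj_gl]]) (auto, metis R R_isom ip_adj ip_sym)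

text \<open>An isometry is injective on \<open>\<pp>\<close>, so the image of \<open>B\<close> is
  independent, and counting dimensions forces it to span. Surjectivity of \<open>R\<close> onto
  \<open>\<pp>\<close> is thus obtained along the way.\<close>

lemma onb_image: "orthonormal_basis \<pp> ip (blinfun_apply R ` B)"
proof -
  have inj: "inj_on (blinfun_apply R) (span B)"
    unfolding onb_span[OF onb_B] by (rule inj_on_inverseI[where g="blinfun_apply (adj R)"]) (rule adj_R_R)
  have ind: "independent (blinfun_apply R ` B)"
    by (rule linear_independent_injective_image[OF linear_blinfun onb_independent[OF onb_B] inj])
  have sub: "blinfun_apply R ` B \<subseteq> \<pp>" using gl_p[OF R] by blast
  have "dim \<pp> \<le> card (blinfun_apply R ` B)"
    using inj span_superset[of B]
    by (metis card_image dim_span_eq_card_independent inj_on_subset onb_B onb_independent onb_span order_refl)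
  then have "span (blinfun_apply R ` B) = \<pp>"
    using card_ge_dim_independent[OF sub ind] span_minimal[OF sub subspace_p] by blast
  moreover have "ip (blinfun_apply R b) (blinfun_apply R c) = (if blinfun_apply R b = blinfun_apply R c then 1 else 0)"
    if "b \<in> B" "c \<in> B" for b c
    using that R_isom onb_in[OF onb_B] onb_ip[OF onb_B] adj_R_R by metis
  ultimately show ?thesis unfolding orthonormal_basis_def using sub by auto
qed

lemma sum_onb_image: "(\<Sum>X\<in>blinfun_apply R ` B. f X) = (\<Sum>X\<in>B. f (blinfun_apply R X))"
  by (rule sum.reindex_cong[where l="blinfun_apply R"])
    (auto intro!: inj_on_inverseI[where g="blinfun_apply (adj R)"] adj_R_R onb_in[OF onb_B])

lemma theta_R:
  assumes "A \<in> gl_on \<kk> \<pp>" "A' \<in> gl_on \<kk> \<pp>"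
    and "\<And>X. X \<in> \<pp> \<Longrightarrow> blinfun_apply A (blinfun_apply R X) = blinfun_apply R (blinfun_apply A' X)"
    and "X \<in> \<pp>" "Y \<in> \<pp>"
  shows "theta A \<nu> (blinfun_apply R X) (blinfun_apply R Y) = blinfun_apply R (theta A' \<nu> X Y)"
  using assms \<nu>_p by (simp add: theta_def equiv gl_p blinfun.bilinear_simps)

lemma bracket_inner_R:
  assumes "bilinear \<alpha>" "bilinear \<alpha>'" "bilinear \<gamma>" "bilinear \<gamma>'"
    and "\<And>X Y. \<gamma> X Y \<in> \<pp>" "\<And>X Y. \<gamma>' X Y \<in> \<pp>"
    and "\<And>X Y. X \<in> \<pp> \<Longrightarrow> Y \<in> \<pp> \<Longrightarrow> \<alpha> (blinfun_apply R X) (blinfun_apply R Y) = blinfun_apply R (\<gamma> X Y)"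
    and "\<And>X Y. X \<in> \<pp> \<Longrightarrow> Y \<in> \<pp> \<Longrightarrow> \<alpha>' (blinfun_apply R X) (blinfun_apply R Y) = blinfun_apply R (\<gamma>' X Y)"
  shows "bracket_inner \<pp> ip \<alpha> \<alpha>' = bracket_inner \<pp> ip \<gamma> \<gamma>'"
  unfolding bracket_inner_eq[OF onb_image assms(1,2)] bracket_inner_eq[OF onb_B assms(3,4)] sum_onb_image
  using assms onb_in[OF onb_B] by (intro sum.cong refl) (simp add: R_isom)

lemma theta_p: "A \<in> gl_on \<kk> \<pp> \<Longrightarrow> theta A \<nu> X Y \<in> \<pp>"
  unfolding theta_def by (intro subspace_diff[OF subspace_p] \<nu>_p gl_p)

lemma L_op_commute:
  assumes A: "A \<in> sym_on \<kk> \<pp> ip"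
    and AR: "\<And>X. X \<in> \<pp> \<Longrightarrow> blinfun_apply A (blinfun_apply R X) = blinfun_apply R (blinfun_apply A X)"
    and X: "X \<in> \<pp>"
  shows "blinfun_apply (L_op \<kk> \<pp> ip \<nu> A) (blinfun_apply R X) = blinfun_apply R (blinfun_apply (L_op \<kk> \<pp> ip \<nu> A) X)"
proof -
  define C where "C = L_op \<kk> \<pp> ip \<nu> A"
  have C: "C \<in> sym_on \<kk> \<pp> ip" "\<And>D. D \<in> sym_on \<kk> \<pp> ip \<Longrightarrow> gl_inner \<kk> \<pp> ip C D = L_form \<nu> A D"
    using L_op[OF bil A] by (auto simp: C_def)
  have Cg: "C \<in> gl_on \<kk> \<pp>" "adj C = C" and Ag: "A \<in> gl_on \<kk> \<pp>" using C(1) A by (auto simp: sym_on_iff)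
  define C' where "C' = adj R o\<^sub>L C o\<^sub>L R"
  have C': "C' \<in> gl_on \<kk> \<pp>" unfolding C'_def by (intro gl_compose adj_gl Cg R)
  have "adj C' = C'" unfolding C'_def using Cg R
    by (simp add: adj_compose gl_compose adj_gl adj_adj blinfun_compose_assoc)
  then have C's: "C' \<in> sym_on \<kk> \<pp> ip" using C' by (simp add: sym_on_iff)
  have "C' = C"
  proof (rule gl_inner_eqI[OF C's C(1)])
    fix D assume "D \<in> sym_on \<kk> \<pp> ip"
    then have D: "D \<in> gl_on \<kk> \<pp>" "adj D = D" "D \<in> sym_on \<kk> \<pp> ip" by (auto simp: sym_on_iff)
    \<comment> \<open>The transport is moved onto the test map: <R^t C R, D> = <C, R D R^t>. Since
      \<open>D'\<close> corresponds to \<open>D\<close> under \<open>R\<close>,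
      \<open>bracket_inner_R\<close> leads back to \<open>D\<close>.\<close>
    define D' where "D' = R o\<^sub>L D o\<^sub>L adj R"
    have D': "D' \<in> gl_on \<kk> \<pp>" unfolding D'_def by (intro gl_compose adj_gl D R)
    have "adj D' = D'" unfolding D'_def using D R
      by (simp add: adj_compose gl_compose adj_gl adj_adj blinfun_compose_assoc)
    then have D's: "D' \<in> sym_on \<kk> \<pp> ip" using D' by (simp add: sym_on_iff)
    have DR: "blinfun_apply D' (blinfun_apply R X) = blinfun_apply R (blinfun_apply D X)" if "X \<in> \<pp>" for X
      using that by (simp add: D'_def adj_R_R)
    have sw: "ip (blinfun_apply (adj R) Z) W = ip Z (blinfun_apply R W)" for Z W
      by (metis R ip_adj ip_sym)
    have "gl_inner \<kk> \<pp> ip C' D = (\<Sum>X\<in>B. ip (blinfun_apply C (blinfun_apply R X)) (blinfun_apply R (blinfun_apply D X)))"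
      unfolding gl_inner_eq[OF onb_B C' D(1)]
      by (simp add: C'_def sw)
    also have "\<dots> = gl_inner \<kk> \<pp> ip C D'"
      unfolding gl_inner_eq[OF onb_image Cg(1) D'] sum_onb_image
      using onb_in[OF onb_B] by (intro sum.cong refl) (simp add: DR)
    also have "\<dots> = L_form \<nu> A D'" by (rule C(2)[OF D's])
    also have "\<dots> = L_form \<nu> A D"
    proof -
      have "bracket_inner \<pp> ip (theta A \<nu>) (theta D' \<nu>) = bracket_inner \<pp> ip (theta A \<nu>) (theta D \<nu>)"
        by (intro bracket_inner_R bilinear_theta bil theta_p theta_R Ag D(1) D' AR DR)
      moreover have "bracket_inner \<pp> ip (theta (D' o\<^sub>L A) \<nu>) \<nu> = bracket_inner \<pp> ip (theta (D o\<^sub>L A) \<nu>) \<nu>"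
        by (intro bracket_inner_R bilinear_theta bil theta_p theta_R Ag D(1) D' gl_compose \<nu>_p equiv)
          (simp_all add: AR DR gl_p[OF Ag])
      ultimately show ?thesis by (simp add: L_form_def)
    qed
    also have "\<dots> = gl_inner \<kk> \<pp> ip C D" by (rule C(2)[OF D(3), symmetric])
    finally show "gl_inner \<kk> \<pp> ip C' D = gl_inner \<kk> \<pp> ip C D" .
  qed
  moreover have "blinfun_apply R (blinfun_apply (adj R) Z) = Z" if "Z \<in> \<pp>" for Z
  proof -
    have "Z = (\<Sum>b\<in>B. ip Z (blinfun_apply R b) *\<^sub>R blinfun_apply R b)"
      using onb_expand[OF onb_image that] sum_onb_image[of "\<lambda>b. ip Z b *\<^sub>R b"] by simp
    also have "\<dots> = blinfun_apply R (blinfun_apply (adj R) Z)"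
      by (simp add: adj_apply blinfun.sum_right blinfun.bilinear_simps)
    finally show ?thesis ..
  qed
  ultimately show ?thesis using gl_p[OF Cg(1)] by (metis C'_def C_def blinfun_apply_blinfun_compose)
qed

end
end

section \<open>Schur's lemma for symmetric maps\<close>

text \<open>Let \<open>\<kappa>\<close> be the maximum of the Rayleigh quotient. Then the form
  \<open>\<kappa>\<close> q(u, w) - q(f u, w) is positive semidefinite and vanishes at the maximiser
  \<open>v\<close>, so \<open>v\<close> lies in its radical; hence \<open>\<kappa>\<close> v - f v
  is q-orthogonal to itself.\<close>

lemma symmetric_eigenvector:
  fixes V :: "'a::euclidean_space set"
  assumes V: "subspace V" "V \<noteq> {0}" and q: "bilinear q" and q_sym: "\<And>X Y. q X Y = (q Y X :: real)"
    and q_pos: "\<And>X. X \<in> V \<Longrightarrow> X \<noteq> 0 \<Longrightarrow> q X X > 0"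
    and f: "linear f" "\<And>X. X \<in> V \<Longrightarrow> f X \<in> V"
    and f_sym: "\<And>X Y. X \<in> V \<Longrightarrow> Y \<in> V \<Longrightarrow> q (f X) Y = q X (f Y)"
  shows "\<exists>v\<in>V. \<exists>\<kappa>. v \<noteq> 0 \<and> f v = \<kappa> *\<^sub>R v"
proof -
  have l: "linear (q X)" "linear (\<lambda>X. q X Y)" for X Y using q by (auto simp: bilinear_def)
  note q_simps = linear_add[OF l(1)] linear_add[OF l(2)] linear_cmul[OF l(1)] linear_cmul[OF l(2)]
    linear_diff[OF l(1)] linear_diff[OF l(2)]
  interpret q: bounded_bilinear q using q bilinear_conv_bounded_bilinear by blast
  have fb: "bounded_linear f" using f(1) linear_conv_bounded_linear by blast
  \<comment> \<open>The unit sphere of the ambient norm, not of \<open>q\<close>, provides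
    compactness. The quotient is homogeneous of degree zero, so its maximum there bounds it on all
    nonzero vectors of \<open>V\<close>.\<close>
  define K where "K = sphere 0 1 \<inter> V"
  have K: "compact K" unfolding K_def
    by (intro compact_Int_closed compact_sphere closed_subspace V)
  obtain w where w: "w \<in> V" "w \<noteq> 0" using V subspace_0 by blast
  have scale: "(1 / norm w) *\<^sub>R w \<in> K" if "w \<in> V" "w \<noteq> 0" for w
    using that V subspace_scale by (auto simp: K_def)
  then have "K \<noteq> {}" using w by blast
  have pos: "q u u > 0" if "u \<in> K" for u using that q_pos[of u] by (cases "u = 0") (auto simp: K_def)
  have "continuous_on K (\<lambda>u. q (f u) u / q u u)"
    using pos by (intro continuous_on_divide q.continuous_on continuous_on_id
        bounded_linear.continuous_on[OF fb]) force
  from continuous_attains_sup[OF K \<open>K \<noteq> {}\<close> this]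
  obtain v where v: "v \<in> K" "\<And>u. u \<in> K \<Longrightarrow> q (f u) u / q u u \<le> q (f v) v / q v v" by blast
  define \<kappa> where "\<kappa> = q (f v) v / q v v"
  have vV: "v \<in> V" "v \<noteq> 0" using v(1) by (auto simp: K_def)
  define g where "g u w = \<kappa> * q u w - q (f u) w" for u w
  have g_nonneg: "g u u \<ge> 0" if "u \<in> V" for u
  proof (cases "u = 0")
    case True
    then show ?thesis by (simp add: g_def q.zero_right)
  next
    case False
    let ?c = "1 / norm u"
    have "q (f (?c *\<^sub>R u)) (?c *\<^sub>R u) / q (?c *\<^sub>R u) (?c *\<^sub>R u) \<le> \<kappa>"
      unfolding \<kappa>_def by (rule v(2)[OF scale[OF that False]])
    also have "q (f (?c *\<^sub>R u)) (?c *\<^sub>R u) / q (?c *\<^sub>R u) (?c *\<^sub>R u) = q (f u) u / q u u"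
      using False by (simp add: linear_cmul[OF f(1)] q_simps)
    finally show ?thesis using q_pos[OF that False] by (simp add: g_def pos_divide_le_eq)
  qed
  have gv: "g v v = 0" using q_pos[OF vV] by (simp add: g_def \<kappa>_def)
  have "g v w = 0" if w: "w \<in> V" for w
  proof (rule ccontr)
    assume ne: "g v w \<noteq> 0"
    have g_sym: "g w v = g v w" using w vV f_sym q_sym by (simp add: g_def)
    have expand: "g (v + t *\<^sub>R w) (v + t *\<^sub>R w) = 2 * t * g v w + t\<^sup>2 * g w w" for t
    proof -
      have "g (v + t *\<^sub>R w) (v + t *\<^sub>R w) = g v v + t * g v w + t * g w v + t * t * g w w"
        unfolding g_def by (simp add: linear_add[OF f(1)] linear_cmul[OF f(1)] q_simps algebra_simps)
      then show ?thesis using gv g_sym by (simp add: power2_eq_square)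
    qed
    have ge: "0 \<le> 2 * t * g v w + t\<^sup>2 * g w w" for t
      unfolding expand[symmetric] using V w vV by (intro g_nonneg subspace_add subspace_scale)
    \<comment> \<open>Chosen to make the quadratic polynomial equal to
      \<open>- t\<^sup>2 (g w w + 2)\<close>, which is negative; the summand 1 covers the case
      \<open>g w w = 0\<close>.\<close>
    define t where "t = - g v w / (g w w + 1)"
    have gw: "g w w \<ge> 0" by (rule g_nonneg[OF w])
    have tt: "t * (g w w + 1) = - g v w" using gw by (simp add: t_def)
    then have "2 * t * g v w + t\<^sup>2 * g w w = - (t\<^sup>2 * (g w w + 2))"
      by (simp add: power2_eq_square) algebra
    moreover have "t \<noteq> 0" using ne gw by (simp add: t_def)
    then have "t\<^sup>2 * (g w w + 2) > 0" using gw by simp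
    ultimately show False using ge[of t] by simp
  qed
  moreover have mem: "\<kappa> *\<^sub>R v - f v \<in> V" using V vV f subspace_diff subspace_scale by blast
  ultimately have "g v (\<kappa> *\<^sub>R v - f v) = 0" by blast
  then have "q (\<kappa> *\<^sub>R v - f v) (\<kappa> *\<^sub>R v - f v) = 0" unfolding g_def by (simp add: q_simps algebra_simps)
  then have "\<kappa> *\<^sub>R v - f v = 0" using q_pos[OF mem] by force
  then show ?thesis using vV by (intro bexI[of _ v] exI[of _ \<kappa>]) auto
qed

text \<open>Kernel and image are invariant, so a nonzero value makes \<open>f\<close> itself a
  bijective intertwiner between \<open>V\<close> and \<open>W\<close>, which is excluded.\<close>

lemma schur_zero:
  assumes V: "irreducible_subrep \<rho> K V" and W: "irreducible_subrep \<rho> K W"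
    and ne: "\<not> equivalent_subreps \<rho> K V W"
    and \<rho>: "\<And>g. g \<in> K \<Longrightarrow> linear (\<rho> g)"
    and f: "linear f" "\<And>v. v \<in> V \<Longrightarrow> f v \<in> W"
    and comm: "\<And>g v. g \<in> K \<Longrightarrow> v \<in> V \<Longrightarrow> f (\<rho> g v) = \<rho> g (f v)"
    and v: "v \<in> V"
  shows "f v = 0"
proof (rule ccontr)
  assume nz: "f v \<noteq> 0"
  have inv: "subspace V" "subspace W" "\<And>g v. g \<in> K \<Longrightarrow> v \<in> V \<Longrightarrow> \<rho> g v \<in> V"
    "\<And>g v. g \<in> K \<Longrightarrow> v \<in> W \<Longrightarrow> \<rho> g v \<in> W"
    using V W unfolding irreducible_subrep_def invariant_subspace_def by auto
  have "subspace {u \<in> V. f u = 0}"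
    using inv(1) by (auto simp: subspace_def linear_0[OF f(1)] linear_add[OF f(1)] linear_cmul[OF f(1)])
  then have "invariant_subspace \<rho> K {u \<in> V. f u = 0}"
    unfolding invariant_subspace_def using inv(3) comm linear_0[OF \<rho>] by auto
  then have "{u \<in> V. f u = 0} = {0} \<or> {u \<in> V. f u = 0} = V"
    using V unfolding irreducible_subrep_def by (metis (no_types, lifting) mem_Collect_eq subsetI)
  then have ker: "{u \<in> V. f u = 0} = {0}" using v nz by blast
  have "inj_on f V"
  proof (rule inj_onI)
    fix a b assume ab: "a \<in> V" "b \<in> V" "f a = f b"
    then have "a - b \<in> {u \<in> V. f u = 0}" using inv(1) by (simp add: subspace_diff linear_diff[OF f(1)])
    then show "a = b" using ker by simp
  qed
  moreover have "invariant_subspace \<rho> K (f ` V)"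
    unfolding invariant_subspace_def
    using linear_subspace_image[OF f(1) inv(1)] inv(3) comm[symmetric] by auto
  then have "f ` V = {0} \<or> f ` V = W"
    using W f(2) unfolding irreducible_subrep_def by (metis (no_types, lifting) image_subsetI)
  then have "f ` V = W" using v nz by blast
  ultimately have "equivalent_subreps \<rho> K V W"
    unfolding equivalent_subreps_def bij_betw_def using f(1) comm by blast
  then show False using ne by blast
qed

text \<open>Over the reals an intertwiner of an irreducible representation need not be scalar.
  Symmetry supplies a real eigenvalue, and its eigenspace is invariant and nonzero, hence
  everything.\<close>

lemma schur_symmetric_scalar:
  fixes V :: "'a::euclidean_space set"
  assumes V: "irreducible_subrep \<rho> K V"
    and \<rho>: "\<And>g. g \<in> K \<Longrightarrow> linear (\<rho> g)"
    and q: "bilinear q" and q_sym: "\<And>X Y. q X Y = (q Y X :: real)"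
    and q_pos: "\<And>X. X \<in> V \<Longrightarrow> X \<noteq> 0 \<Longrightarrow> q X X > 0"
    and f: "linear f" "\<And>X. X \<in> V \<Longrightarrow> f X \<in> V"
    and f_sym: "\<And>X Y. X \<in> V \<Longrightarrow> Y \<in> V \<Longrightarrow> q (f X) Y = q X (f Y)"
    and comm: "\<And>g v. g \<in> K \<Longrightarrow> v \<in> V \<Longrightarrow> f (\<rho> g v) = \<rho> g (f v)"
  shows "\<exists>\<kappa>. \<forall>v\<in>V. f v = \<kappa> *\<^sub>R v"
proof -
  have inv: "subspace V" "V \<noteq> {0}" "\<And>g v. g \<in> K \<Longrightarrow> v \<in> V \<Longrightarrow> \<rho> g v \<in> V"
    using V unfolding irreducible_subrep_def invariant_subspace_def by auto
  obtain v \<kappa> where v: "v \<in> V" "v \<noteq> 0" "f v = \<kappa> *\<^sub>R v"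
    using symmetric_eigenvector[OF inv(1,2) q q_sym q_pos f f_sym] by blast
  have "subspace {u \<in> V. f u = \<kappa> *\<^sub>R u}"
    using inv(1) by (auto simp: subspace_def linear_0[OF f(1)] linear_add[OF f(1)] linear_cmul[OF f(1)] scaleR_add_right)
  then have "invariant_subspace \<rho> K {u \<in> V. f u = \<kappa> *\<^sub>R u}"
    unfolding invariant_subspace_def using inv(3) comm linear_cmul[OF \<rho>] by auto
  then have "{u \<in> V. f u = \<kappa> *\<^sub>R u} = {0} \<or> {u \<in> V. f u = \<kappa> *\<^sub>R u} = V"
    using V unfolding irreducible_subrep_def by (metis (no_types, lifting) mem_Collect_eq subsetI)
  then show ?thesis using v by blast
qed

section \<open>Diagonal metrics\<close>

text \<open>For \<open>k \<noteq> m\<close> the product of the two weights leaves six terms: +1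
  where {i, j} = {k, m}, -1 where \<open>l\<close> takes one of the two values and one of
  \<open>i\<close>, \<open>j\<close> the other. Symmetry of \<open>w\<close> in its lower indices
  pairs them, which absorbs the factor 1/2.\<close>

lemma delta_sum_offdiag:
  fixes w :: "nat \<Rightarrow> nat \<Rightarrow> nat \<Rightarrow> real"
  assumes "finite I" "k \<in> I" "m \<in> I" "k \<noteq> m"
    and sym: "\<And>i j l. w i j l = w j i l"
  shows "1/2 * (\<Sum>i\<in>I. \<Sum>j\<in>I. \<Sum>l\<in>I.
      (of_bool (l = m) - of_bool (i = m) - of_bool (j = m)) * (of_bool (l = k) - of_bool (i = k) - of_bool (j = k)) * w i j l)
    = (\<Sum>i\<in>I. w k m i - w i m k - w i k m)"
proof -
  have pt: "(of_bool (l = m) - of_bool (i = m) - of_bool (j = m)) * (of_bool (l = k) - of_bool (i = k) - of_bool (j = k)) * w i j l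
    = (if i = m then if j = k then w i j l else 0 else 0) + (if i = k then if j = m then w i j l else 0 else 0)
     - (if i = k then if l = m then w i j l else 0 else 0) - (if j = k then if l = m then w i j l else 0 else 0)
     - (if i = m then if l = k then w i j l else 0 else 0) - (if j = m then if l = k then w i j l else 0 else 0)"
    for i j l using assms(4) by (auto simp: of_bool_def)
  have d: "(\<Sum>i\<in>I. if i = a then f i else 0) = f a" if "a \<in> I" for a and f :: "nat \<Rightarrow> real"
    using that assms(1) by simp
  have pull: "(\<Sum>i\<in>I. if b then f i else 0) = (if b then \<Sum>i\<in>I. f i else 0)" for b and f :: "nat \<Rightarrow> real"
    by simp
  have "(\<Sum>i\<in>I. \<Sum>j\<in>I. \<Sum>l\<in>I. if i = a then if j = b then w i j l else 0 else 0) = (\<Sum>l\<in>I. w a b l)"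
    "(\<Sum>i\<in>I. \<Sum>j\<in>I. \<Sum>l\<in>I. if i = a then if l = b then w i j l else 0 else 0) = (\<Sum>j\<in>I. w a j b)"
    "(\<Sum>i\<in>I. \<Sum>j\<in>I. \<Sum>l\<in>I. if j = a then if l = b then w i j l else 0 else 0) = (\<Sum>i\<in>I. w i a b)"
    if "a \<in> I" "b \<in> I" for a b
    by (simp_all only: pull d that)
  note sums = this
  have "(\<Sum>l\<in>I. w m k l) = (\<Sum>l\<in>I. w k m l)" "(\<Sum>j\<in>I. w k j m) = (\<Sum>i\<in>I. w i k m)"
    "(\<Sum>j\<in>I. w m j k) = (\<Sum>i\<in>I. w i m k)"
    by (intro sum.cong refl sym)+
  note eqs = this
  show ?thesis
    unfolding pt sum.distrib sum_subtractf sums[OF assms(2,3)] sums[OF assms(3,2)] eqs by simp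
qed

text \<open>With weight c in {1, 0, -1, -2} the coefficient is (c^2 + c)/2, which vanishes for c = 0
  and c = -1 and equals 1 for c = 1 and c = -2. These two cases are \<open>l = k\<close> with
  \<open>i\<close>, \<open>j\<close> different from \<open>k\<close>, and \<open>i = j = k\<close>
  with \<open>l \<noteq> k\<close>; the triple (k, k, k) has c = -1 and drops out.\<close>

lemma delta_sum_diag:
  fixes w :: "nat \<Rightarrow> nat \<Rightarrow> nat \<Rightarrow> real"
  assumes I: "finite I" "k \<in> I"
  shows "1/2 * (\<Sum>i\<in>I. \<Sum>j\<in>I. \<Sum>l\<in>I.
      (of_bool (l = k) - of_bool (i = k) - of_bool (j = k)) * (of_bool (l = k) - of_bool (i = k) - of_bool (j = k)) * w i j l)
    + 1/2 * (\<Sum>i\<in>I. \<Sum>j\<in>I. \<Sum>l\<in>I. (of_bool (l = k) - of_bool (i = k) - of_bool (j = k)) * w i j l)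
    = (\<Sum>i\<in>I - {k}. \<Sum>j\<in>I - {k}. w i j k) + (\<Sum>l\<in>I - {k}. w k k l)"
proof -
  have pt: "1/2 * ((of_bool (l = k) - of_bool (i = k) - of_bool (j = k)) * (of_bool (l = k) - of_bool (i = k) - of_bool (j = k)) * w i j l)
     + 1/2 * ((of_bool (l = k) - of_bool (i = k) - of_bool (j = k)) * w i j l)
     = (if l = k then if i \<noteq> k then if j \<noteq> k then w i j k else 0 else 0 else 0)
     + (if i = k then if j = k then if l \<noteq> k then w k k l else 0 else 0 else 0)" for i j l
    by (auto simp: of_bool_def)
  have rem: "(\<Sum>i\<in>I - {k}. f i) = (\<Sum>i\<in>I. if i \<noteq> k then f i else 0)" for f :: "nat \<Rightarrow> real"
    using I by (intro sum.mono_neutral_cong_left) auto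
  have d: "(\<Sum>i\<in>I. if i = k then f i else 0) = f k" for f :: "nat \<Rightarrow> real" using I by simp
  have pull: "(\<Sum>i\<in>I. if b then f i else 0) = (if b then \<Sum>i\<in>I. f i else 0)" for b and f :: "nat \<Rightarrow> real"
    by simp
  have "(\<Sum>i\<in>I. \<Sum>j\<in>I. \<Sum>l\<in>I. if l = k then if i \<noteq> k then if j \<noteq> k then w i j k else 0 else 0 else 0)
    = (\<Sum>i\<in>I - {k}. \<Sum>j\<in>I - {k}. w i j k)"
    unfolding rem d by (intro sum.cong refl) simp
  moreover have "(\<Sum>i\<in>I. \<Sum>j\<in>I. \<Sum>l\<in>I. if i = k then if j = k then if l \<noteq> k then w k k l else 0 else 0 else 0)
    = (\<Sum>l\<in>I - {k}. w k k l)"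
    unfolding rem pull d ..
  ultimately show ?thesis
    unfolding sum_distrib_left sum.distrib[symmetric] pt unfolding sum.distrib by simp
qed

section \<open>Block projections and the adapted orthonormal basis\<close>

locale diagonal_metric =
  fixes \<kk> \<pp> :: "'b::euclidean_space set" and Q :: "'b \<Rightarrow> 'b \<Rightarrow> real"
    and r :: nat and P E :: "nat \<Rightarrow> 'b set" and x :: "nat \<Rightarrow> real"
  assumes Q: "inner_product_on UNIV Q"
    and p: "subspace \<pp>"
    and kp_sum: "\<And>X. \<exists>Y\<in>\<kk>. \<exists>Z\<in>\<pp>. X = Y + Z"
    and kp_orth: "\<And>Y Z. Y \<in> \<kk> \<Longrightarrow> Z \<in> \<pp> \<Longrightarrow> Q Y Z = 0"
    and decomp: "orthogonal_decomposition Q \<pp> {1..r} P"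
    and E: "\<And>i. i \<in> {1..r} \<Longrightarrow> orthonormal_basis (P i) Q (E i)"
    and x: "\<And>i. i \<in> {1..r} \<Longrightarrow> x i > 0"
begin

lemma Q_sym: "Q X Y = Q Y X"
  using Q unfolding inner_product_on_def by blast

lemma Q_pos: "X \<noteq> 0 \<Longrightarrow> Q X X > 0"
  using Q unfolding inner_product_on_def by blast

lemma linear_Q_left: "linear (\<lambda>X. Q X Y)"
proof -
  have *: "Q (a *\<^sub>R X + b *\<^sub>R X') Y = a * Q X Y + b * Q X' Y" for a b X X'
    using Q unfolding inner_product_on_def by blast
  show ?thesis
    using *[of 1 _ 1] *[of _ _ 0 0] by (intro linearI) auto
qed

lemma linear_Q_right: "linear (Q X)"
proof -
  have "Q X = (\<lambda>Y. Q Y X)" by (rule ext) (rule Q_sym)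
  then show ?thesis using linear_Q_left by (rule ssubst[where P=linear])
qed

lemma bilinear_Q: "bilinear Q"
  using linear_Q_left linear_Q_right by (simp add: bilinear_def)

lemmas Q_simps = linear_add[OF linear_Q_left] linear_add[OF linear_Q_right]
  linear_cmul[OF linear_Q_left, simplified] linear_cmul[OF linear_Q_right, simplified]
  linear_sum[OF linear_Q_left] linear_sum[OF linear_Q_right]
  linear_diff[OF linear_Q_left] linear_diff[OF linear_Q_right]
  linear_0[OF linear_Q_left] linear_0[OF linear_Q_right]

lemma k_iff: "Y \<in> \<kk> \<longleftrightarrow> (\<forall>Z\<in>\<pp>. Q Y Z = 0)"
proof
  assume *: "\<forall>Z\<in>\<pp>. Q Y Z = 0"
  obtain Y' Z where YZ: "Y' \<in> \<kk>" "Z \<in> \<pp>" "Y = Y' + Z" using kp_sum by blast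
  have "Q Y Z = Q Y' Z + Q Z Z" by (simp add: YZ(3) Q_simps)
  then have "Q Z Z = 0" using * YZ kp_orth by simp
  then have "Z = 0" using Q_pos[of Z] by fastforce
  then show "Y \<in> \<kk>" using YZ by simp
qed (use kp_orth in blast)

lemma subspace_kk: "subspace \<kk>"
  unfolding subspace_def by (auto simp: k_iff Q_simps)

lemma P_subspace: "i \<in> {1..r} \<Longrightarrow> subspace (P i)"
  using decomp unfolding orthogonal_decomposition_def by blast

lemma P_orth: "i \<in> {1..r} \<Longrightarrow> j \<in> {1..r} \<Longrightarrow> i \<noteq> j \<Longrightarrow> X \<in> P i \<Longrightarrow> Y \<in> P j \<Longrightarrow> Q X Y = 0"
  using decomp unfolding orthogonal_decomposition_def by blast

lemma p_eq: "\<pp> = {\<Sum>i\<in>{1..r}. w i | w. \<forall>i\<in>{1..r}. w i \<in> P i}"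
  using decomp unfolding orthogonal_decomposition_def by blast

lemma P_sub: assumes i: "i \<in> {1..r}" shows "P i \<subseteq> \<pp>"
proof
  fix X assume X: "X \<in> P i"
  define w where "w j = (if j = i then X else 0)" for j
  have "(\<Sum>j\<in>{1..r}. w j) = X" using i by (simp add: w_def)
  moreover have "\<forall>j\<in>{1..r}. w j \<in> P j" using X by (simp add: w_def P_subspace subspace_0)
  ultimately show "X \<in> \<pp>" unfolding p_eq by blast
qed

lemma E_in: "i \<in> {1..r} \<Longrightarrow> a \<in> E i \<Longrightarrow> a \<in> P i"
  using E unfolding orthonormal_basis_def by blast

lemma E_Q: "i \<in> {1..r} \<Longrightarrow> a \<in> E i \<Longrightarrow> b \<in> E i \<Longrightarrow> Q a b = (if a = b then 1 else 0)"
  using E unfolding orthonormal_basis_def by blast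

lemma E_finite: "i \<in> {1..r} \<Longrightarrow> finite (E i)"
  using orthonormal_basis_finite[OF bilinear_Q E] .

lemma E_expand: "i \<in> {1..r} \<Longrightarrow> X \<in> P i \<Longrightarrow> (\<Sum>b\<in>E i. Q X b *\<^sub>R b) = X"
  using orthonormal_basis_expand[OF bilinear_Q E] .

text \<open>The Q-orthogonal projection onto \<open>P k\<close>. As a Fourier sum it is linear on
  the whole space and kills \<open>\<kk>\<close>, and it becomes the witness for
  \<open>block_id\<close>.\<close>

definition blk :: "nat \<Rightarrow> ('b \<Rightarrow>\<^sub>L 'b)" where
  "blk k = Blinfun (\<lambda>X. \<Sum>b\<in>E k. Q X b *\<^sub>R b)"

lemma blk_apply: "blinfun_apply (blk k) X = (\<Sum>b\<in>E k. Q X b *\<^sub>R b)"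
  unfolding blk_def
  by (subst Blinfun_linear) (auto intro!: linearI simp: Q_simps scaleR_left_distrib sum.distrib scaleR_sum_right)

lemma blk_in: "k \<in> {1..r} \<Longrightarrow> blinfun_apply (blk k) X \<in> P k"
  unfolding blk_apply by (intro subspace_sum subspace_scale P_subspace E_in)

lemma blk_P: "k \<in> {1..r} \<Longrightarrow> X \<in> P k \<Longrightarrow> blinfun_apply (blk k) X = X"
  unfolding blk_apply by (rule E_expand)

lemma blk_other: "k \<in> {1..r} \<Longrightarrow> i \<in> {1..r} \<Longrightarrow> i \<noteq> k \<Longrightarrow> X \<in> P i \<Longrightarrow> blinfun_apply (blk k) X = 0"
  unfolding blk_apply using E_in P_orth by (intro sum.neutral ballI) simp

lemma blk_kk: "k \<in> {1..r} \<Longrightarrow> X \<in> \<kk> \<Longrightarrow> blinfun_apply (blk k) X = 0"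
  unfolding blk_apply using E_in P_sub kp_orth by (intro sum.neutral ballI) (simp add: subset_iff)

lemma Q_blk: "Q (blinfun_apply (blk k) X) Y = Q X (blinfun_apply (blk k) Y)"
proof -
  have "Q (blinfun_apply (blk k) X) Y = (\<Sum>b\<in>E k. Q X b * Q b Y)" by (simp add: blk_apply Q_simps)
  also have "\<dots> = (\<Sum>b\<in>E k. Q Y b * Q X b)" by (intro sum.cong refl) (metis Q_sym mult.commute)
  also have "\<dots> = Q X (blinfun_apply (blk k) Y)" by (simp add: blk_apply Q_simps)
  finally show ?thesis .
qed

lemma sum_blk: assumes "X \<in> \<pp>" shows "(\<Sum>k\<in>{1..r}. blinfun_apply (blk k) X) = X"
proof -
  obtain w where w: "X = (\<Sum>i\<in>{1..r}. w i)" "\<And>i. i \<in> {1..r} \<Longrightarrow> w i \<in> P i"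
    using assms unfolding p_eq by blast
  have "blinfun_apply (blk k) X = w k" if k: "k \<in> {1..r}" for k
  proof -
    have "blinfun_apply (blk k) X = (\<Sum>i\<in>{1..r}. blinfun_apply (blk k) (w i))"
      unfolding w(1) by (rule blinfun.sum_right)
    also have "\<dots> = (\<Sum>i\<in>{1..r}. if i = k then w i else 0)"
      using k by (intro sum.cong refl) (simp add: w(2) blk_P blk_other)
    finally show ?thesis using k by simp
  qed
  then show ?thesis by (simp add: w(1))
qed

lemma blk_gl: "k \<in> {1..r} \<Longrightarrow> blk k \<in> gl_on \<kk> \<pp>"
  using blk_in P_sub blk_kk unfolding gl_on_def by blast

lemma gl_on_P_eqI:
  assumes A: "A \<in> gl_on \<kk> \<pp>" and A': "A' \<in> gl_on \<kk> \<pp>"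
    and eq: "\<And>i X. i \<in> {1..r} \<Longrightarrow> X \<in> P i \<Longrightarrow> blinfun_apply A X = blinfun_apply A' X"
  shows "A = A'"
proof (rule blinfun_eqI)
  fix X
  obtain Y Z where YZ: "Y \<in> \<kk>" "Z \<in> \<pp>" "X = Y + Z" using kp_sum by blast
  have "blinfun_apply A Z = (\<Sum>k\<in>{1..r}. blinfun_apply A (blinfun_apply (blk k) Z))"
    by (subst sum_blk[OF YZ(2), symmetric]) (rule blinfun.sum_right)
  also have "\<dots> = (\<Sum>k\<in>{1..r}. blinfun_apply A' (blinfun_apply (blk k) Z))"
    by (intro sum.cong refl) (rule eq[OF _ blk_in])
  also have "\<dots> = blinfun_apply A' (\<Sum>k\<in>{1..r}. blinfun_apply (blk k) Z)"
    by (rule blinfun.sum_right[symmetric])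
  finally have "blinfun_apply A Z = blinfun_apply A' Z" by (simp only: sum_blk[OF YZ(2)])
  moreover have "blinfun_apply A Y = 0" "blinfun_apply A' Y = 0"
    using A A' YZ by (auto simp: gl_on_def)
  ultimately show "blinfun_apply A X = blinfun_apply A' X"
    by (simp add: YZ(3) blinfun.add_right)
qed

lemma block_id_eq: assumes k: "k \<in> {1..r}" shows "block_id \<kk> \<pp> r P k = blk k"
  unfolding block_id_def
proof (rule the_equality)
  show *: "blk k \<in> gl_on \<kk> \<pp> \<and> (\<forall>X\<in>P k. blinfun_apply (blk k) X = X) \<and>
        (\<forall>i\<in>{1..r} - {k}. \<forall>X\<in>P i. blinfun_apply (blk k) X = 0)"
    using k blk_gl blk_P blk_other by blast
  fix A assume A: "A \<in> gl_on \<kk> \<pp> \<and> (\<forall>X\<in>P k. blinfun_apply A X = X) \<and>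
        (\<forall>i\<in>{1..r} - {k}. \<forall>X\<in>P i. blinfun_apply A X = 0)"
  show "A = blk k"
  proof (rule gl_on_P_eqI)
    fix i X assume "i \<in> {1..r}" "X \<in> P i"
    then show "blinfun_apply A X = blinfun_apply (blk k) X"
      using A * by (cases "i = k") auto
  qed (use A blk_gl[OF k] in auto)
qed

definition ip :: "'b \<Rightarrow> 'b \<Rightarrow> real" where "ip = diag_metric \<kk> \<pp> r P Q x"

text \<open>One projection suffices, as \<open>blk i\<close> is idempotent and Q-self-adjoint. In
  this form linearity in the first argument and the collapse to a single block are visible.\<close>

lemma ip_eq: "ip X Y = (\<Sum>i\<in>{1..r}. x i * Q (blinfun_apply (blk i) X) Y)"
  unfolding ip_def diag_metric_def
proof (intro sum.cong refl)
  fix i assume i: "i \<in> {1..r}"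
  have "Q (blinfun_apply (blk i) X) (blinfun_apply (blk i) Y) = Q (blinfun_apply (blk i) X) Y"
    by (simp only: Q_blk[symmetric] blk_P[OF i blk_in[OF i]])
  then show "x i * Q (blinfun_apply (block_id \<kk> \<pp> r P i) X) (blinfun_apply (block_id \<kk> \<pp> r P i) Y) =
       x i * Q (blinfun_apply (blk i) X) Y" by (simp only: block_id_eq[OF i])
qed

lemma ip_P: assumes i: "i \<in> {1..r}" "X \<in> P i" shows "ip X Y = x i * Q X Y"
proof -
  have "ip X Y = (\<Sum>j\<in>{1..r}. if j = i then x i * Q X Y else 0)"
    unfolding ip_eq using i by (intro sum.cong refl) (simp add: blk_P blk_other Q_simps)
  then show ?thesis using i by simp
qed

lemma ip_expand: "ip X Y = (\<Sum>l\<in>{1..r}. \<Sum>c\<in>E l. x l * (Q X c * Q Y c))"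
  unfolding ip_eq blk_apply
  by (intro sum.cong refl) (simp add: Q_simps sum_distrib_left Q_sym[of _ Y])

text \<open>Rescaling turns a Q-unit vector of \<open>P i\<close> into a unit vector of the metric.
  Arguments are pairs so that the block is remembered, and sums over \<open>B\<close> split by
  blocks.\<close>

definition s :: "nat \<times> 'b \<Rightarrow> 'b" where "s = (\<lambda>(i, a). (1 / sqrt (x i)) *\<^sub>R a)"

definition B :: "'b set" where "B = s ` (SIGMA i:{1..r}. E i)"

lemma s_in: "i \<in> {1..r} \<Longrightarrow> a \<in> E i \<Longrightarrow> s (i, a) \<in> P i"
  by (simp add: s_def E_in P_subspace subspace_scale)

lemma ip_s:
  assumes i: "i \<in> {1..r}" "a \<in> E i" and j: "j \<in> {1..r}" "b \<in> E j"
  shows "ip (s (i, a)) (s (j, b)) = (if (i, a) = (j, b) then 1 else 0)"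
proof (cases "i = j")
  case True
  have "ip (s (i, a)) (s (j, b)) = x i * (1 / sqrt (x i)) * (1 / sqrt (x i)) * Q a b"
    unfolding ip_P[OF i(1) s_in[OF i]] by (simp add: s_def True Q_simps)
  also have "x i * (1 / sqrt (x i)) * (1 / sqrt (x i)) = 1" using x[OF i(1)] by simp
  finally show ?thesis using True E_Q[OF i(1,2)] j by simp
next
  case False
  then show ?thesis unfolding ip_P[OF i(1) s_in[OF i]]
    using P_orth[OF i(1) j(1) False s_in[OF i] s_in[OF j]] by simp
qed

lemma s_inj: "inj_on s (SIGMA i:{1..r}. E i)"
proof (rule inj_onI)
  fix u v assume uv: "u \<in> (SIGMA i:{1..r}. E i)" "v \<in> (SIGMA i:{1..r}. E i)" "s u = s v"
  obtain i a where u: "u = (i, a)" "i \<in> {1..r}" "a \<in> E i" using uv(1) by blast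
  obtain j b where v: "v = (j, b)" "j \<in> {1..r}" "b \<in> E j" using uv(2) by blast
  have "ip (s u) (s v) = 1" using ip_s[OF u(2,3) u(2,3)] u(1) uv(3) by simp
  then show "u = v" using ip_s[OF u(2,3) v(2,3)] unfolding u(1) v(1) by (simp split: if_splits)
qed

lemma sum_B: "(\<Sum>X\<in>B. f X) = (\<Sum>i\<in>{1..r}. \<Sum>a\<in>E i. f (s (i, a)))"
  unfolding B_def sum.reindex[OF s_inj] using E_finite
  by (simp add: sum.Sigma case_prod_beta o_def)

lemma onb_B: "orthonormal_basis \<pp> ip B"
  unfolding orthonormal_basis_def
proof (intro conjI ballI)
  show sub: "B \<subseteq> \<pp>" unfolding B_def using s_in P_sub by fastforce
  have "E i \<subseteq> span B" if i: "i \<in> {1..r}" for i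
  proof
    fix a assume "a \<in> E i"
    then have "s (i, a) \<in> span B" using i by (intro span_base) (auto simp: B_def)
    from span_scale[OF this, of "sqrt (x i)"] show "a \<in> span B"
      using x[OF i] by (simp add: s_def)
  qed
  then have Pi: "P i \<subseteq> span B" if "i \<in> {1..r}" for i
    using span_minimal[OF _ subspace_span, of "E i" B] E[OF that] that by (simp add: orthonormal_basis_def)
  have "\<pp> \<subseteq> span B"
  proof
    fix X assume "X \<in> \<pp>"
    then obtain w where w: "X = (\<Sum>i\<in>{1..r}. w i)" "\<And>i. i \<in> {1..r} \<Longrightarrow> w i \<in> P i"
      unfolding p_eq by blast
    show "X \<in> span B" unfolding w(1) using w(2) Pi by (intro span_sum) blast
  qed
  then show "span B = \<pp>" using span_minimal[OF sub p] by blast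
  fix u v assume "u \<in> B" "v \<in> B"
  then obtain i a j b where u: "i \<in> {1..r}" "a \<in> E i" "u = s (i, a)"
    and v: "j \<in> {1..r}" "b \<in> E j" "v = s (j, b)" unfolding B_def by blast
  have "(i, a) \<in> (SIGMA i:{1..r}. E i)" "(j, b) \<in> (SIGMA i:{1..r}. E i)" using u v by blast+
  then have "u = v \<longleftrightarrow> (i, a) = (j, b)"
    unfolding u(3) v(3) by (rule inj_on_eq_iff[OF s_inj])
  then show "ip u v = (if u = v then 1 else 0)"
    using ip_s[OF u(1,2) v(1,2)] unfolding u(3) v(3) by (simp only:)
qed

sublocale metric_complement \<kk> \<pp> ip B
proof
  show "subspace \<kk>" by (rule subspace_kk)
  show "subspace \<pp>" by (rule p)
  show "\<exists>Y\<in>\<kk>. \<exists>Z\<in>\<pp>. X = Y + Z" for X by (rule kp_sum)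
  show sym: "ip X Y = ip Y X" for X Y
    unfolding ip_expand by (simp add: mult.commute)
  have lin: "linear (\<lambda>X. ip X Y)" for Y
    unfolding ip_eq
    by (intro linearI) (simp_all add: blinfun.bilinear_simps Q_simps distrib_left sum.distrib sum_distrib_left mult.left_commute)
  moreover have "linear (ip X)" for X
  proof -
    have "ip X = (\<lambda>Y. ip Y X)" by (rule ext) (rule sym)
    then show ?thesis using lin[of X] by (rule ssubst[where P=linear])
  qed
  ultimately show "bilinear ip" unfolding bilinear_def by blast
  show "ip X Y = 0" if "X \<in> \<kk>" for X Y
    unfolding ip_eq using blk_kk[OF _ that] by (simp add: Q_simps)
  show "ip X X > 0" if X: "X \<in> \<pp>" "X \<noteq> 0" for X
  proof -
    have nn: "Q (blinfun_apply (blk i) X) X = Q (blinfun_apply (blk i) X) (blinfun_apply (blk i) X)"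
      if i: "i \<in> {1..r}" for i
      by (simp only: Q_blk[symmetric] blk_P[OF i blk_in[OF i]])
    have "\<exists>i\<in>{1..r}. blinfun_apply (blk i) X \<noteq> 0"
    proof (rule ccontr)
      assume "\<not> ?thesis"
      then have "(\<Sum>i\<in>{1..r}. blinfun_apply (blk i) X) = 0" by (intro sum.neutral) blast
      with sum_blk[OF X(1)] X(2) show False by simp
    qed
    then obtain i where i: "i \<in> {1..r}" "blinfun_apply (blk i) X \<noteq> 0" by blast
    have nonneg: "Q Z Z \<ge> 0" for Z using Q_pos[of Z] by (cases "Z = 0") (auto simp: Q_simps)
    show ?thesis unfolding ip_eq
    proof (rule sum_pos2[OF _ i(1)])
      show "0 < x i * Q (blinfun_apply (blk i) X) X" using nn[OF i(1)] x[OF i(1)] Q_pos[OF i(2)] by simp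
      show "0 \<le> x j * Q (blinfun_apply (blk j) X) X" if "j \<in> {1..r}" for j
        using nn[OF that] x[OF that] nonneg by simp
    qed simp
  qed
  show "orthonormal_basis \<pp> ip B" by (rule onb_B)
qed

lemma Q_pr: "c \<in> \<pp> \<Longrightarrow> Q (pr Z) c = Q Z c"
  using kp_orth[OF diff_pr[of Z]] by (simp add: Q_simps)

lemma blk_s:
  assumes "k \<in> {1..r}" "i \<in> {1..r}" "a \<in> E i"
  shows "blinfun_apply (blk k) (s (i, a)) = (if i = k then 1 else 0) *\<^sub>R s (i, a)"
  using blk_P[OF assms(1), of "s (i, a)"] blk_other[OF assms(1,2) _ s_in[OF assms(2,3)]]
    s_in[OF assms(2,3)] by (cases "i = k") simp_all

lemma blk_sym: assumes "k \<in> {1..r}" shows "blk k \<in> sym_on \<kk> \<pp> ip"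
proof -
  have "adj (blk k) = blk k"
  proof (rule adj_unique[OF blk_gl blk_gl])
    fix X Y
    have a: "ip (blinfun_apply (blk k) Z) W = x k * Q (blinfun_apply (blk k) Z) W" for Z W
      by (rule ip_P[OF assms blk_in[OF assms]])
    show "ip (blinfun_apply (blk k) X) Y = ip X (blinfun_apply (blk k) Y)"
      unfolding ip_sym[of X] a Q_blk[of k Y] Q_sym[of Y] ..
  qed (use assms in auto)
  then show ?thesis using blk_gl[OF assms] by (simp add: sym_on_iff)
qed

lemma gl_inner_blk:
  assumes k: "k \<in> {1..r}" and m: "m \<in> {1..r}"
  shows "gl_inner \<kk> \<pp> ip (blk k) (blk m) = (if k = m then real (card (E k)) else 0)"
proof -
  have "gl_inner \<kk> \<pp> ip (blk k) (blk m) =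
     (\<Sum>i\<in>{1..r}. \<Sum>a\<in>E i. ip (blinfun_apply (blk k) (s (i, a))) (blinfun_apply (blk m) (s (i, a))))"
    by (simp only: gl_inner_eq[OF onb_B blk_gl[OF k] blk_gl[OF m]] sum_B)
  also have "\<dots> = (\<Sum>i\<in>{1..r}. \<Sum>a\<in>E i. if i = k \<and> i = m then 1 else 0)"
    using k m by (intro sum.cong refl) (simp add: blk_s ip_s ip_simps)
  also have "\<dots> = (\<Sum>i\<in>{1..r}. if i = k \<and> k = m then real (card (E k)) else 0)"
    by (intro sum.cong refl) auto
  finally show ?thesis using k by (cases "k = m") auto
qed

text \<open>\<open>f\<close> and \<open>f'\<close> are the multipliers of the two tensors on the
  block component (i, j, l) of \<open>br\<close>. In the weight, \<open>x l\<close> is the metric on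
  the values and the denominator comes from rescaling both arguments. The bracket itself is the case
  of multiplier 1.\<close>

lemma bracket_inner_diag:
  assumes "bilinear \<nu>" "bilinear \<nu>'"
    and \<nu>: "\<And>i j l a b c. \<lbrakk>i \<in> {1..r}; j \<in> {1..r}; l \<in> {1..r}; a \<in> E i; b \<in> E j; c \<in> E l\<rbrakk> \<Longrightarrow>
      Q (\<nu> (s (i, a)) (s (j, b))) c = f i j l * (Q (br a b) c / (sqrt (x i) * sqrt (x j)))"
    and \<nu>': "\<And>i j l a b c. \<lbrakk>i \<in> {1..r}; j \<in> {1..r}; l \<in> {1..r}; a \<in> E i; b \<in> E j; c \<in> E l\<rbrakk> \<Longrightarrow>
      Q (\<nu>' (s (i, a)) (s (j, b))) c = f' i j l * (Q (br a b) c / (sqrt (x i) * sqrt (x j)))"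
  shows "bracket_inner \<pp> ip \<nu> \<nu>' = (\<Sum>i\<in>{1..r}. \<Sum>j\<in>{1..r}. \<Sum>l\<in>{1..r}.
    f i j l * f' i j l * (x l / (x i * x j) * struct_const Q br E i j l))"
proof -
  have "bracket_inner \<pp> ip \<nu> \<nu>' = (\<Sum>i\<in>{1..r}. \<Sum>a\<in>E i. \<Sum>j\<in>{1..r}. \<Sum>b\<in>E j.
      \<Sum>l\<in>{1..r}. \<Sum>c\<in>E l. x l * (Q (\<nu> (s (i, a)) (s (j, b))) c * Q (\<nu>' (s (i, a)) (s (j, b))) c))"
    by (simp only: bracket_inner_eq[OF onb_B assms(1,2)] sum_B ip_expand)
  also have "\<dots> = (\<Sum>i\<in>{1..r}. \<Sum>a\<in>E i. \<Sum>j\<in>{1..r}. \<Sum>b\<in>E j.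
      \<Sum>l\<in>{1..r}. \<Sum>c\<in>E l. f i j l * f' i j l * (x l / (x i * x j)) * (Q (br a b) c)\<^sup>2)"
  proof (intro sum.cong refl)
    fix i a j b l c assume *: "i \<in> {1..r}" "a \<in> E i" "j \<in> {1..r}" "b \<in> E j" "l \<in> {1..r}" "c \<in> E l"
    have "sqrt (x i) * sqrt (x j) * (sqrt (x i) * sqrt (x j)) = (sqrt (x i) * sqrt (x i)) * (sqrt (x j) * sqrt (x j))"
      by (simp only: mult_ac)
    then have sq: "sqrt (x i) * sqrt (x j) * (sqrt (x i) * sqrt (x j)) = x i * x j"
      using x[OF *(1)] x[OF *(3)] by simp
    have "x l * (Q (\<nu> (s (i, a)) (s (j, b))) c * Q (\<nu>' (s (i, a)) (s (j, b))) c)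
      = f i j l * f' i j l * x l * (Q (br a b) c)\<^sup>2 / (sqrt (x i) * sqrt (x j) * (sqrt (x i) * sqrt (x j)))"
      unfolding \<nu>[OF *(1,3,5,2,4,6)] \<nu>'[OF *(1,3,5,2,4,6)] by (simp add: power2_eq_square)
    then show "x l * (Q (\<nu> (s (i, a)) (s (j, b))) c * Q (\<nu>' (s (i, a)) (s (j, b))) c)
      = f i j l * f' i j l * (x l / (x i * x j)) * (Q (br a b) c)\<^sup>2" unfolding sq by simp
  qed
  \<comment> \<open>Three exchanges bring the block indices outside, where multipliers and weight
    are constant; what remains inside is the structural constant.\<close>
  also have "\<dots> = (\<Sum>i\<in>{1..r}. \<Sum>j\<in>{1..r}. \<Sum>a\<in>E i. \<Sum>b\<in>E j.
      \<Sum>l\<in>{1..r}. \<Sum>c\<in>E l. f i j l * f' i j l * (x l / (x i * x j)) * (Q (br a b) c)\<^sup>2)"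
    by (intro sum.cong refl sum.swap)
  also have "\<dots> = (\<Sum>i\<in>{1..r}. \<Sum>j\<in>{1..r}. \<Sum>a\<in>E i. \<Sum>l\<in>{1..r}. \<Sum>b\<in>E j.
      \<Sum>c\<in>E l. f i j l * f' i j l * (x l / (x i * x j)) * (Q (br a b) c)\<^sup>2)"
    by (intro sum.cong refl sum.swap)
  also have "\<dots> = (\<Sum>i\<in>{1..r}. \<Sum>j\<in>{1..r}. \<Sum>l\<in>{1..r}. \<Sum>a\<in>E i. \<Sum>b\<in>E j.
      \<Sum>c\<in>E l. f i j l * f' i j l * (x l / (x i * x j)) * (Q (br a b) c)\<^sup>2)"
    by (intro sum.cong refl sum.swap)
  finally show ?thesis by (simp add: struct_const_def sum_distrib_left mult.assoc)
qed

section \<open>The form of L on the block projections\<close>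

context
  fixes br :: "'b \<Rightarrow> 'b \<Rightarrow> 'b"
  assumes br: "bilinear br" and br_skew: "\<And>X Y. br Y X = - br X Y"
    and br_adjoint: "\<And>X Y Z. Q (br X Y) Z = - Q Y (br X Z)"
begin

lemma struct_const_swap12: "struct_const Q br E i j l = struct_const Q br E j i l"
proof -
  have "Q (br a b) c = - Q (br b a) c" for a b c
    using br_skew[of b a] linear_neg[OF linear_Q_left, of "br a b" c] by simp
  then have sq: "(Q (br a b) c)\<^sup>2 = (Q (br b a) c)\<^sup>2" for a b c
    by (metis power2_minus)
  show ?thesis unfolding struct_const_def by (subst sum.swap) (intro sum.cong refl sq)
qed

lemma struct_const_swap23: "struct_const Q br E i j l = struct_const Q br E i l j"
proof -
  have sq: "(Q (br a b) c)\<^sup>2 = (Q (br a c) b)\<^sup>2" for a b c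
    by (subst br_adjoint) (simp add: Q_sym[of b])
  have "(\<Sum>b\<in>E j. \<Sum>c\<in>E l. (Q (br a b) c)\<^sup>2) = (\<Sum>c\<in>E l. \<Sum>b\<in>E j. (Q (br a c) b)\<^sup>2)" for a
    by (subst sum.swap) (intro sum.cong refl sq)
  then show ?thesis unfolding struct_const_def by simp
qed

lemma bilinear_pr_br: "bilinear (\<lambda>X Y. pr (br X Y))"
  using br linear_compose[OF _ linear_pr] unfolding bilinear_def o_def by blast

text \<open>The rescaled basis vectors are eigenvectors of \<open>blk k\<close>, which gives the two
  negative deltas. The positive one arises by moving the Q-self-adjoint \<open>blk k\<close> onto
  \<open>c\<close>.\<close>

lemma Q_theta_blk:
  assumes k: "k \<in> {1..r}" and i: "i \<in> {1..r}" "a \<in> E i" and j: "j \<in> {1..r}" "b \<in> E j"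
    and l: "l \<in> {1..r}" "c \<in> E l"
  shows "Q (theta (blk k) (\<lambda>X Y. pr (br X Y)) (s (i, a)) (s (j, b))) c =
    (of_bool (l = k) - of_bool (i = k) - of_bool (j = k)) * (Q (br a b) c / (sqrt (x i) * sqrt (x j)))"
    and "Q (pr (br (s (i, a)) (s (j, b)))) c = Q (br a b) c / (sqrt (x i) * sqrt (x j))"
proof -
  define S S' where "S = s (i, a)" and "S' = s (j, b)"
  have lbr: "linear (br X)" "linear (\<lambda>X. br X Y)" for X Y using br by (auto simp: bilinear_def)
  have c: "c \<in> P l" "c \<in> \<pp>" using E_in[OF l] P_sub[OF l(1)] by auto
  have base: "Q (pr (br S S')) c = Q (br a b) c / (sqrt (x i) * sqrt (x j))"
    unfolding Q_pr[OF c(2)] S_def S'_def s_def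
    by (simp add: linear_cmul[OF lbr(1)] linear_cmul[OF lbr(2)] Q_simps)
  then show "Q (pr (br (s (i, a)) (s (j, b)))) c = Q (br a b) c / (sqrt (x i) * sqrt (x j))"
    by (simp only: S_def S'_def)
  have S: "blinfun_apply (blk k) S = of_bool (i = k) *\<^sub>R S" "blinfun_apply (blk k) S' = of_bool (j = k) *\<^sub>R S'"
    unfolding S_def S'_def blk_s[OF k i] blk_s[OF k j] by simp_all
  have blk_c: "blinfun_apply (blk k) c = of_bool (l = k) *\<^sub>R c"
    using blk_P[OF k, of c] blk_other[OF k l(1) _ c(1)] c(1) by (cases "l = k") simp_all
  have "theta (blk k) (\<lambda>X Y. pr (br X Y)) S S' =
      blinfun_apply (blk k) (pr (br S S')) - of_bool (i = k) *\<^sub>R pr (br S S') - of_bool (j = k) *\<^sub>R pr (br S S')"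
    unfolding theta_def S
    by (simp only: linear_cmul[OF lbr(1)] linear_cmul[OF lbr(2)] linear_cmul[OF linear_pr])
  then have "Q (theta (blk k) (\<lambda>X Y. pr (br X Y)) S S') c =
     (of_bool (l = k) - of_bool (i = k) - of_bool (j = k)) * Q (pr (br S S')) c"
    by (simp only: Q_simps Q_blk blk_c left_diff_distrib)
  then show "Q (theta (blk k) (\<lambda>X Y. pr (br X Y)) (s (i, a)) (s (j, b))) c =
    (of_bool (l = k) - of_bool (i = k) - of_bool (j = k)) * (Q (br a b) c / (sqrt (x i) * sqrt (x j)))"
    unfolding base by (simp only: S_def S'_def)
qed

lemma blk_compose: "k \<in> {1..r} \<Longrightarrow> m \<in> {1..r} \<Longrightarrow> blk k o\<^sub>L blk m = (if k = m then blk k else 0)"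
  using blk_P[OF _ blk_in] blk_other[OF _ _ _ blk_in] by (intro blinfun_eqI) auto

text \<open>Distinct block projections compose to zero, so the moment map term disappears and only
  the product of the two theta weights is left.\<close>

lemma L_form_blk_offdiag:
  assumes k: "k \<in> {1..r}" and m: "m \<in> {1..r}" and km: "k \<noteq> m"
  shows "L_form (\<lambda>X Y. pr (br X Y)) (blk m) (blk k) =
    (\<Sum>i\<in>{1..r}. ((x i)\<^sup>2 - (x k)\<^sup>2 - (x m)\<^sup>2) / (x i * x k * x m) * struct_const Q br E i k m)"
proof -
  let ?\<nu> = "\<lambda>X Y. pr (br X Y)"
  define w where "w i j l = x l / (x i * x j) * struct_const Q br E i j l" for i j l
  have w_sym: "w i j l = w j i l" for i j l
    unfolding w_def by (subst struct_const_swap12) (simp only: mult.commute)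
  have "theta 0 ?\<nu> X Y = 0" for X Y
    using theta_scale[OF bilinear_pr_br, of 0 0 X Y] by simp
  then have "bracket_inner \<pp> ip (theta 0 ?\<nu>) ?\<nu> = 0"
    unfolding bracket_inner_eq[OF onb_B bilinear_theta[OF bilinear_pr_br] bilinear_pr_br] by (simp add: ip_simps)
  then have "L_form ?\<nu> (blk m) (blk k) = 1/2 * bracket_inner \<pp> ip (theta (blk m) ?\<nu>) (theta (blk k) ?\<nu>)"
    unfolding L_form_def blk_compose[OF k m] using km by simp
  also have "bracket_inner \<pp> ip (theta (blk m) ?\<nu>) (theta (blk k) ?\<nu>) = (\<Sum>i\<in>{1..r}. \<Sum>j\<in>{1..r}. \<Sum>l\<in>{1..r}.
     (of_bool (l = m) - of_bool (i = m) - of_bool (j = m)) * (of_bool (l = k) - of_bool (i = k) - of_bool (j = k)) * w i j l)"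
    unfolding w_def
    by (rule bracket_inner_diag[OF bilinear_theta[OF bilinear_pr_br] bilinear_theta[OF bilinear_pr_br]];
        rule Q_theta_blk(1)[OF m] Q_theta_blk(1)[OF k]; assumption)
  also have "1/2 * \<dots> = (\<Sum>i\<in>{1..r}. w k m i - w i m k - w i k m)"
    by (rule delta_sum_offdiag[OF _ k m km w_sym]) simp
  also have "\<dots> = (\<Sum>i\<in>{1..r}. ((x i)\<^sup>2 - (x k)\<^sup>2 - (x m)\<^sup>2) / (x i * x k * x m) * struct_const Q br E i k m)"
  proof (intro sum.cong refl)
    fix i assume i: "i \<in> {1..r}"
    \<comment> \<open>By total symmetry all three weights carry the same structural constant, and
      their coefficients combine over the common denominator \<open>x i * x k * x m\<close>.\<close>
    define c where "c = struct_const Q br E i k m"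
    have cc: "struct_const Q br E k m i = c" "struct_const Q br E i m k = c"
      unfolding c_def by (metis struct_const_swap12 struct_const_swap23)+
    show "w k m i - w i m k - w i k m = ((x i)\<^sup>2 - (x k)\<^sup>2 - (x m)\<^sup>2) / (x i * x k * x m) * struct_const Q br E i k m"
      unfolding w_def cc c_def[symmetric] using x[OF i] x[OF k] x[OF m]
      by (simp add: field_simps power2_eq_square)
  qed
  finally show ?thesis .
qed

text \<open>\<open>blk k\<close> is idempotent, so the moment map term contributes the weight to the
  first power next to its square.\<close>

lemma L_form_blk_diag:
  assumes k: "k \<in> {1..r}"
  shows "L_form (\<lambda>X Y. pr (br X Y)) (blk k) (blk k) =
    (\<Sum>i\<in>{1..r} - {k}. \<Sum>j\<in>{1..r} - {k}. x k / (x i * x j) * struct_const Q br E i j k)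
    + (\<Sum>i\<in>{1..r} - {k}. x i / (x k)\<^sup>2 * struct_const Q br E i k k)"
proof -
  let ?\<nu> = "\<lambda>X Y. pr (br X Y)"
  define w where "w i j l = x l / (x i * x j) * struct_const Q br E i j l" for i j l
  have b1: "bracket_inner \<pp> ip (theta (blk k) ?\<nu>) (theta (blk k) ?\<nu>) = (\<Sum>i\<in>{1..r}. \<Sum>j\<in>{1..r}. \<Sum>l\<in>{1..r}.
     (of_bool (l = k) - of_bool (i = k) - of_bool (j = k)) * (of_bool (l = k) - of_bool (i = k) - of_bool (j = k)) * w i j l)"
    unfolding w_def
    by (rule bracket_inner_diag[OF bilinear_theta[OF bilinear_pr_br] bilinear_theta[OF bilinear_pr_br]];
        rule Q_theta_blk(1)[OF k]; assumption)
  have b2: "bracket_inner \<pp> ip (theta (blk k) ?\<nu>) ?\<nu> = (\<Sum>i\<in>{1..r}. \<Sum>j\<in>{1..r}. \<Sum>l\<in>{1..r}.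
     (of_bool (l = k) - of_bool (i = k) - of_bool (j = k)) * 1 * w i j l)"
    unfolding w_def
  proof (rule bracket_inner_diag[OF bilinear_theta[OF bilinear_pr_br] bilinear_pr_br])
    fix i j l a b c assume *: "i \<in> {1..r}" "j \<in> {1..r}" "l \<in> {1..r}" "a \<in> E i" "b \<in> E j" "c \<in> E l"
    show "Q (theta (blk k) ?\<nu> (s (i, a)) (s (j, b))) c =
      (of_bool (l = k) - of_bool (i = k) - of_bool (j = k)) * (Q (br a b) c / (sqrt (x i) * sqrt (x j)))"
      by (rule Q_theta_blk(1)[OF k *(1,4,2,5,3,6)])
    show "Q (pr (br (s (i, a)) (s (j, b)))) c = 1 * (Q (br a b) c / (sqrt (x i) * sqrt (x j)))"
      using Q_theta_blk(2)[OF k *(1,4,2,5,3,6)] by simp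
  qed
  have b3: "blk k o\<^sub>L blk k = blk k" using blk_compose[OF k k] by simp
  have "L_form ?\<nu> (blk k) (blk k) =
      (\<Sum>i\<in>{1..r} - {k}. \<Sum>j\<in>{1..r} - {k}. w i j k) + (\<Sum>l\<in>{1..r} - {k}. w k k l)"
    unfolding L_form_def b1 b2 b3 mult_1_right by (rule delta_sum_diag[OF finite_atLeastAtMost k])
  moreover have "w k k l = x l / (x k)\<^sup>2 * struct_const Q br E l k k" for l
    unfolding w_def power2_eq_square
    by (simp only: struct_const_swap23[of k k l] struct_const_swap12[of k l k])
  ultimately show ?thesis by (simp only: w_def)
qed

end

lemma L_form_scale_left:
  assumes \<nu>: "bilinear \<nu>" shows "L_form \<nu> (c *\<^sub>R A) C = c * L_form \<nu> A C"
proof -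
  have l: "linear (\<lambda>A. bracket_inner \<pp> ip (theta A \<nu>) \<nu>)" "linear (\<lambda>A. bracket_inner \<pp> ip (theta A \<nu>) (theta C \<nu>))"
    by (intro linear_bracket_inner_theta bilinear_theta \<nu>)+
  have "C o\<^sub>L (c *\<^sub>R A) = c *\<^sub>R (C o\<^sub>L A)" by (auto intro!: blinfun_eqI simp: blinfun.bilinear_simps)
  then show ?thesis
    by (simp add: L_form_def linear_cmul[OF l(1)] linear_cmul[OF l(2)] algebra_simps)
qed

section \<open>Invariant symmetric maps under the isotropy representation\<close>

context
  fixes \<rho> :: "'g \<Rightarrow> 'b \<Rightarrow> 'b" and K :: "'g set"
  assumes \<rho>_linear: "\<And>g. g \<in> K \<Longrightarrow> linear (\<rho> g)"
    and \<rho>_Q: "\<And>g X Y. g \<in> K \<Longrightarrow> Q (\<rho> g X) (\<rho> g Y) = Q X Y"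
    and irred: "\<And>i. i \<in> {1..r} \<Longrightarrow> irreducible_subrep \<rho> K (P i)"
begin

lemma \<rho>_P: "i \<in> {1..r} \<Longrightarrow> g \<in> K \<Longrightarrow> X \<in> P i \<Longrightarrow> \<rho> g X \<in> P i"
  using irred[of i] unfolding irreducible_subrep_def invariant_subspace_def by blast

lemma \<rho>_sum_blk: assumes "g \<in> K" "X \<in> \<pp>"
  shows "\<rho> g X = (\<Sum>i\<in>{1..r}. \<rho> g (blinfun_apply (blk i) X))"
  using linear_sum[OF \<rho>_linear[OF assms(1)], of "\<lambda>i. blinfun_apply (blk i) X" "{1..r}"] sum_blk[OF assms(2)]
  by (simp only: o_def)

lemma \<rho>_p: assumes "g \<in> K" "X \<in> \<pp>" shows "\<rho> g X \<in> \<pp>"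
proof -
  have "\<rho> g (blinfun_apply (blk i) X) \<in> \<pp>" if "i \<in> {1..r}" for i
    using \<rho>_P[OF that assms(1) blk_in[OF that]] P_sub[OF that] by blast
  then show ?thesis unfolding \<rho>_sum_blk[OF assms] by (rule subspace_sum[OF p])
qed

lemma blk_\<rho>:
  assumes k: "k \<in> {1..r}" and g: "g \<in> K" and X: "X \<in> \<pp>"
  shows "blinfun_apply (blk k) (\<rho> g X) = \<rho> g (blinfun_apply (blk k) X)"
proof -
  have "blinfun_apply (blk k) (\<rho> g X) = (\<Sum>i\<in>{1..r}. blinfun_apply (blk k) (\<rho> g (blinfun_apply (blk i) X)))"
    unfolding \<rho>_sum_blk[OF g X] by (rule blinfun.sum_right)
  also have "\<dots> = (\<Sum>i\<in>{1..r}. if i = k then \<rho> g (blinfun_apply (blk i) X) else 0)"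
  proof (intro sum.cong refl)
    fix i assume i: "i \<in> {1..r}"
    have m: "\<rho> g (blinfun_apply (blk i) X) \<in> P i" by (rule \<rho>_P[OF i g blk_in[OF i]])
    show "blinfun_apply (blk k) (\<rho> g (blinfun_apply (blk i) X)) = (if i = k then \<rho> g (blinfun_apply (blk i) X) else 0)"
      using m blk_P[OF k] blk_other[OF k i _ m] by (cases "i = k") simp_all
  qed
  finally show ?thesis using k by simp
qed

text \<open>Here \<open>\<rho>\<close> is only a family of linear isometries, with no inverses
  given. Injectivity and a dimension count on \<open>\<pp>\<close> replace the inverse.\<close>

lemma \<rho>_surj: assumes g: "g \<in> K" and Z: "Z \<in> \<pp>" shows "\<exists>Z'\<in>\<pp>. Z = \<rho> g Z'"
proof -
  have z: "X = 0" if "\<rho> g X = 0" for X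
  proof (rule ccontr)
    assume "X \<noteq> 0"
    then have "0 < Q X X" by (rule Q_pos)
    moreover have "Q X X = 0" using \<rho>_Q[OF g, of X X] that by (simp add: Q_simps)
    ultimately show False by simp
  qed
  have "inj (\<rho> g)" unfolding linear_injective_0[OF \<rho>_linear[OF g]] using z by blast
  then have "dim (\<rho> g ` \<pp>) = dim \<pp>"
    using dim_image_eq[OF \<rho>_linear[OF g]] inj_on_subset by blast
  moreover have "\<rho> g ` \<pp> \<subseteq> \<pp>" using \<rho>_p[OF g] by blast
  moreover have "subspace (\<rho> g ` \<pp>)" by (rule linear_subspace_image[OF \<rho>_linear[OF g] p])
  ultimately have "\<rho> g ` \<pp> = \<pp>" using subspace_dim_equal[OF _ p] by simp
  then show ?thesis using Z by blast
qed

text \<open>Stability of \<open>\<kk>\<close> is deduced from that of its orthogonal complement,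
  which avoids conjugating one-parameter subgroups. It makes \<open>pr\<close> equivariant.\<close>

lemma \<rho>_k: assumes g: "g \<in> K" and Y: "Y \<in> \<kk>" shows "\<rho> g Y \<in> \<kk>"
  unfolding k_iff
proof
  fix Z assume "Z \<in> \<pp>"
  then obtain Z' where "Z' \<in> \<pp>" "Z = \<rho> g Z'" using \<rho>_surj[OF g] by blast
  then show "Q (\<rho> g Y) Z = 0" using \<rho>_Q[OF g, of Y Z'] kp_orth[OF Y] by simp
qed

lemma pr_\<rho>: assumes g: "g \<in> K" shows "pr (\<rho> g Z) = \<rho> g (pr Z)"
proof -
  have "pr (\<rho> g (Z - pr Z)) = 0" by (rule pr_k[OF \<rho>_k[OF g diff_pr]])
  then have "pr (\<rho> g Z) = pr (\<rho> g (pr Z))"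
    by (simp add: linear_diff[OF \<rho>_linear[OF g]] linear_diff[OF linear_pr])
  then show ?thesis using pr_p[OF \<rho>_p[OF g pr_in]] by simp
qed

lemma ip_\<rho>: assumes g: "g \<in> K" and X: "X \<in> \<pp>" shows "ip (\<rho> g X) (\<rho> g Y) = ip X Y"
  unfolding ip_eq by (intro sum.cong refl) (simp add: blk_\<rho>[OF _ g X] \<rho>_Q[OF g])

lemma L_op_sym_inv:
  assumes br: "bilinear br"
    and equiv: "\<And>g X Y. g \<in> K \<Longrightarrow> \<rho> g (br X Y) = br (\<rho> g X) (\<rho> g Y)"
    and A: "A \<in> sym_inv_on \<kk> \<pp> ip \<rho> K"
  shows "L_op \<kk> \<pp> ip (\<lambda>X Y. pr (br X Y)) A \<in> sym_inv_on \<kk> \<pp> ip \<rho> K"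
proof -
  let ?\<nu> = "\<lambda>X Y. pr (br X Y)"
  have \<nu>: "bilinear ?\<nu>"
    using br linear_compose[OF _ linear_pr] unfolding bilinear_def o_def by blast
  have As: "A \<in> sym_on \<kk> \<pp> ip" and AK: "\<And>g X. g \<in> K \<Longrightarrow> X \<in> \<pp> \<Longrightarrow> blinfun_apply A (\<rho> g X) = \<rho> g (blinfun_apply A X)"
    using A by (auto simp: sym_inv_on_def)
  have Ap: "blinfun_apply A X \<in> \<pp>" for X using As gl_p by (simp add: sym_on_iff)
  have Ls: "L_op \<kk> \<pp> ip ?\<nu> A \<in> sym_on \<kk> \<pp> ip" by (rule L_op(1)[OF \<nu> As])
  have Lp: "blinfun_apply (L_op \<kk> \<pp> ip ?\<nu> A) X \<in> \<pp>" for X using Ls gl_p by (simp add: sym_on_iff)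
  have "blinfun_apply (L_op \<kk> \<pp> ip ?\<nu> A) (\<rho> g X) = \<rho> g (blinfun_apply (L_op \<kk> \<pp> ip ?\<nu> A) X)"
    if g: "g \<in> K" and X: "X \<in> \<pp>" for g X
  proof -
    \<comment> \<open>The action of \<open>g\<close> on \<open>\<pp>\<close>, cut off to zero on
      \<open>\<kk>\<close> so that it belongs to \<open>gl_on\<close>.\<close>
    define R where "R = Blinfun (\<lambda>X. \<rho> g (pr X))"
    have "linear (\<lambda>X. \<rho> g (pr X))"
      using linear_compose[OF linear_pr \<rho>_linear[OF g]] by (simp only: o_def)
    then have R: "blinfun_apply R X = \<rho> g (pr X)" for X
      unfolding R_def by (simp only: Blinfun_linear)
    have Rp: "blinfun_apply R X = \<rho> g X" if "X \<in> \<pp>" for X using that by (simp only: R pr_p)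
    have R_gl: "R \<in> gl_on \<kk> \<pp>"
      unfolding gl_on_def by (auto simp: R \<rho>_p[OF g pr_in] pr_k linear_0[OF \<rho>_linear[OF g]])
    have "blinfun_apply (L_op \<kk> \<pp> ip ?\<nu> A) (blinfun_apply R X) = blinfun_apply R (blinfun_apply (L_op \<kk> \<pp> ip ?\<nu> A) X)"
    proof (rule L_op_commute[OF R_gl _ \<nu> _ _ As _ X])
      show "ip (blinfun_apply R X) (blinfun_apply R Y) = ip X Y" if "X \<in> \<pp>" "Y \<in> \<pp>" for X Y
        using ip_\<rho>[OF g that(1)] that by (simp only: Rp)
      show "pr (br X Y) \<in> \<pp>" for X Y by (rule pr_in)
      show "pr (br (blinfun_apply R X) (blinfun_apply R Y)) = blinfun_apply R (pr (br X Y))"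
        if "X \<in> \<pp>" "Y \<in> \<pp>" for X Y
        using that by (simp only: Rp Rp[OF pr_in] equiv[OF g, symmetric] pr_\<rho>[OF g])
      show "blinfun_apply A (blinfun_apply R X) = blinfun_apply R (blinfun_apply A X)" if "X \<in> \<pp>" for X
        using that by (simp only: Rp Rp[OF Ap] AK[OF g])
    qed
    then show ?thesis using X by (simp only: Rp Rp[OF Lp])
  qed
  then show ?thesis using Ls by (simp add: sym_inv_on_def)
qed

lemma blk_sym_inv: "k \<in> {1..r} \<Longrightarrow> blk k \<in> sym_inv_on \<kk> \<pp> ip \<rho> K"
  using blk_sym blk_\<rho> by (simp add: sym_inv_on_def)

text \<open>Each compression of \<open>A\<close> from \<open>P k\<close> to \<open>P j\<close> is an
  intertwiner: zero for different blocks by inequivalence, a scalar on the diagonal by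
  symmetry.\<close>

lemma sym_inv_eq_sum_blk:
  assumes inequiv: "\<And>i j. i \<in> {1..r} \<Longrightarrow> j \<in> {1..r} \<Longrightarrow> i \<noteq> j \<Longrightarrow> \<not> equivalent_subreps \<rho> K (P i) (P j)"
    and A: "A \<in> sym_inv_on \<kk> \<pp> ip \<rho> K"
  shows "\<exists>\<kappa>. A = (\<Sum>k\<in>{1..r}. \<kappa> k *\<^sub>R blk k)"
proof -
  have As: "A \<in> gl_on \<kk> \<pp>" "adj A = A" and AK: "\<And>g X. g \<in> K \<Longrightarrow> X \<in> \<pp> \<Longrightarrow> blinfun_apply A (\<rho> g X) = \<rho> g (blinfun_apply A X)"
    using A by (auto simp: sym_inv_on_def sym_on_iff)
  have Pp: "X \<in> \<pp>" if "i \<in> {1..r}" "X \<in> P i" for i X using P_sub that by blast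
  have comm: "blinfun_apply (blk j o\<^sub>L A) (\<rho> g v) = \<rho> g (blinfun_apply (blk j o\<^sub>L A) v)"
    if "j \<in> {1..r}" "i \<in> {1..r}" "g \<in> K" "v \<in> P i" for i j g v
    using Pp[OF that(2,4)] by (simp add: AK[OF that(3)] blk_\<rho>[OF that(1,3)] gl_p[OF As(1)])
  have off: "blinfun_apply (blk j) (blinfun_apply A v) = 0"
    if "j \<in> {1..r}" "k \<in> {1..r}" "k \<noteq> j" "v \<in> P k" for j k v
  proof -
    have "blinfun_apply (blk j o\<^sub>L A) v = 0"
    proof (rule schur_zero[where f="blinfun_apply (blk j o\<^sub>L A)",
          OF irred[OF that(2)] irred[OF that(1)] inequiv[OF that(2,1,3)] _ linear_blinfun _ _ that(4)])
      show "linear (\<rho> g)" if "g \<in> K" for g by (rule \<rho>_linear[OF that])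
      show "blinfun_apply (blk j o\<^sub>L A) u \<in> P j" for u
        unfolding blinfun_apply_blinfun_compose by (rule blk_in[OF that(1)])
      show "blinfun_apply (blk j o\<^sub>L A) (\<rho> g u) = \<rho> g (blinfun_apply (blk j o\<^sub>L A) u)"
        if "g \<in> K" "u \<in> P k" for g u
        by (rule comm[OF \<open>j \<in> {1..r}\<close> \<open>k \<in> {1..r}\<close> that])
    qed
    then show ?thesis by simp
  qed
  have ex: "\<exists>c. \<forall>v\<in>P k. blinfun_apply (blk k o\<^sub>L A) v = c *\<^sub>R v" if k: "k \<in> {1..r}" for k
  proof (rule schur_symmetric_scalar[where f="blinfun_apply (blk k o\<^sub>L A)",
        OF irred[OF k] _ bilinear_Q Q_sym Q_pos linear_blinfun])
    show "linear (\<rho> g)" if "g \<in> K" for g by (rule \<rho>_linear[OF that])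
    show "blinfun_apply (blk k o\<^sub>L A) X \<in> P k" for X
      unfolding blinfun_apply_blinfun_compose by (rule blk_in[OF k])
    show "blinfun_apply (blk k o\<^sub>L A) (\<rho> g u) = \<rho> g (blinfun_apply (blk k o\<^sub>L A) u)"
      if "g \<in> K" "u \<in> P k" for g u by (rule comm[OF k k that])
    fix X Y assume XY: "X \<in> P k" "Y \<in> P k"
    \<comment> \<open>On \<open>P k\<close> the metric is \<open>x k\<close> times \<open>Q\<close>,
      so the symmetry of \<open>A\<close> for the metric becomes Q-symmetry of its compression, as
      the scalar form of Schur's lemma requires.\<close>
    have e: "x k * Q (blinfun_apply (blk k o\<^sub>L A) X) Y = ip (blinfun_apply A X) Y" if "Y \<in> P k" for X Y
      unfolding ip_sym[of "blinfun_apply A X" Y] ip_P[OF k that] blinfun_apply_blinfun_compose Q_blk blk_P[OF k that]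
      by (simp only: Q_sym)
    have "x k * Q (blinfun_apply (blk k o\<^sub>L A) X) Y = x k * Q (blinfun_apply (blk k o\<^sub>L A) Y) X"
      unfolding e[OF XY(1)] e[OF XY(2)] ip_adj[OF As(1), of X Y] As(2) by (rule ip_sym)
    then show "Q (blinfun_apply (blk k o\<^sub>L A) X) Y = Q X (blinfun_apply (blk k o\<^sub>L A) Y)"
      using x[OF k] by (simp add: Q_sym[of X])
  qed
  have "\<forall>k\<in>{1..r}. \<exists>c. \<forall>v\<in>P k. blinfun_apply (blk k o\<^sub>L A) v = c *\<^sub>R v"
    using ex by (rule ballI)
  from bchoice[OF this] obtain c
    where "\<forall>k\<in>{1..r}. \<forall>v\<in>P k. blinfun_apply (blk k o\<^sub>L A) v = c k *\<^sub>R v" by (rule exE)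
  then have c: "blinfun_apply (blk k) (blinfun_apply A v) = c k *\<^sub>R v" if "k \<in> {1..r}" "v \<in> P k" for k v
    using that by simp
  have "A = (\<Sum>k\<in>{1..r}. c k *\<^sub>R blk k)"
  proof (rule gl_on_P_eqI[OF As(1)])
    show "(\<Sum>k\<in>{1..r}. c k *\<^sub>R blk k) \<in> gl_on \<kk> \<pp>"
      by (intro subspace_sum subspace_scale subspace_gl blk_gl)
    fix i X assume i: "i \<in> {1..r}" "X \<in> P i"
    have "blinfun_apply A X = (\<Sum>j\<in>{1..r}. blinfun_apply (blk j) (blinfun_apply A X))"
      by (rule sum_blk[OF gl_p[OF As(1)], symmetric])
    also have "\<dots> = (\<Sum>j\<in>{1..r}. c j *\<^sub>R blinfun_apply (blk j) X)"
    proof (intro sum.cong refl)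
      fix j assume j: "j \<in> {1..r}"
      show "blinfun_apply (blk j) (blinfun_apply A X) = c j *\<^sub>R blinfun_apply (blk j) X"
        using c[OF i] off[OF j i(1) _ i(2)] blk_P[OF i] blk_other[OF j i(1) _ i(2)] by (cases "i = j") simp_all
    qed
    finally show "blinfun_apply A X = blinfun_apply (\<Sum>k\<in>{1..r}. c k *\<^sub>R blk k) X"
      by (simp only: blinfun.sum_left blinfun.scaleR_left)
  qed
  then show ?thesis by blast
qed

end

end

theorem theorem1p2:
  fixes G :: "('g, 'z) monoid_scheme" (structure)
    and T :: "'g topology" and \<A> :: "('g set \<times> ('g \<Rightarrow> 'b::euclidean_space)) set"
    and TM :: "'m topology" and \<A>M :: "('m set \<times> ('m \<Rightarrow> 'c::euclidean_space)) set"
    and act :: "'g \<Rightarrow> 'm \<Rightarrow> 'm" and pt :: 'm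
    and U :: "'g set" and \<phi> :: "'g \<Rightarrow> 'b"
    and K :: "'g set" and \<kk> \<pp> :: "'b set" and Q :: "'b \<Rightarrow> 'b \<Rightarrow> real"
    and r :: nat and P :: "nat \<Rightarrow> 'b set" and E :: "nat \<Rightarrow> 'b set"
    and x :: "nat \<Rightarrow> real" and ip :: "'b \<Rightarrow> 'b \<Rightarrow> real"
    and d :: "nat \<Rightarrow> real" and c :: "nat \<Rightarrow> nat \<Rightarrow> nat \<Rightarrow> real"
    and \<mu> :: "'b \<Rightarrow> 'b \<Rightarrow> 'b" and L :: "('b \<Rightarrow>\<^sub>L 'b) \<Rightarrow> ('b \<Rightarrow>\<^sub>L 'b)"
    and S :: "('b \<Rightarrow>\<^sub>L 'b) set" and e :: "nat \<Rightarrow> ('b \<Rightarrow>\<^sub>L 'b)"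
  assumes homogeneous: "compact_homogeneous_space G T \<A> TM \<A>M act"
    and pt: "pt \<in> topspace TM"
    and K: "K = stabilizer G act pt"
    and chart: "(U, \<phi>) \<in> \<A>" "\<one> \<in> U"
    and Q: "inner_product_on UNIV Q"
    and Q_inv: "\<And>g X Y. g \<in> carrier G \<Longrightarrow> Q (Ad G U \<phi> g X) (Ad G U \<phi> g Y) = Q X Y"
    and k: "\<kk> = lie_subalgebra G T \<phi> K"
    and p: "subspace \<pp>"
    and kp_sum: "\<And>X. \<exists>Y\<in>\<kk>. \<exists>Z\<in>\<pp>. X = Y + Z"
    and kp_orth: "\<And>Y Z. Y \<in> \<kk> \<Longrightarrow> Z \<in> \<pp> \<Longrightarrow> Q Y Z = 0"
    and decomp: "orthogonal_decomposition Q \<pp> {1..r} P"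
    and irred: "\<And>i. i \<in> {1..r} \<Longrightarrow> irreducible_subrep (Ad G U \<phi>) K (P i)"
    and inequiv: "\<And>i j. i \<in> {1..r} \<Longrightarrow> j \<in> {1..r} \<Longrightarrow> i \<noteq> j \<Longrightarrow>
          \<not> equivalent_subreps (Ad G U \<phi>) K (P i) (P j)"
    and E: "\<And>i. i \<in> {1..r} \<Longrightarrow> orthonormal_basis (P i) Q (E i)"
    and x: "\<And>i. i \<in> {1..r} \<Longrightarrow> x i > 0"
    and ip: "ip = diag_metric \<kk> \<pp> r P Q x"
    and d: "\<And>i. d i = real (dim (P i))"
    and c: "\<And>i j k. c i j k = struct_const Q (lie_bracket G U \<phi>) E i j k"
    and \<mu>: "\<And>X Y. \<mu> X Y = proj_along \<kk> \<pp> (lie_bracket G U \<phi> X Y)"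
    and L: "L = L_op \<kk> \<pp> ip \<mu>"
    and S: "S = sym_inv_on \<kk> \<pp> ip (Ad G U \<phi>) K"
    and e: "\<And>k. e k = (1 / sqrt (d k)) *\<^sub>R block_id \<kk> \<pp> r P k"
  shows "inj_on e {1..r} \<and> orthonormal_basis S (gl_inner \<kk> \<pp> ip) (e ` {1..r})
    \<and> L ` S \<subseteq> S
    \<and> (\<forall>k\<in>{1..r}. matrix_entry {1..r} e L k k =
          1 / d k * (\<Sum>i\<in>{1..r} - {k}. \<Sum>j\<in>{1..r} - {k}. x k / (x i * x j) * c i j k)
        + 1 / d k * (\<Sum>i\<in>{1..r} - {k}. x i / (x k)\<^sup>2 * c i k k))
    \<and> (\<forall>k\<in>{1..r}. \<forall>m\<in>{1..r}. k \<noteq> m \<longrightarrow> matrix_entry {1..r} e L k m =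
          1 / (sqrt (d k) * sqrt (d m)) *
          (\<Sum>i\<in>{1..r}. ((x i)\<^sup>2 - (x k)\<^sup>2 - (x m)\<^sup>2) / (x i * x k * x m) * c i k m))"
proof -
  interpret H: compact_homogeneous_space G T \<A> TM \<A>M act by (rule homogeneous)
  interpret lie_group_chart G T \<A> U \<phi>
    by (intro lie_group_chart.intro lie_group_chart_axioms.intro H.lie_group_axioms chart)
  interpret D: diagonal_metric \<kk> \<pp> Q r P E x
    by (intro diagonal_metric.intro Q p kp_sum kp_orth decomp E x)
  define br where "br = lie_bracket G U \<phi>"
  define \<rho> where "\<rho> = Ad G U \<phi>"
  have KG: "g \<in> carrier G" if "g \<in> K" for g using that by (simp add: K stabilizer_def)
  have br: "bilinear br"
    unfolding bilinear_def br_def using linear_lie_bracket_left linear_lie_bracket_right by blast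
  have br_skew: "br Y X = - br X Y" for X Y unfolding br_def by (rule lie_bracket_skew)
  have br_adj: "Q (br X Y) Z = - Q Y (br X Z)" for X Y Z
    unfolding br_def by (rule lie_bracket_skew_adjoint[OF D.bilinear_Q Q_inv])
  have \<rho>_lin: "linear (\<rho> g)" if "g \<in> K" for g unfolding \<rho>_def by (rule linear_Ad[OF KG[OF that]])
  have \<rho>_Q: "Q (\<rho> g X) (\<rho> g Y) = Q X Y" if "g \<in> K" for g X Y
    unfolding \<rho>_def by (rule Q_inv[OF KG[OF that]])
  have \<rho>_br: "\<rho> g (br X Y) = br (\<rho> g X) (\<rho> g Y)" if "g \<in> K" for g X Y
    unfolding \<rho>_def br_def by (rule Ad_lie_bracket[OF KG[OF that]])
  note irr = irred[folded \<rho>_def] and ineq = inequiv[folded \<rho>_def]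
  have ip_D: "ip = D.ip" unfolding ip D.ip_def ..
  define \<nu> where "\<nu> = (\<lambda>X Y. D.pr (br X Y))"
  have \<nu>: "bilinear \<nu>" unfolding \<nu>_def by (rule D.bilinear_pr_br[OF br br_skew br_adj])
  have "\<mu> = \<nu>" unfolding \<nu>_def br_def by (intro ext) (simp only: \<mu> D.proj_along_eq)
  then have L_D: "L = L_op \<kk> \<pp> D.ip \<nu>" by (simp only: L ip_D)
  have S_D: "S = sym_inv_on \<kk> \<pp> D.ip \<rho> K" by (simp only: S ip_D \<rho>_def)
  have c_D: "c i j l = struct_const Q br E i j l" for i j l by (simp only: c br_def)
  \<comment> \<open>Irreducible subspaces are nonzero by definition, so \<open>d i\<close> is
    positive. Otherwise \<open>1 / sqrt (d i)\<close> would be zero by the convention for division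
    and \<open>e i\<close> would vanish.\<close>
  have d_D: "d i = real (card (E i))" and d_pos: "d i > 0" if i: "i \<in> {1..r}" for i
  proof -
    have Ei: "independent (E i)" "span (E i) = P i"
      using orthonormal_basis_independent[OF D.bilinear_Q E[OF i]] E[OF i] by (auto simp: orthonormal_basis_def)
    show "d i = real (card (E i))"
      unfolding d Ei(2)[symmetric] by (simp only: dim_span_eq_card_independent[OF Ei(1)])
    moreover have "P i \<noteq> {0}" using irr[OF i] by (simp add: irreducible_subrep_def)
    then have "E i \<noteq> {}" using Ei(2) by auto
    then have "card (E i) > 0" using D.E_finite[OF i] by (simp add: card_gt_0_iff)
    ultimately show "d i > 0" by simp
  qed
  have e_D: "e k = (1 / sqrt (d k)) *\<^sub>R D.blk k" if "k \<in> {1..r}" for k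
    unfolding e D.block_id_eq[OF that] ..
  have subS: "subspace S" unfolding S_D by (rule D.subspace_sym_inv_on[OF \<rho>_lin])
  have S_gl: "A \<in> gl_on \<kk> \<pp>" if "A \<in> S" for A using that D.sym_inv_on_gl unfolding S_D by blast
  have blk_S: "D.blk k \<in> S" if "k \<in> {1..r}" for k
    unfolding S_D by (rule D.blk_sym_inv[OF \<rho>_lin \<rho>_Q irr that])
  have e_S: "e k \<in> S" if "k \<in> {1..r}" for k
    unfolding e_D[OF that] by (rule subspace_scale[OF subS blk_S[OF that]])
  have tl: "linear (D.trace_form A)" "linear (\<lambda>A. D.trace_form A C)" for A C
    using D.bilinear_trace_form by (auto simp: bilinear_def)
  have e_on: "D.trace_form (e k) (e m) = (if k = m then 1 else 0)" if k: "k \<in> {1..r}" and m: "m \<in> {1..r}" for k m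
  proof -
    have "D.trace_form (D.blk k) (D.blk m) = (if k = m then d k else 0)"
      using D.gl_inner_blk[OF k m] D.gl_inner_trace_form[OF D.blk_gl[OF k] D.blk_gl[OF m]] d_D[OF k] by (cases "k = m") simp_all
    then show ?thesis
      unfolding e_D[OF k] e_D[OF m] using d_pos[OF k]
      by (cases "k = m") (simp_all add: linear_cmul[OF tl(1)] linear_cmul[OF tl(2)])
  qed
  have inj: "inj_on e {1..r}"
  proof (rule inj_onI)
    fix k m assume km: "k \<in> {1..r}" "m \<in> {1..r}" "e k = e m"
    show "k = m" using e_on[OF km(1,2)] e_on[OF km(1,1)] km(3) by (simp split: if_splits)
  qed
  have span: "span (e ` {1..r}) = S"
  proof
    show "span (e ` {1..r}) \<subseteq> S" by (rule span_minimal[OF _ subS]) (use e_S in blast)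
    show "S \<subseteq> span (e ` {1..r})"
    proof
      fix A assume "A \<in> S"
      then obtain \<kappa> where A: "A = (\<Sum>k\<in>{1..r}. \<kappa> k *\<^sub>R D.blk k)"
        using D.sym_inv_eq_sum_blk[OF \<rho>_lin \<rho>_Q irr ineq] unfolding S_D by blast
      show "A \<in> span (e ` {1..r})" unfolding A
      proof (intro span_sum span_scale)
        fix k assume k: "k \<in> {1..r}"
        have "D.blk k = sqrt (d k) *\<^sub>R e k" unfolding e_D[OF k] using d_pos[OF k] by simp
        then show "D.blk k \<in> span (e ` {1..r})" using k by (simp add: span_base span_scale)
      qed
    qed
  qed
  have e_sub: "e ` {1..r} \<subseteq> S" using e_S by blast
  have tr_on: "D.trace_form u v = (if u = v then 1 else 0)"
    if uv: "u \<in> e ` {1..r}" "v \<in> e ` {1..r}" for u v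
  proof -
    obtain k m where k: "k \<in> {1..r}" "u = e k" and m: "m \<in> {1..r}" "v = e m" using uv by blast
    show ?thesis
      unfolding k(2) m(2) inj_on_eq_iff[OF inj k(1) m(1)] by (rule e_on[OF k(1) m(1)])
  qed
  \<comment> \<open>Orthonormality is first recorded for \<open>trace_form\<close>, since reading
    off coefficients needs a form known to be bilinear on the whole type; on \<open>S\<close> it
    coincides with \<open>gl_inner\<close>.\<close>
  have onb: "orthonormal_basis S D.trace_form (e ` {1..r})"
    unfolding orthonormal_basis_def by (intro conjI ballI e_sub span tr_on)
  have gl_tr: "gl_inner \<kk> \<pp> D.ip A C = D.trace_form A C" if "A \<in> S" "C \<in> S" for A C
    using D.gl_inner_trace_form S_gl that by blast
  have onb': "orthonormal_basis S (gl_inner \<kk> \<pp> ip) (e ` {1..r})"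
    unfolding orthonormal_basis_def ip_D
  proof (intro conjI ballI e_sub span)
    fix u v assume uv: "u \<in> e ` {1..r}" "v \<in> e ` {1..r}"
    have "gl_inner \<kk> \<pp> D.ip u v = D.trace_form u v"
      by (rule gl_tr[OF subsetD[OF e_sub uv(1)] subsetD[OF e_sub uv(2)]])
    then show "gl_inner \<kk> \<pp> D.ip u v = (if u = v then 1 else 0)"
      by (simp only: tr_on[OF uv])
  qed
  have LS: "L A \<in> S" if "A \<in> S" for A
  proof -
    have "A \<in> sym_inv_on \<kk> \<pp> D.ip \<rho> K" using that by (simp only: S_D)
    from D.L_op_sym_inv[OF \<rho>_lin \<rho>_Q irr br \<rho>_br this] show ?thesis
      by (simp only: L_D S_D \<nu>_def)
  qed
  have S_sym: "A \<in> sym_on \<kk> \<pp> D.ip" if "A \<in> S" for A using that by (simp add: S_D sym_inv_on_def)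
  \<comment> \<open>The coefficient of \<open>e k\<close> in \<open>L (e m)\<close> is their inner
    product, which the defining property of \<open>L_op\<close> turns into \<open>L_form\<close>;
    the two normalising factors come out by linearity in each argument.\<close>
  have entry: "matrix_entry {1..r} e L k m = 1 / (sqrt (d k) * sqrt (d m)) * D.L_form \<nu> (D.blk m) (D.blk k)"
    if k: "k \<in> {1..r}" and m: "m \<in> {1..r}" for k m
  proof -
    have "matrix_entry {1..r} e L k m = D.trace_form (L (e m)) (e k)"
      unfolding matrix_entry_def
      using orthonormal_basis_representation[OF D.bilinear_trace_form onb _ LS[OF e_S[OF m]]] k by simp
    also have "\<dots> = gl_inner \<kk> \<pp> D.ip (L (e m)) (e k)" by (rule gl_tr[OF LS[OF e_S[OF m]] e_S[OF k], symmetric])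
    also have "\<dots> = D.L_form \<nu> (e m) (e k)"
      unfolding L_D by (rule D.L_op(2)[OF \<nu> S_sym[OF e_S[OF m]] S_sym[OF e_S[OF k]]])
    finally show ?thesis
      unfolding e_D[OF k] e_D[OF m] by (simp add: D.L_form_scale_left[OF \<nu>] linear_cmul[OF D.linear_L_form[OF \<nu>]])
  qed
  have diag: "matrix_entry {1..r} e L k k =
          1 / d k * (\<Sum>i\<in>{1..r} - {k}. \<Sum>j\<in>{1..r} - {k}. x k / (x i * x j) * c i j k)
        + 1 / d k * (\<Sum>i\<in>{1..r} - {k}. x i / (x k)\<^sup>2 * c i k k)" if k: "k \<in> {1..r}" for k
  proof -
    have "sqrt (d k) * sqrt (d k) = d k" using d_pos[OF k] by simp
    then show ?thesis
      unfolding entry[OF k k] \<nu>_def D.L_form_blk_diag[OF br br_skew br_adj k] c_D by (simp only: distrib_left)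
  qed
  have off: "matrix_entry {1..r} e L k m = 1 / (sqrt (d k) * sqrt (d m)) *
          (\<Sum>i\<in>{1..r}. ((x i)\<^sup>2 - (x k)\<^sup>2 - (x m)\<^sup>2) / (x i * x k * x m) * c i k m)"
    if "k \<in> {1..r}" "m \<in> {1..r}" "k \<noteq> m" for k m
    unfolding entry[OF that(1,2)] \<nu>_def D.L_form_blk_offdiag[OF br br_skew br_adj that] c_D ..
  show ?thesis using inj onb' LS diag off by blast
qed

end
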